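(* Let $\alpha>-1$, and let $\varphi$ be a hyperbolic automorphism of $\mathbb{D}$ with Denjoy-Wolff point $a\in\partial\mathbb{D}$ and the other fixed point $b\in\partial\mathbb{D}$. Assume that $\psi\in H^\infty(\mathbb{D})$ is not identically zero and is continuous at the points $a$ and $b$. If the weighted composition operator $C_{\psi,\varphi}$ is not invertible on $A_\alpha^2(\mathbb{D})$, then the spectrum of $C_{\psi,\varphi}$ on $A_\alpha^2(\mathbb{D})$ is $$\left\{\lambda\in\mathbb{C} :|\lambda|\leqslant\max\left\{\frac{|\psi(a)|}{\varphi'(a)^{(\alpha+2)/2}},\frac{|\psi(b)|}{\varphi'(b)^{(\alpha+2)/2}}\right\}\right\}.$$
   Context: $\mathbb{D}$ is the open unit disk in $\mathbb{C}$. For $\alpha>-1$, the weighted Bergman space $A_\alpha^2(\mathbb{D})$ is the Hilbert space of analytic functions $f$ on $\mathbb{D}$ with $\|f\|^2=\int_{\mathbb{D}}|f(z)|^2\,\frac{1+\alpha}{\pi}(1-|z|^2)^\alpha\,dA(z)<\infty$, where $dA$ is Lebesgue area measure. $H^\infty(\mathbb{D})$ is the space of bounded analytic functions on $\mathbb{D}$. For an automorphism $\varphi$ of $\mathbb{D}$ and $\psi\in H^\infty(\mathbb{D})$, $C_{\psi,\varphi}$ is the bounded operator $C_{\psi,\varphi}f=\psi\cdot(f\circ\varphi)$. An automorphism of $\mathbb{D}$ (extended analytically to a neighbourhood of $\overline{\mathbb{D}}$) is hyperbolic if it has two distinct fixed points on $\partial\mathbb{D}$; its derivatives at these points are positive.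 Its Denjoy-Wolff point is the fixed point to which its iterates converge uniformly on compact subsets of $\mathbb{D}$. For $c\in\partial\mathbb{D}$, "$\psi$ is continuous at $c$" means that the limit of $\psi(z)$ as $z\to c$, $z\in\mathbb{D}$, exists; this limit is denoted $\psi(c)$. *)

theory Defs
  imports "HOL-Complex_Analysis.Complex_Analysis"
begin

abbreviation unit_disk :: "complex set" where
  "unit_disk \<equiv> ball 0 1"

definition bergman_density :: "real \<Rightarrow> (complex \<Rightarrow> complex) \<Rightarrow> complex \<Rightarrow> real" where
  "bergman_density \<alpha> f z =
     (cmod (f z))\<^sup>2 * ((1 + \<alpha>) / pi * (1 - (cmod z)\<^sup>2) powr \<alpha>)"

text \<open>A function on the disk is represented by its extension by zero to the whole plane.
  Thus equality in the space is equality of HOL functions, and the vector space operations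
  are the pointwise ones.\<close>

definition bergman_space :: "real \<Rightarrow> (complex \<Rightarrow> complex) set" where
  "bergman_space \<alpha> =
     {f. f holomorphic_on unit_disk \<and> (\<forall>z. z \<notin> unit_disk \<longrightarrow> f z = 0) \<and>
         set_integrable lborel unit_disk (bergman_density \<alpha> f)}"

definition bergman_norm :: "real \<Rightarrow> (complex \<Rightarrow> complex) \<Rightarrow> real" where
  "bergman_norm \<alpha> f = sqrt (LINT z:unit_disk|lborel. bergman_density \<alpha> f z)"

definition H_infinity :: "(complex \<Rightarrow> complex) set" where
  "H_infinity = {\<psi>. \<psi> holomorphic_on unit_disk \<and> bounded (\<psi> ` unit_disk)}"

text \<open>Since the Bergman space depends on a real parameter, it is a set with a norm rather than
  a type; operators on it are considered only through their values on that set.\<close>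

definition bounded_operator_on ::
  "(complex \<Rightarrow> complex) set \<Rightarrow> ((complex \<Rightarrow> complex) \<Rightarrow> real) \<Rightarrow>
   ((complex \<Rightarrow> complex) \<Rightarrow> (complex \<Rightarrow> complex)) \<Rightarrow> bool" where
  "bounded_operator_on H N T \<longleftrightarrow>
     (\<forall>f\<in>H. T f \<in> H) \<and>
     (\<forall>f\<in>H. \<forall>g\<in>H. T (\<lambda>z. f z + g z) = (\<lambda>z. T f z + T g z)) \<and>
     (\<forall>c. \<forall>f\<in>H. T (\<lambda>z. c * f z) = (\<lambda>z. c * T f z)) \<and>
     (\<exists>K. \<forall>f\<in>H. N (T f) \<le> K * N f)"

definition invertible_operator_on ::
  "(complex \<Rightarrow> complex) set \<Rightarrow> ((complex \<Rightarrow> complex) \<Rightarrow> real) \<Rightarrow>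
   ((complex \<Rightarrow> complex) \<Rightarrow> (complex \<Rightarrow> complex)) \<Rightarrow> bool" where
  "invertible_operator_on H N T \<longleftrightarrow>
     bounded_operator_on H N T \<and>
     (\<exists>S. bounded_operator_on H N S \<and> (\<forall>f\<in>H. S (T f) = f \<and> T (S f) = f))"

definition operator_spectrum ::
  "(complex \<Rightarrow> complex) set \<Rightarrow> ((complex \<Rightarrow> complex) \<Rightarrow> real) \<Rightarrow>
   ((complex \<Rightarrow> complex) \<Rightarrow> (complex \<Rightarrow> complex)) \<Rightarrow> complex set" where
  "operator_spectrum H N T =
     {\<mu>. \<not> invertible_operator_on H N (\<lambda>f z. T f z - \<mu> * f z)}"

definition weighted_composition ::
  "(complex \<Rightarrow> complex) \<Rightarrow> (complex \<Rightarrow> complex) \<Rightarrow>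
   (complex \<Rightarrow> complex) \<Rightarrow> (complex \<Rightarrow> complex)" where
  "weighted_composition \<psi> \<phi> f = (\<lambda>z. if z \<in> unit_disk then \<psi> z * f (\<phi> z) else 0)"

text \<open>An automorphism is identified with its analytic extension to a neighbourhood of the
  closed disk, so that \<open>\<phi>\<close> and \<open>deriv \<phi>\<close> make sense at boundary points.\<close>

definition disk_automorphism :: "(complex \<Rightarrow> complex) \<Rightarrow> bool" where
  "disk_automorphism \<phi> \<longleftrightarrow>
     \<phi> analytic_on cball 0 1 \<and> bij_betw \<phi> unit_disk unit_disk"

text \<open>Requiring exactly two fixed points on the circle excludes the identity; any other
  automorphism has at most two.\<close>

definition hyperbolic_automorphism :: "(complex \<Rightarrow> complex) \<Rightarrow> bool" where
  "hyperbolic_automorphism \<phi> \<longleftrightarrow>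
     disk_automorphism \<phi> \<and> card {z \<in> sphere 0 1. \<phi> z = z} = 2"

definition denjoy_wolff_point :: "(complex \<Rightarrow> complex) \<Rightarrow> complex \<Rightarrow> bool" where
  "denjoy_wolff_point \<phi> a \<longleftrightarrow>
     a \<in> cball 0 1 \<and> \<phi> a = a \<and>
     (\<forall>K. compact K \<and> K \<subseteq> unit_disk \<longrightarrow>
        uniform_limit K (\<lambda>n. \<phi> ^^ n) (\<lambda>_. a) sequentially)"

text \<open>Here \<open>c\<close> lies on the unit circle; the limit is unrestricted within the disk, and the
  HOL value \<open>\<psi> c\<close> plays no role.\<close>

definition continuous_at_boundary :: "(complex \<Rightarrow> complex) \<Rightarrow> complex \<Rightarrow> bool" where
  "continuous_at_boundary \<psi> c \<longleftrightarrow> (\<exists>l. (\<psi> \<longlongrightarrow> l) (at c within unit_disk))"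

definition boundary_value :: "(complex \<Rightarrow> complex) \<Rightarrow> complex \<Rightarrow> complex" where
  "boundary_value \<psi> c = Lim (at c within unit_disk) \<psi>"

end

theory Submission imports Defs begin

text \<open>
  Write \<open>T\<close> for the operator and \<open>\<gamma>\<close> for \<open>(\<alpha> + 2) / 2\<close>. The half-plane coordinate \<open>w\<close> sends the repelling fixed
  point \<open>b\<close> to \<open>0\<close>, the attracting one \<open>a\<close> to infinity, and turns \<open>\<phi>\<close> into the dilation by \<open>1 / s\<close>, where
  \<open>s < 1\<close> is the derivative of \<open>\<phi>\<close> at \<open>a\<close>. Since \<open>\<phi>\<close> preserves the hyperbolic metric, a change of
  variables shows that composition with \<open>\<phi>\<close>, corrected by the factor of modulus \<open>\<bar>\<phi>'\<bar> powr \<gamma>\<close>, is isometric. So \<open>T\<close>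
  acts along each orbit of \<open>\<phi>\<close> like a weighted shift, whose weight at \<open>z\<close> is the gain
  \<open>\<bar>\<psi> z\<bar> / \<bar>\<phi>' z\<bar> powr \<gamma>\<close>. The gain tends to the two numbers \<open>A\<close> and \<open>B\<close> in the theorem as \<open>z\<close> tends
  to \<open>a\<close> and to \<open>b\<close>.

  The spectrum lies in the disk of radius \<open>max A B\<close>: every orbit runs from \<open>b\<close> to \<open>a\<close> and spends a bounded number of steps away
  from these points, so the norm of the \<open>n\<close>-th power of \<open>T\<close> is at most a constant times the \<open>n\<close>-th power of any
  \<open>q > max A B\<close>, and the Neumann series of the resolvent converges (\<open>wcomp_resolvent\<close>).

  Conversely, suppose that \<open>T - \<mu>\<close> is invertible, and follow the solution of \<open>\<psi> \<cdot> f \<circ> \<phi> - \<mu> f = g\<close> along an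
  orbit, for test functions \<open>g\<close> built from a power of the reproducing kernel and a rational function of \<open>w\<close>.

  \<^item> If \<open>A < \<bar>\<mu>\<bar> < B\<close>, the forward and the backward half of the orbit both determine \<open>f\<close> at its middle point, and the two
    values disagree for a \<open>g\<close> concentrated there (\<open>not_invertible_repelling_annulus\<close>).
  \<^item> If \<open>B < \<bar>\<mu>\<bar> < A\<close>, the equation is solvable for every \<open>g\<close> that vanishes to high order at \<open>a\<close>, because this vanishing lowers the
    gain at \<open>a\<close>; but the solutions for functions \<open>g\<close> of bounded norm, concentrated ever farther along a forward orbit, are not bounded
    (\<open>not_invertible_attracting_annulus\<close>).
  \<^item> If \<open>\<bar>\<mu>\<bar> < min A B\<close>, the hypothesis that \<open>T\<close> itself is not invertible enters. It means that \<open>\<psi>\<close> is not bounded away from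
    zero, and then \<open>\<psi>\<close> takes arbitrarily small values at points \<open>z\<close> on whose backward orbits it stays bounded below
    (\<open>small_values_exist\<close>). Cutting the orbit at \<open>z\<close> leaves a backward half that determines \<open>f z\<close> from \<open>g\<close>,
    while \<open>\<psi> z * f (\<phi> z)\<close> is negligible; this is again contradictory for a \<open>g\<close> concentrated at \<open>z\<close>
    (\<open>not_invertible_small_values\<close>).

  The circles that remain belong to the spectrum because it is closed.

  Of the Bergman space this uses the isometry above, the boundedness of point evaluations (\<open>point_evaluation_bounded\<close>), and
  completeness for geometric series (\<open>bergman_geometric_series\<close>).
\<close>

section \<open>Holomorphic change of variables\<close>

text \<open>The complex plane is identified with the Euclidean plane, so that Lebesgue measure and Jacobian
  determinants can be transferred between them.\<close>

definition plane_of_vec :: "real^2 \<Rightarrow> complex" where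
  "plane_of_vec v = Complex (vec_nth v 1) (vec_nth v 2)"

definition vec_of_plane :: "complex \<Rightarrow> real^2" where
  "vec_of_plane z = vector [Re z, Im z]"

lemma plane_vec_inverse [simp]: "plane_of_vec (vec_of_plane z) = z"
  by (simp add: plane_of_vec_def vec_of_plane_def)

lemma vec_plane_inverse [simp]: "vec_of_plane (plane_of_vec v) = v"
  by (simp add: plane_of_vec_def vec_of_plane_def vec_eq_iff forall_2)

lemma bounded_linear_plane_of_vec: "bounded_linear plane_of_vec"
proof -
  have "linear plane_of_vec"
    by (rule linearI) (auto simp: plane_of_vec_def complex_eq_iff)
  then show ?thesis by (simp add: linear_conv_bounded_linear)
qed

lemma bounded_linear_vec_of_plane: "bounded_linear vec_of_plane"
proof -
  have "linear vec_of_plane"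
    by (rule linearI) (auto simp: vec_of_plane_def vec_eq_iff forall_2)
  then show ?thesis by (simp add: linear_conv_bounded_linear)
qed

lemma measurable_plane_of_vec [measurable]: "plane_of_vec \<in> borel_measurable borel"
  by (intro borel_measurable_continuous_onI linear_continuous_on bounded_linear_plane_of_vec)

lemma distr_plane_of_vec: "distr lborel borel plane_of_vec = lborel"
proof (rule sym, rule lborel_eqI)
  fix l u :: complex
  assume le: "\<And>b. b \<in> Basis \<Longrightarrow> l \<bullet> b \<le> u \<bullet> b"
  have lu: "Re l \<le> Re u" "Im l \<le> Im u"
    using le[of 1] le[of \<i>] by (auto simp: Basis_complex_def)
  have eq: "plane_of_vec -` box l u = box (vec_of_plane l) (vec_of_plane u)"
  proof (rule set_eqI)
    fix x :: "real^2"
    have "x \<in> box (vec_of_plane l) (vec_of_plane u) \<longleftrightarrow>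
        Re l < vec_nth x 1 \<and> vec_nth x 1 < Re u \<and> Im l < vec_nth x 2 \<and> vec_nth x 2 < Im u"
      unfolding mem_box_cart by (auto simp: vec_of_plane_def forall_2)
    then show "x \<in> plane_of_vec -` box l u \<longleftrightarrow> x \<in> box (vec_of_plane l) (vec_of_plane u)"
      by (auto simp: plane_of_vec_def mem_box Basis_complex_def)
  qed
  have bas: "(Basis :: (real^2) set) = {axis 1 1, axis 2 1}"
    by (auto simp: Basis_vec_def) (metis exhaust_2)
  have ne: "axis (1::2) (1::real) \<noteq> axis 2 1"
    by (simp add: axis_eq_axis)
  have "emeasure (distr lborel borel plane_of_vec) (box l u)
      = emeasure lborel (box (vec_of_plane l) (vec_of_plane u))"
    by (subst emeasure_distr) (auto simp: eq)
  also have "\<dots> = ennreal (\<Prod>b\<in>Basis. (vec_of_plane u - vec_of_plane l) \<bullet> b)"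
    by (rule emeasure_lborel_box) (use lu in \<open>auto simp: bas inner_axis vec_of_plane_def\<close>)
  also have "(\<Prod>b\<in>Basis. (vec_of_plane u - vec_of_plane l) \<bullet> b) = (\<Prod>b\<in>Basis. (u - l) \<bullet> b)"
    using ne by (simp add: bas Basis_complex_def inner_axis vec_of_plane_def)
  finally show "emeasure (distr lborel borel plane_of_vec) (box l u) = (\<Prod>b\<in>Basis. (u - l) \<bullet> b)" .
qed simp

lemma integrable_plane_of_vec_iff:
  fixes h :: "complex \<Rightarrow> real"
  assumes "h \<in> borel_measurable borel"
  shows "integrable lborel (\<lambda>v. h (plane_of_vec v)) \<longleftrightarrow> integrable lborel h"
    and "(LINT v|lborel. h (plane_of_vec v)) = (LINT z|lborel. h z)"
proof -
  have "integrable (distr lborel borel plane_of_vec) h \<longleftrightarrow> integrable lborel (\<lambda>v. h (plane_of_vec v))"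
    using assms by (intro integrable_distr_eq) auto
  then show "integrable lborel (\<lambda>v. h (plane_of_vec v)) \<longleftrightarrow> integrable lborel h"
    by (simp add: distr_plane_of_vec)
  have "integral\<^sup>L (distr lborel borel plane_of_vec) h = (LINT v|lborel. h (plane_of_vec v))"
    using assms by (intro integral_distr) auto
  then show "(LINT v|lborel. h (plane_of_vec v)) = (LINT z|lborel. h z)"
    by (simp add: distr_plane_of_vec)
qed

text \<open>Multiplication by \<open>c\<close> acts on the real plane with determinant the square of its modulus, by
  the Cauchy-Riemann equations.\<close>

lemma det_complex_multiplication:
  "det (matrix (\<lambda>v. vec_of_plane (c * plane_of_vec v))) = (cmod c)\<^sup>2"
  by (simp add: det_2 matrix_def vec_of_plane_def plane_of_vec_def axis_def cmod_power2 flip: power2_eq_square)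

lemma set_integrable_plane_of_vec:
  fixes h :: "complex \<Rightarrow> real"
  assumes S: "S \<in> sets borel" and h: "(\<lambda>z. indicator S z * h z) \<in> borel_measurable borel"
  shows "set_integrable lborel S h \<longleftrightarrow>
      (\<lambda>v. h (plane_of_vec v)) absolutely_integrable_on (vec_of_plane ` S)"
    and "(LINT z:S|lborel. h z) = (LINT v:vec_of_plane ` S|lebesgue. h (plane_of_vec v))"
proof -
  let ?k = "\<lambda>z. indicator S z * h z"
  have ind: "indicator (vec_of_plane ` S) v = indicator S (plane_of_vec v)" for v
  proof -
    have "v \<in> vec_of_plane ` S \<longleftrightarrow> plane_of_vec v \<in> S"
      by (metis image_iff plane_vec_inverse vec_plane_inverse)
    then show ?thesis by (simp add: indicator_def)
  qed
  have m: "(\<lambda>v. ?k (plane_of_vec v)) \<in> borel_measurable borel"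
    using measurable_compose[OF measurable_plane_of_vec h] by simp
  show "set_integrable lborel S h \<longleftrightarrow>
      (\<lambda>v. h (plane_of_vec v)) absolutely_integrable_on (vec_of_plane ` S)"
    using integrable_plane_of_vec_iff(1)[OF h] m
    by (simp add: set_integrable_def ind integrable_completion)
  show "(LINT z:S|lborel. h z) = (LINT v:vec_of_plane ` S|lebesgue. h (plane_of_vec v))"
    using integrable_plane_of_vec_iff(2)[OF h] m
    by (simp add: set_lebesgue_integral_def ind integral_completion)
qed

text \<open>The change-of-variables theorem for Euclidean space, read for an injective holomorphic map:
  the Jacobian determinant is the squared modulus of the complex derivative.\<close>

lemma holomorphic_change_of_variables:
  fixes h :: "complex \<Rightarrow> real"
  assumes S: "open S" and hol: "\<tau> holomorphic_on S" and inj: "inj_on \<tau> S"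
    and h: "continuous_on (\<tau> ` S) h"
    and int: "set_integrable lborel (\<tau> ` S) h"
  shows "set_integrable lborel S (\<lambda>z. (cmod (deriv \<tau> z))\<^sup>2 * h (\<tau> z))"
    and "(LINT z:S|lborel. (cmod (deriv \<tau> z))\<^sup>2 * h (\<tau> z)) = (LINT z:\<tau> ` S|lborel. h z)"
proof -
  let ?g = "\<lambda>v. vec_of_plane (\<tau> (plane_of_vec v))"
  let ?g' = "\<lambda>v u. vec_of_plane (deriv \<tau> (plane_of_vec v) * plane_of_vec u)"
  let ?S = "vec_of_plane ` S"
  let ?k = "\<lambda>z. (cmod (deriv \<tau> z))\<^sup>2 * h (\<tau> z)"
  let ?f = "\<lambda>v. (vec (h (plane_of_vec v)) :: real^1)"
  have S': "?S = plane_of_vec -` S"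
    by (auto simp: image_iff) (metis vec_plane_inverse)
  have openS': "open ?S"
    unfolding S' using S
    by (intro open_vimage linear_continuous_on bounded_linear_plane_of_vec)
  have ims: "?g ` ?S = vec_of_plane ` (\<tau> ` S)"
    by (auto simp: image_image)
  have openT: "open (\<tau> ` S)"
    by (rule open_mapping_thm3[OF hol S inj])
  have der: "(?g has_derivative ?g' v) (at v within ?S)" if "v \<in> ?S" for v
  proof -
    have "plane_of_vec v \<in> S" using that S' by auto
    then have "(\<tau> has_derivative (*) (deriv \<tau> (plane_of_vec v))) (at (plane_of_vec v))"
      using holomorphic_derivI[OF hol S, of "plane_of_vec v" UNIV] by (simp add: has_field_derivative_def)
    moreover have "(plane_of_vec has_derivative plane_of_vec) (at v)"
      by (rule bounded_linear_imp_has_derivative[OF bounded_linear_plane_of_vec])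
    ultimately have "((\<lambda>v. \<tau> (plane_of_vec v)) has_derivative
        (\<lambda>u. deriv \<tau> (plane_of_vec v) * plane_of_vec u)) (at v)"
      by (rule has_derivative_compose[rotated])
    from bounded_linear.has_derivative[OF bounded_linear_vec_of_plane this]
    show ?thesis by (rule has_derivative_at_withinI)
  qed
  have injg: "inj_on ?g ?S"
  proof (rule inj_onI)
    fix x y assume xy: "x \<in> ?S" "y \<in> ?S" "?g x = ?g y"
    have "\<tau> (plane_of_vec x) = \<tau> (plane_of_vec y)"
      using xy(3) plane_vec_inverse by metis
    then have "plane_of_vec x = plane_of_vec y"
      using inj xy(1,2) S' by (auto dest: inj_onD)
    then show "x = y" by (metis vec_plane_inverse)
  qed
  have borS: "S \<in> sets borel" "\<tau> ` S \<in> sets borel"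
    using S openT by auto
  have mh: "(\<lambda>z. indicator (\<tau> ` S) z * h z) \<in> borel_measurable borel"
    using borel_measurable_continuous_on_indicator[OF borS(2) h] by simp
  have contk: "continuous_on S ?k"
    using hol S h
    by (intro continuous_intros holomorphic_on_imp_continuous_on holomorphic_deriv
        continuous_on_compose2[OF h holomorphic_on_imp_continuous_on[OF hol]]) auto
  have mk: "(\<lambda>z. indicator S z * ?k z) \<in> borel_measurable borel"
    using borel_measurable_continuous_on_indicator[OF borS(1) contk] by simp
  have "(\<lambda>v. h (plane_of_vec v)) absolutely_integrable_on (?g ` ?S)"
    using int set_integrable_plane_of_vec(1)[OF borS(2) mh] ims by simp
  then have ai: "?f absolutely_integrable_on (?g ` ?S)"
    by (simp add: absolutely_integrable_on_1_iff)
  have Sleb: "?S \<in> sets lebesgue"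
    using openS' by (simp add: borel_open)
  from has_absolute_integral_change_of_variables[OF Sleb der injg, of ?f "integral (?g ` ?S) ?f"] ai
  have c1: "(\<lambda>v. \<bar>det (matrix (?g' v))\<bar> *\<^sub>R ?f (?g v)) absolutely_integrable_on ?S"
    and c2: "integral ?S (\<lambda>v. \<bar>det (matrix (?g' v))\<bar> *\<^sub>R ?f (?g v)) = integral (?g ` ?S) ?f"
    by auto
  have c1': "(\<lambda>v. ?k (plane_of_vec v)) absolutely_integrable_on ?S"
    using c1 by (simp add: det_complex_multiplication absolutely_integrable_on_1_iff)
  then show int2: "set_integrable lborel S ?k"
    using set_integrable_plane_of_vec(1)[OF borS(1) mk] by simp
  have hint: "(\<lambda>v. h (plane_of_vec v)) absolutely_integrable_on (?g ` ?S)"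
    using ai by (simp add: absolutely_integrable_on_1_iff)
  have "integral ?S (\<lambda>v. ?k (plane_of_vec v)) = integral (?g ` ?S) (\<lambda>v. h (plane_of_vec v))"
    using arg_cong[OF c2, of "\<lambda>v. vec_nth v 1"] by (simp add: det_complex_multiplication integral_on_1_eq)
  then have "(LINT v:?S|lebesgue. ?k (plane_of_vec v)) = (LINT v:vec_of_plane ` (\<tau> ` S)|lebesgue. h (plane_of_vec v))"
    using c1' hint ims by (simp add: set_lebesgue_integral_eq_integral)
  then show "(LINT z:S|lborel. ?k z) = (LINT z:\<tau> ` S|lborel. h z)"
    using set_integrable_plane_of_vec(2)[OF borS(1) mk] set_integrable_plane_of_vec(2)[OF borS(2) mh]
    by simp
qed

section \<open>Bijections of the disk\<close>

definition disk_bijection :: "(complex \<Rightarrow> complex) \<Rightarrow> bool" where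
  "disk_bijection \<tau> \<longleftrightarrow> \<tau> holomorphic_on unit_disk \<and> bij_betw \<tau> unit_disk unit_disk"

lemma disk_bijectionD:
  assumes "disk_bijection \<tau>"
  shows "\<tau> holomorphic_on unit_disk" "inj_on \<tau> unit_disk" "\<tau> ` unit_disk = unit_disk"
    and "\<And>z. z \<in> unit_disk \<Longrightarrow> \<tau> z \<in> unit_disk"
  using assms by (auto simp: disk_bijection_def bij_betw_def)

lemma disk_bijection_id: "disk_bijection (\<lambda>z. z)"
  by (auto simp: disk_bijection_def bij_betw_def)

lemma disk_bijection_compose:
  assumes "disk_bijection \<sigma>" "disk_bijection \<tau>"
  shows "disk_bijection (\<lambda>z. \<sigma> (\<tau> z))"
proof -
  have "(\<sigma> \<circ> \<tau>) holomorphic_on unit_disk"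
    using assms by (intro holomorphic_on_compose_gen[where t = unit_disk]) (auto simp: disk_bijection_def bij_betw_def)
  moreover have "bij_betw (\<sigma> \<circ> \<tau>) unit_disk unit_disk"
    using assms by (intro bij_betw_trans) (auto simp: disk_bijection_def)
  ultimately show ?thesis by (simp add: disk_bijection_def o_def)
qed

lemma disk_bijection_funpow:
  assumes "disk_bijection \<tau>"
  shows "disk_bijection (\<tau> ^^ n)"
proof (induction n)
  case 0
  then show ?case using disk_bijection_id by (simp add: id_def)
next
  case (Suc n)
  then show ?case using disk_bijection_compose[OF assms] by (simp add: o_def)
qed

lemma disk_bijection_inverse:
  assumes "disk_bijection \<tau>"
  obtains \<sigma> where "disk_bijection \<sigma>" "\<And>z. z \<in> unit_disk \<Longrightarrow> \<sigma> (\<tau> z) = z"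
    "\<And>z. z \<in> unit_disk \<Longrightarrow> \<tau> (\<sigma> z) = z"
proof -
  note d = disk_bijectionD[OF assms]
  obtain \<sigma> where hol: "\<sigma> holomorphic_on (\<tau> ` unit_disk)" and inv: "\<And>z. z \<in> unit_disk \<Longrightarrow> \<sigma> (\<tau> z) = z"
    using holomorphic_has_inverse[OF d(1) open_ball d(2)] by metis
  have inv': "\<tau> (\<sigma> z) = z" if "z \<in> unit_disk" for z
    using that inv d(3) by (metis imageE)
  have "bij_betw \<sigma> unit_disk unit_disk"
  proof (rule bij_betwI[where g = \<tau>])
    show "\<sigma> \<in> unit_disk \<rightarrow> unit_disk"
    proof (rule Pi_I)
      fix z :: complex assume "z \<in> unit_disk"
      then obtain x where "x \<in> unit_disk" "z = \<tau> x" using d(3) by blast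
      then show "\<sigma> z \<in> unit_disk" using inv by simp
    qed
  qed (use d(4) inv inv' in auto)
  then show ?thesis using that[of \<sigma>] hol d(3) inv inv' by (simp add: disk_bijection_def)
qed

lemma one_minus_cnj_mult_nonzero:
  assumes "cmod c < 1" "cmod z \<le> 1"
  shows "1 - cnj c * z \<noteq> 0"
proof
  assume "1 - cnj c * z = 0"
  then have "cmod (cnj c * z) = 1" by (metis norm_one right_minus_eq)
  moreover have "cmod (cnj c * z) \<le> cmod c"
    using assms mult_left_le[of "cmod z" "cmod c"] by (simp add: norm_mult)
  ultimately show False using assms by simp
qed

lemma disk_bijection_Moebius:
  assumes "cmod c < 1"
  shows "disk_bijection (Moebius_function 0 c)"
proof -
  have "bij_betw (Moebius_function 0 c) unit_disk unit_disk"
    by (rule bij_betwI[where g = "Moebius_function 0 (-c)"])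
      (use assms Moebius_function_norm_lt_1 Moebius_function_compose in auto)
  then show ?thesis using assms by (simp add: disk_bijection_def Moebius_function_holomorphic)
qed

text \<open>After a Moebius map has moved the zero of the bijection to the origin, the Schwarz lemma applies
  to it and to its inverse, so it is a rotation.\<close>

lemma disk_bijection_is_Moebius:
  assumes "disk_bijection \<tau>"
  obtains e c where "cmod e = 1" "cmod c < 1"
    "\<And>z. z \<in> unit_disk \<Longrightarrow> \<tau> z = e * ((z - c) / (1 - cnj c * z))"
proof -
  note d = disk_bijectionD[OF assms]
  obtain c where c: "c \<in> unit_disk" "\<tau> c = 0"
    using d(3) by (metis imageE centre_in_ball zero_less_one)
  have c1: "cmod c < 1" using c by simp
  define F where "F = (\<lambda>z. \<tau> (Moebius_function 0 (-c) z))"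
  have F: "disk_bijection F"
    unfolding F_def by (rule disk_bijection_compose[OF assms disk_bijection_Moebius]) (use c1 in simp)
  obtain G where G: "disk_bijection G" "\<And>z. z \<in> unit_disk \<Longrightarrow> G (F z) = z"
    "\<And>z. z \<in> unit_disk \<Longrightarrow> F (G z) = z"
    using disk_bijection_inverse[OF F] by metis
  have F0: "F 0 = 0" by (simp add: F_def Moebius_function_of_zero c)
  have G0: "G 0 = 0" using G(2)[of 0] F0 by simp
  have Fle: "cmod (F z) \<le> cmod z" if "cmod z < 1" for z
    using Schwarz_Lemma(1)[OF disk_bijectionD(1)[OF F] F0 _ that] disk_bijectionD(4)[OF F] by simp
  have Gle: "cmod (G z) \<le> cmod z" if "cmod z < 1" for z
    using Schwarz_Lemma(1)[OF disk_bijectionD(1)[OF G(1)] G0 _ that] disk_bijectionD(4)[OF G(1)] by simp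
  have "cmod (F z) = cmod z" if "cmod z < 1" for z
    using Fle[OF that] Gle[of "F z"] G(2)[of z] disk_bijectionD(4)[OF F, of z] that by simp
  then have "cmod (F (1/2)) = cmod (1/2)" by simp
  then have "\<exists>e. (\<forall>z. cmod z < 1 \<longrightarrow> F z = e * z) \<and> cmod e = 1"
    using disk_bijectionD(4)[OF F]
    by (intro Schwarz_Lemma(3)[OF disk_bijectionD(1)[OF F] F0, of 0] disjI1 exI[of _ "1/2"]) auto
  then obtain e where e: "cmod e = 1" "\<And>z. cmod z < 1 \<Longrightarrow> F z = e * z" by blast
  have "\<tau> z = e * ((z - c) / (1 - cnj c * z))" if "z \<in> unit_disk" for z
  proof -
    have "Moebius_function 0 (-c) (Moebius_function 0 c z) = z"
      using Moebius_function_compose[of "-c" c z] c1 that by simp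
    then have "\<tau> z = F (Moebius_function 0 c z)" by (simp add: F_def)
    also have "\<dots> = e * Moebius_function 0 c z"
      using e(2) Moebius_function_norm_lt_1 c1 that by simp
    finally show ?thesis by (simp add: Moebius_function_simple)
  qed
  then show ?thesis using that e c1 by blast
qed

lemma Moebius_one_minus_norm:
  assumes "cmod c < 1" "cmod z \<le> 1" "cmod e = 1"
  shows "1 - (cmod (e * ((z - c) / (1 - cnj c * z))))\<^sup>2
    = (1 - (cmod c)\<^sup>2) * (1 - (cmod z)\<^sup>2) / (cmod (1 - cnj c * z))\<^sup>2"
proof -
  have nz: "(cmod (1 - cnj c * z))\<^sup>2 \<noteq> 0"
    using one_minus_cnj_mult_nonzero[OF assms(1,2)] by simp
  have "(cmod (1 - cnj c * z))\<^sup>2 - (cmod (z - c))\<^sup>2 = (1 - (cmod c)\<^sup>2) * (1 - (cmod z)\<^sup>2)"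
    unfolding cmod_power2 by (simp add: algebra_simps power2_eq_square)
  then have "1 - (cmod (z - c) / cmod (1 - cnj c * z))\<^sup>2
    = (1 - (cmod c)\<^sup>2) * (1 - (cmod z)\<^sup>2) / (cmod (1 - cnj c * z))\<^sup>2"
    using nz by (simp add: power_divide divide_simps)
  moreover have "cmod (e * ((z - c) / (1 - cnj c * z))) = cmod (z - c) / cmod (1 - cnj c * z)"
    by (simp only: norm_mult norm_divide assms(3) mult_1)
  ultimately show ?thesis by simp
qed

lemma Moebius_derivative:
  assumes "cmod c < 1" "cmod z \<le> 1"
  shows "((\<lambda>z. e * ((z - c) / (1 - cnj c * z))) has_field_derivative
     e * (1 - (cmod c)\<^sup>2) / (1 - cnj c * z)\<^sup>2) (at z)"
proof -
  have cc: "cnj c * c = of_real ((cmod c)\<^sup>2)"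
    by (metis complex_norm_square mult.commute)
  show ?thesis
    using one_minus_cnj_mult_nonzero[OF assms] cc
    by (auto intro!: derivative_eq_intros simp: power2_eq_square field_simps)
qed

text \<open>The case of equality in the Schwarz-Pick lemma: holomorphic bijections of the disk preserve the
  hyperbolic metric.\<close>

lemma disk_bijection_deriv_norm:
  assumes "disk_bijection \<tau>" "z \<in> unit_disk"
  shows "cmod (deriv \<tau> z) * (1 - (cmod z)\<^sup>2) = 1 - (cmod (\<tau> z))\<^sup>2"
proof -
  obtain e c where ec: "cmod e = 1" "cmod c < 1"
    "\<And>z. z \<in> unit_disk \<Longrightarrow> \<tau> z = e * ((z - c) / (1 - cnj c * z))"
    using disk_bijection_is_Moebius[OF assms(1)] by blast
  have z: "cmod z < 1" using assms by simp
  have "(\<tau> has_field_derivative e * (1 - (cmod c)\<^sup>2) / (1 - cnj c * z)\<^sup>2) (at z)"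
    by (rule has_field_derivative_transform_within_open[OF Moebius_derivative[of c z e] open_ball assms(2)])
      (use ec z in auto)
  then have "deriv \<tau> z = e * (1 - (cmod c)\<^sup>2) / (1 - cnj c * z)\<^sup>2" by (rule DERIV_imp_deriv)
  moreover have "cmod (1 - (complex_of_real (cmod c))\<^sup>2) = 1 - (cmod c)\<^sup>2"
  proof -
    have "(cmod c)\<^sup>2 \<le> 1" using ec(2) by (simp add: power_le_one)
    then have "cmod (of_real (1 - (cmod c)\<^sup>2)) = 1 - (cmod c)\<^sup>2" by (simp only: norm_of_real)
    then show ?thesis by simp
  qed
  ultimately show ?thesis
    using Moebius_one_minus_norm[of c z e] ec z assms(2)
    by (simp add: norm_mult norm_divide norm_power)
qed

text \<open>For a Moebius map the quotient of the two distances is explicit, and bounded because the denominator of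
  the map has modulus at most 2.\<close>

lemma disk_bijection_ratio_bounds:
  assumes "disk_bijection \<tau>"
  obtains m where "m > 0" "\<And>z. z \<in> unit_disk \<Longrightarrow> 1 - (cmod z)\<^sup>2 \<le> m * (1 - (cmod (\<tau> z))\<^sup>2)"
proof -
  obtain e c where ec: "cmod e = 1" "cmod c < 1"
    "\<And>z. z \<in> unit_disk \<Longrightarrow> \<tau> z = e * ((z - c) / (1 - cnj c * z))"
    using disk_bijection_is_Moebius[OF assms] by blast
  have c: "1 - (cmod c)\<^sup>2 > 0" using ec(2) by (simp add: abs_square_less_1)
  have "1 - (cmod z)\<^sup>2 \<le> (4 / (1 - (cmod c)\<^sup>2)) * (1 - (cmod (\<tau> z))\<^sup>2)" if z: "z \<in> unit_disk" for z
  proof -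
    have zz: "1 - (cmod z)\<^sup>2 > 0" using z by (simp add: abs_square_less_1)
    have "cmod (1 - cnj c * z) \<le> 2"
      using norm_triangle_ineq4[of 1 "cnj c * z"] ec(2) z mult_le_one[of "cmod c" "cmod z"]
      by (simp add: norm_mult)
    then have "(cmod (1 - cnj c * z))\<^sup>2 \<le> 2\<^sup>2" by (intro power_mono) auto
    moreover have "(cmod (1 - cnj c * z))\<^sup>2 > 0"
      using one_minus_cnj_mult_nonzero ec(2) z by simp
    ultimately have "(1 - (cmod z)\<^sup>2) * (cmod (1 - cnj c * z))\<^sup>2 \<le> (1 - (cmod z)\<^sup>2) * 4"
        and N: "(cmod (1 - cnj c * z))\<^sup>2 > 0"
      using zz mult_left_mono[of "(cmod (1 - cnj c * z))\<^sup>2" "2\<^sup>2" "1 - (cmod z)\<^sup>2"] by auto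
    then have "1 - (cmod z)\<^sup>2 \<le> 4 * ((1 - (cmod z)\<^sup>2) / (cmod (1 - cnj c * z))\<^sup>2)"
      by (simp add: pos_le_divide_eq mult.commute)
    also have "\<dots> = (4 / (1 - (cmod c)\<^sup>2)) * (1 - (cmod (\<tau> z))\<^sup>2)"
      using Moebius_one_minus_norm[of c z e] ec z c by simp
    finally show ?thesis .
  qed
  then show ?thesis using that[of "4 / (1 - (cmod c)\<^sup>2)"] c by simp
qed

section \<open>Weighted composition operators on the Bergman space\<close>

text \<open>Point evaluation at \<open>z\<close> has norm comparable to the inverse of this quantity, which is
  therefore the natural factor by which to normalise values.\<close>

definition eval_weight :: "real \<Rightarrow> complex \<Rightarrow> real" where
  "eval_weight \<alpha> z = (1 - (cmod z)\<^sup>2) powr ((\<alpha> + 2) / 2)"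

lemma one_minus_norm_pos: "z \<in> unit_disk \<Longrightarrow> 1 - (cmod z)\<^sup>2 > 0"
  by (simp add: abs_square_less_1)

lemma eval_weight_pos: "z \<in> unit_disk \<Longrightarrow> eval_weight \<alpha> z > 0"
  using one_minus_norm_pos by (simp add: eval_weight_def) (metis less_irrefl)

lemma bergman_density_nonneg:
  assumes "\<alpha> > -1" shows "bergman_density \<alpha> f z \<ge> 0"
  using assms by (simp add: bergman_density_def)

lemma bergman_density_continuous:
  assumes "f holomorphic_on unit_disk"
  shows "continuous_on unit_disk (bergman_density \<alpha> f)"
proof -
  have "(cmod z)\<^sup>2 \<noteq> 1" if "cmod z < 1" for z
    using that by (simp add: abs_square_eq_1)
  then show ?thesis
  unfolding bergman_density_def
  using assms by (intro continuous_intros holomorphic_on_imp_continuous_on) auto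
qed

lemma bergman_density_eval_weight:
  assumes "z \<in> unit_disk"
  shows "bergman_density \<alpha> f z = (1 + \<alpha>) / pi * (cmod (f z) * eval_weight \<alpha> z / (1 - (cmod z)\<^sup>2))\<^sup>2"
proof -
  let ?x = "1 - (cmod z)\<^sup>2"
  have x: "?x > 0" using assms by (rule one_minus_norm_pos)
  have "(eval_weight \<alpha> z)\<^sup>2 = ?x powr (\<alpha> + 2)"
    using x by (simp add: eval_weight_def power2_eq_square flip: powr_add)
  also have "\<dots> = ?x powr \<alpha> * ?x\<^sup>2"
    using x by (simp add: powr_add powr_realpow)
  finally show ?thesis using x
    by (simp add: bergman_density_def power_divide power_mult_distrib)
qed

lemma bergman_spaceD:
  assumes "f \<in> bergman_space \<alpha>"
  shows "f holomorphic_on unit_disk" "\<And>z. z \<notin> unit_disk \<Longrightarrow> f z = 0"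
    "set_integrable lborel unit_disk (bergman_density \<alpha> f)"
  using assms by (auto simp: bergman_space_def)

lemma bergman_norm_nonneg: "\<alpha> > -1 \<Longrightarrow> bergman_norm \<alpha> f \<ge> 0"
  unfolding bergman_norm_def set_lebesgue_integral_def
  by (intro real_sqrt_ge_zero integral_nonneg_AE AE_I2) (auto simp: bergman_density_nonneg)

lemma bergman_norm_square:
  "\<alpha> > -1 \<Longrightarrow> (bergman_norm \<alpha> f)\<^sup>2 = (LINT z:unit_disk|lborel. bergman_density \<alpha> f z)"
  unfolding bergman_norm_def set_lebesgue_integral_def
  by (intro real_sqrt_pow2 integral_nonneg_AE AE_I2) (auto simp: bergman_density_nonneg)

lemma bergman_space_dominated:
  assumes \<alpha>: "\<alpha> > -1" and hol: "f holomorphic_on unit_disk" and z0: "\<And>z. z \<notin> unit_disk \<Longrightarrow> f z = 0"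
    and h: "set_integrable lborel unit_disk h"
    and le: "\<And>z. z \<in> unit_disk \<Longrightarrow> bergman_density \<alpha> f z \<le> h z"
  shows "f \<in> bergman_space \<alpha>"
    and "(bergman_norm \<alpha> f)\<^sup>2 \<le> (LINT z:unit_disk|lborel. h z)"
proof -
  have m: "set_borel_measurable lborel unit_disk (bergman_density \<alpha> f)"
    using borel_measurable_continuous_on_indicator[OF _ bergman_density_continuous[OF hol]]
    by (simp add: set_borel_measurable_def)
  have int: "set_integrable lborel unit_disk (bergman_density \<alpha> f)"
    by (rule set_integrable_bound[OF h m])
      (use le bergman_density_nonneg[OF \<alpha>] in \<open>auto intro!: AE_I2 simp: abs_le_iff intro: order_trans[OF le]\<close>)
  then show "f \<in> bergman_space \<alpha>"
    using hol z0 by (auto simp: bergman_space_def)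
  show "(bergman_norm \<alpha> f)\<^sup>2 \<le> (LINT z:unit_disk|lborel. h z)"
    unfolding bergman_norm_square[OF \<alpha>]
    by (rule set_integral_mono[OF int h]) (use le in auto)
qed

text \<open>Since \<open>\<tau>\<close> preserves the hyperbolic metric, the change of variables turns the density of \<open>f \<circ> \<tau>\<close>
  into that of \<open>f\<close>, up to the square of the quotient of the evaluation weights at \<open>\<tau> z\<close> and at \<open>z\<close>.\<close>

lemma weighted_composition_bound:
  assumes \<alpha>: "\<alpha> > -1" and \<tau>: "disk_bijection \<tau>" and f: "f \<in> bergman_space \<alpha>"
    and G: "G holomorphic_on unit_disk" and M: "M \<ge> 0"
    and le: "\<And>z. z \<in> unit_disk \<Longrightarrow> cmod (G z) * eval_weight \<alpha> z \<le> M * eval_weight \<alpha> (\<tau> z)"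
  shows "weighted_composition G \<tau> f \<in> bergman_space \<alpha>"
    and "bergman_norm \<alpha> (weighted_composition G \<tau> f) \<le> M * bergman_norm \<alpha> f"
proof -
  note d = disk_bijectionD[OF \<tau>]
  let ?h = "bergman_density \<alpha> f"
  let ?k = "\<lambda>z. (cmod (deriv \<tau> z))\<^sup>2 * ?h (\<tau> z)"
  have int: "set_integrable lborel unit_disk ?k"
    and eq: "(LINT z:unit_disk|lborel. ?k z) = (LINT z:unit_disk|lborel. ?h z)"
    using holomorphic_change_of_variables[OF open_ball d(1,2), of ?h]
      bergman_density_continuous[of f \<alpha>] bergman_spaceD[OF f] d(3) by auto
  have hol: "weighted_composition G \<tau> f holomorphic_on unit_disk"
  proof -
    have "(\<lambda>z. G z * (f \<circ> \<tau>) z) holomorphic_on unit_disk"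
      using G bergman_spaceD(1)[OF f] d
      by (intro holomorphic_intros holomorphic_on_compose_gen[where t = unit_disk]) auto
    then show ?thesis
      by (rule holomorphic_transform) (simp add: weighted_composition_def)
  qed
  have bd: "bergman_density \<alpha> (weighted_composition G \<tau> f) z \<le> M\<^sup>2 * ?k z" if z: "z \<in> unit_disk" for z
  proof -
    let ?x = "1 - (cmod z)\<^sup>2" and ?y = "1 - (cmod (\<tau> z))\<^sup>2"
    have x: "?x > 0" and y: "?y > 0" using one_minus_norm_pos z d(4) by blast+
    have der: "cmod (deriv \<tau> z) = ?y / ?x"
      using disk_bijection_deriv_norm[OF \<tau> z] x by (simp add: field_simps)
    have "?k z = (1 + \<alpha>) / pi * (cmod (f (\<tau> z)) * eval_weight \<alpha> (\<tau> z) / ?x)\<^sup>2"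
      unfolding bergman_density_eval_weight[OF d(4)[OF z]] der using x y
      by (simp add: power_divide power_mult_distrib)
    then have "M\<^sup>2 * ?k z = (1 + \<alpha>) / pi * (cmod (f (\<tau> z)) * (M * eval_weight \<alpha> (\<tau> z)) / ?x)\<^sup>2"
      by (simp add: power_divide power_mult_distrib)
    moreover have "(cmod (f (\<tau> z)) * (cmod (G z) * eval_weight \<alpha> z) / ?x)\<^sup>2
        \<le> (cmod (f (\<tau> z)) * (M * eval_weight \<alpha> (\<tau> z)) / ?x)\<^sup>2"
      using le[OF z] x eval_weight_pos[OF z, of \<alpha>]
      by (intro power_mono divide_right_mono mult_left_mono) (auto intro!: divide_nonneg_pos)
    ultimately have "(1 + \<alpha>) / pi * (cmod (f (\<tau> z)) * (cmod (G z) * eval_weight \<alpha> z) / ?x)\<^sup>2 \<le> M\<^sup>2 * ?k z"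
      unfolding \<open>M\<^sup>2 * ?k z = _\<close> using \<alpha> by (intro mult_left_mono) auto
    then show ?thesis
      unfolding bergman_density_eval_weight[OF z] using z
      by (simp add: weighted_composition_def norm_mult mult_ac)
  qed
  have int': "set_integrable lborel unit_disk (\<lambda>z. M\<^sup>2 * ?k z)"
    using int by simp
  note dom = bergman_space_dominated[OF \<alpha> hol _ int' bd]
  show "weighted_composition G \<tau> f \<in> bergman_space \<alpha>"
    by (rule dom(1)) (auto simp: weighted_composition_def)
  have "(bergman_norm \<alpha> (weighted_composition G \<tau> f))\<^sup>2 \<le> (LINT z:unit_disk|lborel. M\<^sup>2 * ?k z)"
    by (rule dom(2)) (auto simp: weighted_composition_def)
  also have "\<dots> = (M * bergman_norm \<alpha> f)\<^sup>2"
    using eq by (simp add: power_mult_distrib bergman_norm_square[OF \<alpha>])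
  finally show "bergman_norm \<alpha> (weighted_composition G \<tau> f) \<le> M * bergman_norm \<alpha> f"
    by (rule power2_le_imp_le) (use M bergman_norm_nonneg[OF \<alpha>] in auto)
qed

lemma bounded_multiple_bound:
  assumes \<alpha>: "\<alpha> > -1" and f: "f \<in> bergman_space \<alpha>"
    and G: "G holomorphic_on unit_disk"
    and le: "\<And>z. z \<in> unit_disk \<Longrightarrow> cmod (G z) \<le> M"
  shows "(\<lambda>z. G z * f z) \<in> bergman_space \<alpha>"
    and "bergman_norm \<alpha> (\<lambda>z. G z * f z) \<le> M * bergman_norm \<alpha> f"
proof -
  have eq: "weighted_composition G (\<lambda>z. z) f = (\<lambda>z. G z * f z)"
    using bergman_spaceD(2)[OF f] by (auto simp: weighted_composition_def fun_eq_iff)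
  have M: "M \<ge> 0" using le[of 0] by (meson centre_in_ball norm_ge_zero order_trans zero_less_one)
  have le': "cmod (G z) * eval_weight \<alpha> z \<le> M * eval_weight \<alpha> z" if "z \<in> unit_disk" for z
    using le[OF that] eval_weight_pos[OF that, of \<alpha>] by (intro mult_right_mono) auto
  show "(\<lambda>z. G z * f z) \<in> bergman_space \<alpha>" "bergman_norm \<alpha> (\<lambda>z. G z * f z) \<le> M * bergman_norm \<alpha> f"
    using weighted_composition_bound[OF \<alpha> disk_bijection_id f G M le'] by (simp_all add: eq)
qed

lemma bergman_space_scale:
  assumes \<alpha>: "\<alpha> > -1" and f: "f \<in> bergman_space \<alpha>"
  shows "(\<lambda>z. c * f z) \<in> bergman_space \<alpha>"
    and "bergman_norm \<alpha> (\<lambda>z. c * f z) \<le> cmod c * bergman_norm \<alpha> f"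
  using bounded_multiple_bound[OF \<alpha> f, of "\<lambda>_. c" "cmod c"] by auto

text \<open>The crude parallelogram bound suffices, because only the existence of operator bounds is
  ever at stake for sums.\<close>

lemma bergman_space_add:
  assumes \<alpha>: "\<alpha> > -1" and f: "f \<in> bergman_space \<alpha>" and g: "g \<in> bergman_space \<alpha>"
  shows "(\<lambda>z. f z + g z) \<in> bergman_space \<alpha>"
    and "bergman_norm \<alpha> (\<lambda>z. f z + g z) \<le> 2 * (bergman_norm \<alpha> f + bergman_norm \<alpha> g)"
proof -
  let ?h = "\<lambda>z. 2 * bergman_density \<alpha> f z + 2 * bergman_density \<alpha> g z"
  have int: "set_integrable lborel unit_disk (\<lambda>z. 2 * bergman_density \<alpha> f z)"
     "set_integrable lborel unit_disk (\<lambda>z. 2 * bergman_density \<alpha> g z)"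
    using bergman_spaceD(3)[OF f] bergman_spaceD(3)[OF g] by auto
  have int': "set_integrable lborel unit_disk ?h"
    using int by (rule set_integral_add)
  have bd: "bergman_density \<alpha> (\<lambda>z. f z + g z) z \<le> ?h z" for z
  proof -
    have "(cmod (f z + g z))\<^sup>2 \<le> (cmod (f z) + cmod (g z))\<^sup>2"
      by (intro power_mono norm_triangle_ineq) auto
    also have "\<dots> \<le> 2 * (cmod (f z))\<^sup>2 + 2 * (cmod (g z))\<^sup>2"
      using sum_squares_bound[of "cmod (f z)" "cmod (g z)"] by (simp add: power2_sum)
    finally have "(cmod (f z + g z))\<^sup>2 * ((1 + \<alpha>) / pi * (1 - (cmod z)\<^sup>2) powr \<alpha>)
       \<le> (2 * (cmod (f z))\<^sup>2 + 2 * (cmod (g z))\<^sup>2) * ((1 + \<alpha>) / pi * (1 - (cmod z)\<^sup>2) powr \<alpha>)"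
      using \<alpha> by (intro mult_right_mono) auto
    then show ?thesis by (simp only: bergman_density_def distrib_right mult.assoc)
  qed
  have hol: "(\<lambda>z. f z + g z) holomorphic_on unit_disk"
    using bergman_spaceD(1)[OF f] bergman_spaceD(1)[OF g] by (intro holomorphic_intros)
  note dom = bergman_space_dominated[OF \<alpha> hol _ int' bd]
  show "(\<lambda>z. f z + g z) \<in> bergman_space \<alpha>"
    by (rule dom(1)) (simp add: bergman_spaceD(2)[OF f] bergman_spaceD(2)[OF g])
  have "(bergman_norm \<alpha> (\<lambda>z. f z + g z))\<^sup>2 \<le> (LINT z:unit_disk|lborel. ?h z)"
    by (rule dom(2)) (simp add: bergman_spaceD(2)[OF f] bergman_spaceD(2)[OF g])
  also have "\<dots> = 2 * (bergman_norm \<alpha> f)\<^sup>2 + 2 * (bergman_norm \<alpha> g)\<^sup>2"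
    using int by (subst set_integral_add) (simp_all add: bergman_norm_square[OF \<alpha>])
  also have "\<dots> \<le> (2 * (bergman_norm \<alpha> f + bergman_norm \<alpha> g))\<^sup>2"
    using bergman_norm_nonneg[OF \<alpha>, of f] bergman_norm_nonneg[OF \<alpha>, of g]
    by (simp add: power2_eq_square algebra_simps)
  finally show "bergman_norm \<alpha> (\<lambda>z. f z + g z) \<le> 2 * (bergman_norm \<alpha> f + bergman_norm \<alpha> g)"
    by (rule power2_le_imp_le) (use bergman_norm_nonneg[OF \<alpha>] in \<open>simp add: add_nonneg_nonneg\<close>)
qed

section \<open>Point evaluations on the Bergman space\<close>

text \<open>On the annulus where the distance to the circle
  is about \<open>2 powr (-k)\<close> the function is at most a constant times \<open>2 powr (-k * \<beta>)\<close> and the area is at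
  most a constant times \<open>2 powr (-k)\<close>, so the annuli contribute a convergent geometric series.\<close>

lemma boundary_power_integrable:
  fixes \<beta> :: real
  assumes \<beta>: "\<beta> > -1" "\<beta> \<le> 0"
  shows "set_integrable lborel unit_disk (\<lambda>z. (1 - cmod z) powr \<beta>)"
proof -
  define c where "c k = ((1/2) ^ (Suc k)) powr \<beta>" for k :: nat
  define B where "B k = unit_disk - ball 0 (1 - (1/2)^k)" for k :: nat
  let ?g = "\<lambda>z. indicator unit_disk z * (1 - cmod z) powr \<beta>"
  have cpos: "c k \<ge> 0" for k by (simp add: c_def)
  have mB [measurable]: "B k \<in> sets borel" for k by (simp add: B_def)
  have eB: "emeasure lborel (B k) \<le> ennreal (2 * pi * (1/2)^k)" for k
  proof -
    have le1: "(1/2::real)^k \<le> 1" by (simp add: power_le_one)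
    have sub: "ball (0::complex) (1 - (1/2)^k) \<subseteq> unit_disk"
      by (rule subset_ball) simp
    have "emeasure lborel (B k) = emeasure lborel unit_disk - emeasure lborel (ball (0::complex) (1 - (1/2)^k))"
      unfolding B_def using sub le1 by (intro emeasure_Diff) (auto simp: emeasure_ball)
    also have "\<dots> = ennreal (pi - pi * (1 - (1/2)^k)\<^sup>2)"
      using le1 by (simp add: emeasure_ball unit_ball_vol_2 ennreal_minus power_le_one)
    also have "\<dots> \<le> ennreal (2 * pi * (1/2)^k)"
    proof (rule ennreal_leI)
      have "1 - (1 - x)\<^sup>2 \<le> 2 * x" for x :: real by (simp add: power2_eq_square algebra_simps)
      from mult_left_mono[OF this[of "(1/2)^k"], of pi]
      show "pi - pi * (1 - (1/2)^k)\<^sup>2 \<le> 2 * pi * (1/2)^k" by (simp add: algebra_simps)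
    qed
    finally show ?thesis .
  qed
  have pt: "ennreal (?g z) \<le> (\<Sum>k. ennreal (c k) * indicator (B k) z)" for z
  proof (cases "z \<in> unit_disk")
    case True
    define d where "d = 1 - cmod z"
    have d: "0 < d" "d \<le> 1" using True by (auto simp: d_def)
    have "\<exists>n. (1/2)^n < d" using real_arch_pow_inv[of d "1/2"] d by auto
    define n where "n = (LEAST n. (1/2)^n < d)"
    have n: "(1/2)^n < d" unfolding n_def by (rule LeastI_ex) fact
    have "n \<noteq> 0" using n d by (cases n) auto
    then obtain k where k: "n = Suc k" using not0_implies_Suc by blast
    have "\<not> (1/2)^k < d" using not_less_Least[of k "\<lambda>n. (1/2)^n < d"] k n_def by simp
    then have "z \<in> B k" using True by (auto simp: B_def d_def)
    moreover have "d powr \<beta> \<le> c k"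
      unfolding c_def using n k \<beta> d by (intro powr_mono2') auto
    ultimately have "ennreal (?g z) \<le> ennreal (c k) * indicator (B k) z"
      using True by (simp add: d_def ennreal_leI)
    also have "\<dots> \<le> (\<Sum>k. ennreal (c k) * indicator (B k) z)"
    proof -
      define t where "t = (\<lambda>k. ennreal (c k) * indicator (B k) z)"
      have "t k \<le> suminf t" using sum_le_suminf[of t "{k}"] by simp
      then show ?thesis by (simp only: t_def)
    qed
    finally show ?thesis .
  qed simp
  have ck: "c k * (2 * pi * (1/2)^k) = 2 * pi * ((1/2) powr \<beta>) * ((1/2) powr (1 + \<beta>)) ^ k" for k
  proof -
    have "c k = (1/2) powr (real (Suc k) * \<beta>)"
      unfolding c_def by (subst powr_realpow[symmetric]) (simp_all add: powr_powr)
    moreover have "(1/2::real)^k = (1/2) powr real k" by (simp add: powr_realpow)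
    moreover have "((1/2) powr (1 + \<beta>)) ^ k = (1/2) powr (real k * (1 + \<beta>))"
      by (subst powr_realpow[symmetric]) (simp_all add: powr_powr mult.commute)
    ultimately show ?thesis by (simp add: powr_add[symmetric] algebra_simps)
  qed
  have "(1/2::real) powr (1 + \<beta>) < 1"
    using \<beta> powr_less_mono'[of "1/2::real" 0 "1 + \<beta>"] by simp
  then have summ: "summable (\<lambda>k. c k * (2 * pi * (1/2)^k))"
    unfolding ck by (intro summable_mult summable_geometric) simp
  have "(\<integral>\<^sup>+z. ennreal (?g z) \<partial>lborel) \<le> (\<integral>\<^sup>+z. (\<Sum>k. ennreal (c k) * indicator (B k) z) \<partial>lborel)"
    by (rule nn_integral_mono) (rule pt)
  also have "\<dots> = (\<Sum>k. (\<integral>\<^sup>+z. ennreal (c k) * indicator (B k) z \<partial>lborel))"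
    by (rule nn_integral_suminf) simp
  also have "\<dots> = (\<Sum>k. ennreal (c k) * emeasure lborel (B k))"
    by (simp add: nn_integral_cmult_indicator)
  also have "\<dots> \<le> (\<Sum>k. ennreal (c k * (2 * pi * (1/2)^k)))"
  proof (rule suminf_le)
    show "ennreal (c k) * emeasure lborel (B k) \<le> ennreal (c k * (2 * pi * (1/2)^k))" for k
      using mult_left_mono[OF eB[of k], of "ennreal (c k)"] cpos[of k] by (simp add: ennreal_mult)
  qed auto
  also have "\<dots> < \<infinity>"
  proof -
    have "(\<Sum>k. ennreal (c k * (2 * pi * (1/2)^k))) \<noteq> top"
      by (rule ennreal_suminf_neq_top[OF summ]) (simp add: cpos)
    then show ?thesis by (simp only: infinity_ennreal_def top.not_eq_extremum)
  qed
  finally have fin: "(\<integral>\<^sup>+z. ennreal (?g z) \<partial>lborel) < \<infinity>" .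
  have "integrable lborel ?g"
  proof (rule integrableI_nonneg[OF _ _ fin])
    show "?g \<in> borel_measurable lborel"
      by (intro borel_measurable_times borel_measurable_indicator) (simp_all add: powr_real_measurable)
  qed simp
  then show ?thesis by (simp add: set_integrable_def)
qed

abbreviation disk_one :: "complex \<Rightarrow> complex" where
  "disk_one \<equiv> (\<lambda>z. if z \<in> unit_disk then 1 else 0)"

lemma disk_one_bergman:
  assumes \<alpha>: "\<alpha> > -1" shows "disk_one \<in> bergman_space \<alpha>"
proof (rule bergman_space_dominated(1)[OF \<alpha>])
  show "disk_one holomorphic_on unit_disk"
    by (rule holomorphic_transform[of "\<lambda>_. 1"]) auto
  have "min \<alpha> 0 > -1" "min \<alpha> 0 \<le> 0" using \<alpha> by auto
  then show "set_integrable lborel unit_disk (\<lambda>z. (1 + \<alpha>) / pi * (1 - cmod z) powr (min \<alpha> 0))"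
    using boundary_power_integrable by simp
  fix z :: complex assume z: "z \<in> unit_disk"
  have le: "1 - cmod z \<le> 1 - (cmod z)\<^sup>2"
    using z by (simp add: power2_eq_square mult_left_le)
  have "(1 - (cmod z)\<^sup>2) powr \<alpha> \<le> (1 - (cmod z)\<^sup>2) powr (min \<alpha> 0)"
    using one_minus_norm_pos[OF z] by (intro powr_mono') auto
  also have "\<dots> \<le> (1 - cmod z) powr (min \<alpha> 0)"
    using le z by (intro powr_mono2') auto
  finally have "(1 - (cmod z)\<^sup>2) powr \<alpha> \<le> (1 - cmod z) powr (min \<alpha> 0)" .
  then show "bergman_density \<alpha> disk_one z \<le> (1 + \<alpha>) / pi * (1 - cmod z) powr (min \<alpha> 0)"
    using \<alpha> z unfolding bergman_density_def by (auto intro!: mult_left_mono divide_right_mono)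
qed simp

text \<open>Cauchy's formula for the square of \<open>f\<close> at the centre of the circle through \<open>z\<close>.\<close>

lemma square_at_0_le_circle_mean:
  assumes f: "f holomorphic_on unit_disk" and z: "z \<in> unit_disk"
  shows "ennreal ((cmod (f 0))\<^sup>2) \<le>
     (\<integral>\<^sup>+t. ennreal ((cmod (f (exp (2 * of_real pi * \<i> * of_real t) * z)))\<^sup>2) * indicator {0..1} t \<partial>lborel)"
proof -
  define e where "e = (\<lambda>t::real. exp (2 * of_real pi * \<i> * of_real t))"
  define F where "F = (\<lambda>u. (f (u * z))\<^sup>2)"
  have in_disk: "u * z \<in> unit_disk" if "u \<in> cball 0 1" for u
    using that z mult_le_one[of "cmod u" "cmod z"] mult_right_le_one_le[of "cmod z" "cmod u"]
    by (simp add: norm_mult mult.commute)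
  have "(f \<circ> (\<lambda>u. u * z)) holomorphic_on cball 0 1"
    using in_disk by (intro holomorphic_on_compose_gen[OF _ f] holomorphic_intros) auto
  then have F: "F holomorphic_on cball 0 1"
    unfolding F_def by (auto intro!: holomorphic_intros simp: o_def)
  have ne: "e t \<noteq> 0" and ce: "e t \<in> cball 0 1" and cp: "circlepath 0 1 t = e t" for t
    by (auto simp: e_def circlepath)
  have "((\<lambda>u. F u / (u - 0)) has_contour_integral (2 * of_real pi * \<i> * F 0)) (circlepath 0 1)"
    by (rule Cauchy_integral_circlepath_simple[OF F]) simp
  then have "((\<lambda>t. F (e t) / e t * (2 * of_real pi * \<i> * e t)) has_integral (2 * of_real pi * \<i> * F 0)) {0..1}"
    unfolding has_contour_integral_def
    by (rule has_integral_eq[rotated]) (simp add: cp vector_derivative_circlepath01, simp add: e_def)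
  then have "((\<lambda>t. (2 * of_real pi * \<i>) * F (e t)) has_integral ((2 * of_real pi * \<i>) * F 0)) {0..1}"
    by (rule has_integral_eq[rotated]) (simp add: ne)
  from has_integral_mult_right[OF this, of "inverse (2 * of_real pi * \<i>)"]
  have I: "((\<lambda>t. F (e t)) has_integral F 0) {0..1}" by (simp add: field_simps)
  have cont: "continuous_on {0..1} (\<lambda>t. F (e t))"
    using ce unfolding e_def
    by (intro continuous_on_compose2[OF holomorphic_on_imp_continuous_on[OF F]] continuous_intros) auto
  then have ni: "(\<lambda>t. cmod (F (e t))) integrable_on {0..1}"
    by (intro integrable_continuous_real continuous_on_norm)
  have "cmod (F 0) = cmod (integral {0..1} (\<lambda>t. F (e t)))"
    using I by (simp add: integral_unique)
  also have "\<dots> \<le> integral {0..1} (\<lambda>t. cmod (F (e t)))"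
    using I ni by (intro Henstock_Kurzweil_Integration.integral_norm_bound_integral) auto
  finally have "ennreal (cmod (F 0)) \<le> ennreal (integral {0..1} (\<lambda>t. cmod (F (e t))))"
    by (rule ennreal_leI)
  also have "\<dots> = (\<integral>\<^sup>+t. ennreal (cmod (F (e t))) * indicator {0..1} t \<partial>lborel)"
    by (rule nn_integral_has_integral_lebesgue'[symmetric])
      (use ni in \<open>auto simp: integrable_integral\<close>)
  finally show ?thesis by (simp add: F_def e_def norm_power)
qed

lemma rotation_invariant_integral:
  assumes f: "f holomorphic_on unit_disk" and u: "cmod u = 1" and r: "0 < r" "r < 1"
  shows "(LINT z:ball 0 r|lborel. (cmod (f (u * z)))\<^sup>2) = (LINT z:ball 0 r|lborel. (cmod (f z))\<^sup>2)"
    and "set_integrable lborel (ball 0 r) (\<lambda>z. (cmod (f z))\<^sup>2)"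
    and "set_integrable lborel (ball 0 r) (\<lambda>z. (cmod (f (u * z)))\<^sup>2)"
proof -
  have cont: "continuous_on unit_disk (\<lambda>z. (cmod (f z))\<^sup>2)"
    using f by (intro continuous_intros holomorphic_on_imp_continuous_on)
  have "integrable lborel (\<lambda>z. indicator (cball 0 r) z *\<^sub>R (cmod (f z))\<^sup>2)"
    by (rule borel_integrable_compact[OF compact_cball continuous_on_subset[OF cont]]) (use r in auto)
  then have "set_integrable lborel (cball 0 r) (\<lambda>z. (cmod (f z))\<^sup>2)"
    by (simp add: set_integrable_def)
  then show int: "set_integrable lborel (ball 0 r) (\<lambda>z. (cmod (f z))\<^sup>2)"
    by (rule set_integrable_subset) auto
  have im: "(*) u ` ball 0 r = ball 0 r"
  proof (intro equalityI subsetI)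
    fix z :: complex assume "z \<in> ball 0 r"
    then show "z \<in> (*) u ` ball 0 r"
      using u by (intro image_eqI[of _ _ "z / u"]) (auto simp: norm_divide)
  qed (use u in \<open>auto simp: norm_mult\<close>)
  have inj: "inj_on ((*) u) (ball 0 r)" using u by (auto intro!: inj_onI)
  have dr: "deriv ((*) u) z = u" for z by (rule DERIV_imp_deriv) (auto intro!: derivative_eq_intros)
  have c: "continuous_on ((*) u ` ball 0 r) (\<lambda>z. (cmod (f z))\<^sup>2)"
    unfolding im by (rule continuous_on_subset[OF cont]) (use r in auto)
  have i: "set_integrable lborel ((*) u ` ball 0 r) (\<lambda>z. (cmod (f z))\<^sup>2)"
    unfolding im by (rule int)
  have hol: "(*) u holomorphic_on ball 0 r" by (intro holomorphic_intros)
  from holomorphic_change_of_variables[OF open_ball hol inj c i]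
  show "(LINT z:ball 0 r|lborel. (cmod (f (u * z)))\<^sup>2) = (LINT z:ball 0 r|lborel. (cmod (f z))\<^sup>2)"
    "set_integrable lborel (ball 0 r) (\<lambda>z. (cmod (f (u * z)))\<^sup>2)"
    by (simp_all add: dr u im)
qed

text \<open>Averaging the mean value inequality over the disk of radius one half; by rotation invariance the
  average over the angle drops out.\<close>

lemma eval_at_0_bounded:
  assumes \<alpha>: "\<alpha> > -1"
  obtains C where "C \<ge> 0" "\<And>f. f \<in> bergman_space \<alpha> \<Longrightarrow> cmod (f 0) \<le> C * bergman_norm \<alpha> f"
proof -
  let ?B = "ball (0::complex) (1/2)"
  let ?e = "\<lambda>t::real. exp (2 * of_real pi * \<i> * of_real t)"
  define m where "m = (1 + \<alpha>) / pi * min 1 ((3/4) powr \<alpha>)"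
  have m: "m > 0" using \<alpha> by (simp add: m_def)
  have vol: "emeasure lborel ?B = ennreal (pi / 4)"
    by (simp add: emeasure_ball unit_ball_vol_2 power2_eq_square)
  have main: "(pi / 4 * m) * (cmod (f 0))\<^sup>2 \<le> (bergman_norm \<alpha> f)\<^sup>2" if f: "f \<in> bergman_space \<alpha>" for f
  proof -
    note fD = bergman_spaceD[OF f]
    let ?g = "\<lambda>z. (cmod (f z))\<^sup>2"
    have "f = (\<lambda>z. indicator unit_disk z *\<^sub>R f z)" using fD(2) by (auto simp: fun_eq_iff indicator_def)
    then have fm [measurable]: "f \<in> borel_measurable borel"
      using borel_measurable_continuous_on_indicator[OF _ holomorphic_on_imp_continuous_on[OF fD(1)]] by simp
    have em [measurable]: "?e \<in> borel_measurable borel"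
      by (intro borel_measurable_continuous_onI continuous_intros)
    have Bm [measurable]: "?B \<in> sets borel" by simp
    let ?I = "LINT z:?B|lborel. ?g z"
    have inner: "(\<integral>\<^sup>+z. ennreal (?g (?e t * z)) * indicator ?B z \<partial>lborel) = ennreal ?I" for t
    proof -
      have u: "cmod (?e t) = 1" by simp
      note rot = rotation_invariant_integral[OF fD(1) u, of "1/2"]
      have "(\<integral>\<^sup>+z. ennreal (?g (?e t * z)) * indicator ?B z \<partial>lborel)
          = (\<integral>\<^sup>+z. ennreal (indicator ?B z *\<^sub>R ?g (?e t * z)) \<partial>lborel)"
        by (intro nn_integral_cong) (auto simp: indicator_def)
      also have "\<dots> = ennreal (LINT z:?B|lborel. ?g (?e t * z))"
        unfolding set_lebesgue_integral_def using rot(3)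
        by (intro nn_integral_eq_integral) (auto simp: set_integrable_def)
      finally show ?thesis using rot(1) by simp
    qed
    have "ennreal (?g 0) * ennreal (pi / 4) = (\<integral>\<^sup>+z. ennreal (?g 0) * indicator ?B z \<partial>lborel)"
      by (simp add: nn_integral_cmult_indicator vol)
    also have "\<dots> \<le> (\<integral>\<^sup>+z. (\<integral>\<^sup>+t. ennreal (?g (?e t * z)) * indicator {0..1} t * indicator ?B z \<partial>lborel) \<partial>lborel)"
    proof (rule nn_integral_mono)
      fix z :: complex
      show "ennreal (?g 0) * indicator ?B z
          \<le> (\<integral>\<^sup>+t. ennreal (?g (?e t * z)) * indicator {0..1} t * indicator ?B z \<partial>lborel)"
        using square_at_0_le_circle_mean[OF fD(1), of z] by (cases "z \<in> ?B") auto
    qed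
    also have "\<dots> = (\<integral>\<^sup>+t. (\<integral>\<^sup>+z. ennreal (?g (?e t * z)) * indicator {0..1} t * indicator ?B z \<partial>lborel) \<partial>lborel)"
      by (rule lborel_pair.Fubini') (intro borel_measurable_times_ennreal measurable_compose[OF measurable_snd]
        measurable_compose[OF measurable_fst] borel_measurable_indicator measurable, use Bm in simp_all)
    also have "\<dots> = (\<integral>\<^sup>+t. ennreal ?I * indicator {0..1::real} t \<partial>lborel)"
    proof (rule nn_integral_cong)
      fix t :: real
      show "(\<integral>\<^sup>+z. ennreal (?g (?e t * z)) * indicator {0..1} t * indicator ?B z \<partial>lborel)
          = ennreal ?I * indicator {0..1} t"
        using inner[of t] by (cases "t \<in> {0..1}") auto
    qed
    also have "\<dots> = ennreal ?I" by (simp add: nn_integral_cmult_indicator)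
    finally have "ennreal (?g 0) * ennreal (pi / 4) \<le> ennreal ?I" .
    moreover have "ennreal (?g 0 * (pi / 4)) = ennreal (?g 0) * ennreal (pi / 4)"
      by (rule ennreal_mult) auto
    ultimately have "ennreal (?g 0 * (pi / 4)) \<le> ennreal ?I" by simp
    moreover have I0: "?I \<ge> 0"
      unfolding set_lebesgue_integral_def by (intro integral_nonneg_AE AE_I2) auto
    ultimately have gI: "?g 0 * (pi / 4) \<le> ?I" by (simp add: ennreal_le_iff)
    have intg: "set_integrable lborel ?B ?g"
      using rotation_invariant_integral(2)[OF fD(1), of 1 "1/2"] by simp
    have intd: "set_integrable lborel ?B (bergman_density \<alpha> f)"
      by (rule set_integrable_subset[OF fD(3)]) auto
    have "m * ?I = (LINT z:?B|lborel. m * ?g z)" by simp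
    also have "\<dots> \<le> (LINT z:?B|lborel. bergman_density \<alpha> f z)"
    proof (rule set_integral_mono[OF _ intd])
      show "set_integrable lborel ?B (\<lambda>z. m * ?g z)" using intg by simp
      fix z assume z: "z \<in> ?B"
      have x: "3/4 \<le> 1 - (cmod z)\<^sup>2"
        using power_mono[of "cmod z" "1/2" 2] z by (simp add: power2_eq_square)
      have "min 1 ((3/4) powr \<alpha>) \<le> (1 - (cmod z)\<^sup>2) powr \<alpha>"
      proof (cases "\<alpha> \<ge> 0")
        case True
        then have "(3/4) powr \<alpha> \<le> (1 - (cmod z)\<^sup>2) powr \<alpha>" using x by (intro powr_mono2) auto
        then show ?thesis by simp
      next
        case False
        then have "1 powr \<alpha> \<le> (1 - (cmod z)\<^sup>2) powr \<alpha>" using x by (intro powr_mono2') auto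
        then show ?thesis by simp
      qed
      then have "m \<le> (1 + \<alpha>) / pi * (1 - (cmod z)\<^sup>2) powr \<alpha>"
        unfolding m_def using \<alpha> by (intro mult_left_mono) auto
      then show "m * ?g z \<le> bergman_density \<alpha> f z"
        unfolding bergman_density_def by (subst mult.commute) (intro mult_left_mono, auto)
    qed
    also have "\<dots> \<le> (LINT z:unit_disk|lborel. bergman_density \<alpha> f z)"
    proof -
      have "(LINT z|lborel. indicator ?B z *\<^sub>R bergman_density \<alpha> f z)
          \<le> (LINT z|lborel. indicator unit_disk z *\<^sub>R bergman_density \<alpha> f z)"
        using intd fD(3) bergman_density_nonneg[OF \<alpha>]
        by (intro integral_mono) (auto simp: set_integrable_def indicator_def)
      then show ?thesis by (simp add: set_lebesgue_integral_def)
    qed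
    finally have "m * ?I \<le> (bergman_norm \<alpha> f)\<^sup>2" using bergman_norm_square[OF \<alpha>] by simp
    moreover have "m * (?g 0 * (pi / 4)) \<le> m * ?I" using m by (intro mult_left_mono gI) auto
    ultimately have "m * (?g 0 * (pi / 4)) \<le> (bergman_norm \<alpha> f)\<^sup>2" by linarith
    then show ?thesis by (simp only: mult_ac)
  qed
  define C where "C = 1 / sqrt (pi / 4 * m)"
  have k: "pi / 4 * m > 0" using m by simp
  have "cmod (f 0) \<le> C * bergman_norm \<alpha> f" if f: "f \<in> bergman_space \<alpha>" for f
  proof -
    have "(cmod (f 0))\<^sup>2 \<le> (C * bergman_norm \<alpha> f)\<^sup>2"
      using main[OF f] k m by (simp add: C_def power_mult_distrib power_divide field_simps)
    then show ?thesis
      by (rule power2_le_imp_le) (use bergman_norm_nonneg[OF \<alpha>, of f] m in \<open>simp add: C_def\<close>)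
  qed
  then show ?thesis using that[of C] m by (simp add: C_def)
qed

text \<open>The normalised power of the reproducing kernel: up to a factor of modulus one it is a power of the derivative of the disk
  automorphism vanishing at \<open>c\<close>, and multiplication by it makes composition with that
  automorphism isometric.\<close>

definition unit_kernel :: "real \<Rightarrow> complex \<Rightarrow> complex \<Rightarrow> complex" where
  "unit_kernel \<alpha> c z = (if z \<in> unit_disk
     then of_real (eval_weight \<alpha> c) / (1 - cnj c * z) powr of_real (\<alpha> + 2) else 0)"

lemma unit_kernel_holomorphic:
  assumes c: "c \<in> unit_disk"
  shows "unit_kernel \<alpha> c holomorphic_on unit_disk"
proof -
  have re: "1 - cnj c * z \<notin> \<real>\<^sub>\<le>\<^sub>0" if "z \<in> unit_disk" for z
  proof -
    have "cmod (cnj c * z) < 1" using c that norm_mult_less[of "cnj c" 1 z 1] by simp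
    then have "Re (cnj c * z) < 1" using complex_Re_le_cmod[of "cnj c * z"] by linarith
    then have "Re (1 - cnj c * z) > 0" by (simp only: minus_complex.sel one_complex.sel)
    then show ?thesis by (auto simp: complex_nonpos_Reals_iff)
  qed
  have "(\<lambda>z. of_real (eval_weight \<alpha> c) / (1 - cnj c * z) powr of_real (\<alpha> + 2)) holomorphic_on unit_disk"
    using re c one_minus_cnj_mult_nonzero[of c] by (intro holomorphic_intros) auto
  then show ?thesis by (rule holomorphic_transform) (simp add: unit_kernel_def)
qed

lemma unit_kernel_weight:
  assumes c: "c \<in> unit_disk" and z: "z \<in> unit_disk"
  shows "cmod (unit_kernel \<alpha> c z) * eval_weight \<alpha> z = eval_weight \<alpha> (Moebius_function 0 c z)"
proof -
  have N: "cmod (1 - cnj c * z) > 0"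
    using one_minus_cnj_mult_nonzero[of c z] c z by simp
  have "eval_weight \<alpha> (Moebius_function 0 c z) =
      ((1 - (cmod c)\<^sup>2) * (1 - (cmod z)\<^sup>2) / (cmod (1 - cnj c * z))\<^sup>2) powr ((\<alpha> + 2) / 2)"
    using Moebius_one_minus_norm[of c z 1] c z by (simp add: eval_weight_def Moebius_function_simple)
  also have "\<dots> = eval_weight \<alpha> c * eval_weight \<alpha> z / ((cmod (1 - cnj c * z))\<^sup>2) powr ((\<alpha> + 2) / 2)"
    using one_minus_norm_pos[OF c] one_minus_norm_pos[OF z]
    by (simp add: eval_weight_def powr_divide powr_mult)
  also have "((cmod (1 - cnj c * z))\<^sup>2) powr ((\<alpha> + 2) / 2) = cmod (1 - cnj c * z) powr (\<alpha> + 2)"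
  proof -
    have "(cmod (1 - cnj c * z))\<^sup>2 = cmod (1 - cnj c * z) powr 2" using N by simp
    moreover have "2 * ((\<alpha> + 2) / 2) = \<alpha> + 2" by simp
    ultimately show ?thesis by (simp only: powr_powr)
  qed
  finally show ?thesis using z eval_weight_pos[OF c, of \<alpha>]
    by (simp add: unit_kernel_def norm_divide norm_powr_real_powr' abs_of_pos)
qed

lemma eval_weight_le_one: "z \<in> unit_disk \<Longrightarrow> \<alpha> > -1 \<Longrightarrow> eval_weight \<alpha> z \<le> 1"
  using one_minus_norm_pos[of z] unfolding eval_weight_def
  by (intro powr_le1) auto

lemma unit_kernel_bounds:
  assumes \<alpha>: "\<alpha> > -1" and c: "c \<in> unit_disk"
  shows "\<And>z. z \<in> unit_disk \<Longrightarrow> cmod (unit_kernel \<alpha> c z) * eval_weight \<alpha> z \<le> 1"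
    and "cmod (unit_kernel \<alpha> c c) * eval_weight \<alpha> c = 1"
proof -
  fix z assume z: "z \<in> unit_disk"
  show "cmod (unit_kernel \<alpha> c z) * eval_weight \<alpha> z \<le> 1"
    unfolding unit_kernel_weight[OF c z] using c z \<alpha> Moebius_function_norm_lt_1[of c z 0]
    by (intro eval_weight_le_one) auto
next
  show "cmod (unit_kernel \<alpha> c c) * eval_weight \<alpha> c = 1"
    unfolding unit_kernel_weight[OF c c] by (simp add: Moebius_function_eq_zero eval_weight_def)
qed

lemma unit_kernel_composition:
  assumes \<alpha>: "\<alpha> > -1" and c: "c \<in> unit_disk" and f: "f \<in> bergman_space \<alpha>"
  shows "weighted_composition (unit_kernel \<alpha> c) (Moebius_function 0 c) f \<in> bergman_space \<alpha>"
    and "bergman_norm \<alpha> (weighted_composition (unit_kernel \<alpha> c) (Moebius_function 0 c) f) \<le> bergman_norm \<alpha> f"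
proof -
  have c1: "cmod c < 1" using c by simp
  have le: "cmod (unit_kernel \<alpha> c z) * eval_weight \<alpha> z \<le> 1 * eval_weight \<alpha> (Moebius_function 0 c z)"
    if "z \<in> unit_disk" for z
    using unit_kernel_weight[OF c that] by simp
  show "weighted_composition (unit_kernel \<alpha> c) (Moebius_function 0 c) f \<in> bergman_space \<alpha>"
    "bergman_norm \<alpha> (weighted_composition (unit_kernel \<alpha> c) (Moebius_function 0 c) f) \<le> bergman_norm \<alpha> f"
    using weighted_composition_bound[OF \<alpha> disk_bijection_Moebius[OF c1] f unit_kernel_holomorphic[OF c] _ le]
    by simp_all
qed

lemma unit_kernel_bergman:
  assumes \<alpha>: "\<alpha> > -1" and c: "c \<in> unit_disk"
  shows "unit_kernel \<alpha> c \<in> bergman_space \<alpha>"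
    and "bergman_norm \<alpha> (unit_kernel \<alpha> c) \<le> bergman_norm \<alpha> disk_one"
proof -
  have "weighted_composition (unit_kernel \<alpha> c) (Moebius_function 0 c) disk_one = unit_kernel \<alpha> c"
    using c Moebius_function_norm_lt_1[of c _ 0]
    by (auto simp: weighted_composition_def fun_eq_iff unit_kernel_def)
  then show "unit_kernel \<alpha> c \<in> bergman_space \<alpha>"
    "bergman_norm \<alpha> (unit_kernel \<alpha> c) \<le> bergman_norm \<alpha> disk_one"
    using unit_kernel_composition[OF \<alpha> c disk_one_bergman[OF \<alpha>]] by simp_all
qed

text \<open>Moving an arbitrary point to the origin by the isometry of the preceding lemmas.\<close>

lemma point_evaluation_bounded:
  assumes \<alpha>: "\<alpha> > -1"
  obtains C where "C > 0"
    "\<And>f z. f \<in> bergman_space \<alpha> \<Longrightarrow> z \<in> unit_disk \<Longrightarrow> eval_weight \<alpha> z * cmod (f z) \<le> C * bergman_norm \<alpha> f"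
proof -
  obtain C where C: "C \<ge> 0" "\<And>f. f \<in> bergman_space \<alpha> \<Longrightarrow> cmod (f 0) \<le> C * bergman_norm \<alpha> f"
    using eval_at_0_bounded[OF \<alpha>] by blast
  have "eval_weight \<alpha> z * cmod (f z) \<le> (C + 1) * bergman_norm \<alpha> f"
    if f: "f \<in> bergman_space \<alpha>" and z: "z \<in> unit_disk" for f z
  proof -
    have z': "- z \<in> unit_disk" using z by simp
    let ?g = "weighted_composition (unit_kernel \<alpha> (-z)) (Moebius_function 0 (-z)) f"
    note g = unit_kernel_composition[OF \<alpha> z' f]
    have "cmod (?g 0) = eval_weight \<alpha> z * cmod (f z)"
      using eval_weight_pos[OF z, of \<alpha>]
      by (simp add: weighted_composition_def unit_kernel_def Moebius_function_of_zero norm_mult eval_weight_def)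
    then have "eval_weight \<alpha> z * cmod (f z) \<le> C * bergman_norm \<alpha> ?g" using C(2)[OF g(1)] by simp
    also have "\<dots> \<le> C * bergman_norm \<alpha> f" using C(1) g(2) by (rule mult_left_mono[rotated])
    also have "\<dots> \<le> (C + 1) * bergman_norm \<alpha> f" using bergman_norm_nonneg[OF \<alpha>, of f] by (simp add: algebra_simps)
    finally show ?thesis .
  qed
  then show ?thesis using that[of "C + 1"] C(1) by simp
qed

section \<open>Neumann series and the resolvent\<close>

lemma suminf_square_le_weighted:
  fixes a :: "nat \<Rightarrow> complex"
  assumes q: "0 < q" "q < 1" and a: "summable a" and b: "summable (\<lambda>n. (cmod (a n))\<^sup>2 / q ^ n)"
  shows "(cmod (\<Sum>n. a n))\<^sup>2 \<le> (1 / (1 - q)) * (\<Sum>n. (cmod (a n))\<^sup>2 / q ^ n)"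
proof -
  let ?R = "(1 / (1 - q)) * (\<Sum>n. (cmod (a n))\<^sup>2 / q ^ n)"
  have "(cmod (\<Sum>n<M. a n))\<^sup>2 \<le> ?R" for M
  proof -
    have sq: "(sqrt (q ^ n))\<^sup>2 = q ^ n" "sqrt (q ^ n) > 0" for n using q by auto
    have "(cmod (\<Sum>n<M. a n))\<^sup>2 \<le> (\<Sum>n<M. cmod (a n))\<^sup>2"
      by (intro power_mono norm_sum) auto
    also have "\<dots> = (\<Sum>n<M. sqrt (q ^ n) * (cmod (a n) / sqrt (q ^ n)))\<^sup>2"
      using sq(2) by (metis (no_types, lifting) nonzero_mult_div_cancel_left less_irrefl times_divide_eq_right)
    also have "\<dots> \<le> (\<Sum>n<M. (sqrt (q ^ n))\<^sup>2) * (\<Sum>n<M. (cmod (a n) / sqrt (q ^ n))\<^sup>2)"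
      by (rule Cauchy_Schwarz_ineq_sum)
    also have "\<dots> = (\<Sum>n<M. q ^ n) * (\<Sum>n<M. (cmod (a n))\<^sup>2 / q ^ n)"
      by (simp add: sq(1) power_divide)
    also have "\<dots> \<le> (\<Sum>n. q ^ n) * (\<Sum>n. (cmod (a n))\<^sup>2 / q ^ n)"
      using q b by (intro mult_mono sum_le_suminf summable_geometric sum_nonneg suminf_nonneg) auto
    also have "\<dots> = ?R" using q by (simp add: suminf_geometric)
    finally show ?thesis .
  qed
  moreover have "(\<lambda>M. (cmod (\<Sum>n<M. a n))\<^sup>2) \<longlonglongrightarrow> (cmod (\<Sum>n. a n))\<^sup>2"
    using summable_LIMSEQ[OF a] by (intro tendsto_intros)
  ultimately show ?thesis by (intro LIMSEQ_le_const2) auto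
qed

text \<open>Completeness of the Bergman space, in the form in which it is used: the sum converges locally
  uniformly because point evaluations are bounded, and the weighted Cauchy-Schwarz inequality lets
  the squared norm of the sum be integrated termwise.\<close>

lemma bergman_geometric_series:
  assumes \<alpha>: "\<alpha> > -1" and F: "\<And>n. F n \<in> bergman_space \<alpha>"
    and q: "0 < q" "q < 1" and le: "\<And>n. bergman_norm \<alpha> (F n) \<le> C * q ^ n"
  shows "\<And>z. summable (\<lambda>n. F n z)"
    and "(\<lambda>z. \<Sum>n. F n z) \<in> bergman_space \<alpha>"
    and "bergman_norm \<alpha> (\<lambda>z. \<Sum>n. F n z) \<le> C / (1 - q)"
proof -
  let ?S = "\<lambda>z. \<Sum>n. F n z"
  obtain K where K: "K > 0"
    "\<And>f z. f \<in> bergman_space \<alpha> \<Longrightarrow> z \<in> unit_disk \<Longrightarrow> eval_weight \<alpha> z * cmod (f z) \<le> K * bergman_norm \<alpha> f"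
    using point_evaluation_bounded[OF \<alpha>] by blast
  have C0: "C \<ge> 0" using le[of 0] bergman_norm_nonneg[OF \<alpha>, of "F 0"] by simp
  have sg: "summable (\<lambda>n. c * q ^ n)" for c using q by (intro summable_mult summable_geometric) simp
  have pt: "cmod (F n z) \<le> K * C / eval_weight \<alpha> z * q ^ n" if z: "z \<in> unit_disk" for n z
  proof -
    have "eval_weight \<alpha> z * cmod (F n z) \<le> K * (C * q ^ n)"
      using K(2)[OF F z, of n] mult_left_mono[OF le[of n], of K] K(1) by linarith
    then show ?thesis using eval_weight_pos[OF z, of \<alpha>] by (simp add: field_simps)
  qed
  have summ': "summable (\<lambda>n. F n z)" if "z \<in> unit_disk" for z
    by (rule summable_comparison_test[OF _ sg]) (use pt[OF that] in blast)
  then show summ: "summable (\<lambda>n. F n z)" for z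
    using bergman_spaceD(2)[OF F] by (cases "z \<in> unit_disk") auto
  have hol: "?S holomorphic_on unit_disk"
  proof (rule holomorphic_uniform_sequence[where f = "\<lambda>n z. \<Sum>i<n. F i z"])
    show "open unit_disk" by simp
    show "(\<lambda>z. \<Sum>i<n. F i z) holomorphic_on unit_disk" for n
      using bergman_spaceD(1)[OF F] by (intro holomorphic_intros)
    fix x :: complex assume x: "x \<in> unit_disk"
    then obtain d where d: "d > 0" "cball x d \<subseteq> unit_disk"
      using open_contains_cball open_ball by blast
    have "continuous_on (cball x d) (\<lambda>z. 1 / eval_weight \<alpha> z)"
    proof -
      have "continuous_on unit_disk (\<lambda>z. 1 / eval_weight \<alpha> z)"
      proof (intro continuous_intros)
        show "continuous_on unit_disk (eval_weight \<alpha>)"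
          unfolding eval_weight_def using one_minus_norm_pos
          by (intro continuous_intros) (metis less_irrefl)
        show "\<forall>z\<in>unit_disk. eval_weight \<alpha> z \<noteq> 0" using eval_weight_pos less_irrefl by metis
      qed
      then show ?thesis using d(2) continuous_on_subset by blast
    qed
    then have "bdd_above ((\<lambda>z. 1 / eval_weight \<alpha> z) ` cball x d)"
      by (intro bounded_imp_bdd_above compact_imp_bounded compact_continuous_image) auto
    then obtain b where b: "\<And>z. z \<in> cball x d \<Longrightarrow> 1 / eval_weight \<alpha> z \<le> b"
      unfolding bdd_above_def by (meson imageI)
    have "uniform_limit (cball x d) (\<lambda>n z. \<Sum>i<n. F i z) ?S sequentially"
    proof (rule Weierstrass_m_test[where M = "\<lambda>n. K * C * b * q ^ n"])
      fix n z assume z: "z \<in> cball x d"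
      have "cmod (F n z) \<le> K * C * (1 / eval_weight \<alpha> z) * q ^ n" using pt[of z n] z d(2) by auto
      also have "\<dots> \<le> K * C * b * q ^ n"
        using b[OF z] K(1) C0 q by (intro mult_right_mono mult_left_mono) auto
      finally show "cmod (F n z) \<le> K * C * b * q ^ n" .
    qed (rule sg)
    then show "\<exists>d>0. cball x d \<subseteq> unit_disk \<and> uniform_limit (cball x d) (\<lambda>n z. \<Sum>i<n. F i z) ?S sequentially"
      using d by blast
  qed
  have S0: "?S z = 0" if "z \<notin> unit_disk" for z
    using bergman_spaceD(2)[OF F that] by simp
  let ?d = "\<lambda>n z. bergman_density \<alpha> (F n) z / q ^ n"
  have id: "set_integrable lborel unit_disk (?d n)" for n
    using bergman_spaceD(3)[OF F] by simp
  have Id: "(LINT z:unit_disk|lborel. ?d n z) = (bergman_norm \<alpha> (F n))\<^sup>2 / q ^ n" for n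
    by (simp add: bergman_norm_square[OF \<alpha>])
  have Idle: "(bergman_norm \<alpha> (F n))\<^sup>2 / q ^ n \<le> C\<^sup>2 * q ^ n" for n
  proof -
    have "(bergman_norm \<alpha> (F n))\<^sup>2 \<le> (C * q ^ n)\<^sup>2"
      using le[of n] bergman_norm_nonneg[OF \<alpha>] by (intro power_mono) auto
    then have "(bergman_norm \<alpha> (F n))\<^sup>2 / q ^ n \<le> (C * q ^ n)\<^sup>2 / q ^ n"
      using q by (intro divide_right_mono) auto
    also have "\<dots> = C\<^sup>2 * q ^ n" using q by (simp add: power_mult_distrib power2_eq_square)
    finally show ?thesis .
  qed
  have sums_sq: "summable (\<lambda>n. (cmod (F n z))\<^sup>2 / q ^ n)" for z
  proof (cases "z \<in> unit_disk")
    case True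
    let ?c = "K * C / eval_weight \<alpha> z"
    have "(cmod (F n z))\<^sup>2 / q ^ n \<le> ?c\<^sup>2 * q ^ n" for n
    proof -
      have "(cmod (F n z))\<^sup>2 \<le> (?c * q ^ n)\<^sup>2" using pt[OF True] by (intro power_mono) auto
      then have "(cmod (F n z))\<^sup>2 / q ^ n \<le> (?c * q ^ n)\<^sup>2 / q ^ n"
        using q by (intro divide_right_mono) auto
      also have "\<dots> = ?c\<^sup>2 * q ^ n" using q by (simp only: power_mult_distrib power2_eq_square) simp
      finally show ?thesis .
    qed
    then show ?thesis
      using q by (intro summable_comparison_test[OF _ sg[of "?c\<^sup>2"]] exI[of _ 0]) auto
  next
    case False
    then show ?thesis using bergman_spaceD(2)[OF F] by simp
  qed
  let ?w = "\<lambda>z. (1 + \<alpha>) / pi * (1 - (cmod z)\<^sup>2) powr \<alpha>"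
  have dw: "?d n z = ?w z * ((cmod (F n z))\<^sup>2 / q ^ n)" for n z
    by (simp add: bergman_density_def)
  have sumd: "summable (\<lambda>n. ?d n z)" for z
    unfolding dw by (intro summable_mult sums_sq)
  let ?f = "\<lambda>n z. indicator unit_disk z *\<^sub>R ?d n z"
  have f1: "integrable lborel (?f n)" for n using id by (simp add: set_integrable_def)
  have f2: "AE z in lborel. summable (\<lambda>n. norm (?f n z))"
  proof (rule AE_I2)
    fix z
    show "summable (\<lambda>n. norm (?f n z))"
      using sumd[of z] bergman_density_nonneg[OF \<alpha>] q by (cases "z \<in> unit_disk") (simp_all add: abs_of_nonneg)
  qed
  have fn: "norm (?f n z) = ?f n z" for n z
    using bergman_density_nonneg[OF \<alpha>] q by simp
  have f3: "summable (\<lambda>n. LINT z|lborel. norm (?f n z))"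
  proof (rule summable_comparison_test[OF _ sg[of "C\<^sup>2"]])
    have "norm (LINT z|lborel. norm (?f n z)) \<le> C\<^sup>2 * q ^ n" for n
      unfolding fn using Id[of n] Idle[of n] q unfolding set_lebesgue_integral_def by simp
    then show "\<exists>N. \<forall>n\<ge>N. norm (LINT z|lborel. norm (?f n z)) \<le> C\<^sup>2 * q ^ n" by blast
  qed
  have g1: "integrable lborel (\<lambda>z. \<Sum>n. ?f n z)"
    and g2: "(LINT z|lborel. (\<Sum>n. ?f n z)) = (\<Sum>n. LINT z|lborel. ?f n z)"
    using integrable_suminf[OF f1 f2 f3] integral_suminf[OF f1 f2 f3] by auto
  have pull: "(\<Sum>n. ?f n z) = indicator unit_disk z *\<^sub>R (\<Sum>n. ?d n z)" for z
    by (cases "z \<in> unit_disk") auto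
  let ?h = "\<lambda>z. (1 / (1 - q)) * (\<Sum>n. ?d n z)"
  have ih: "set_integrable lborel unit_disk ?h"
    using g1 unfolding pull set_integrable_def[symmetric] by (rule set_integrable_mult_right)
  have bd: "bergman_density \<alpha> ?S z \<le> ?h z" for z
  proof -
    have w0: "?w z \<ge> 0" using \<alpha> by simp
    have "bergman_density \<alpha> ?S z = ?w z * (cmod (?S z))\<^sup>2" by (simp add: bergman_density_def)
    also have "\<dots> \<le> ?w z * ((1 / (1 - q)) * (\<Sum>n. (cmod (F n z))\<^sup>2 / q ^ n))"
      by (intro mult_left_mono suminf_square_le_weighted q summ sums_sq w0)
    also have "\<dots> = (1 / (1 - q)) * (?w z * (\<Sum>n. (cmod (F n z))\<^sup>2 / q ^ n))" by (simp only: mult_ac)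
    also have "?w z * (\<Sum>n. (cmod (F n z))\<^sup>2 / q ^ n) = (\<Sum>n. ?d n z)"
      unfolding dw by (rule suminf_mult[symmetric, OF sums_sq])
    finally show ?thesis .
  qed
  note dom = bergman_space_dominated[OF \<alpha> hol S0 ih bd]
  show "?S \<in> bergman_space \<alpha>" by (rule dom(1))
  have Ids: "summable (\<lambda>n. (bergman_norm \<alpha> (F n))\<^sup>2 / q ^ n)"
    using Idle q by (intro summable_comparison_test[OF _ sg[of "C\<^sup>2"]] exI[of _ 0]) auto
  have "(bergman_norm \<alpha> ?S)\<^sup>2 \<le> (LINT z:unit_disk|lborel. ?h z)" by (rule dom(2))
  also have "\<dots> = (1 / (1 - q)) * (\<Sum>n. (bergman_norm \<alpha> (F n))\<^sup>2 / q ^ n)"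
    using g2 unfolding pull set_lebesgue_integral_def[symmetric] Id by simp
  also have "\<dots> \<le> (1 / (1 - q)) * (\<Sum>n. C\<^sup>2 * q ^ n)"
    using q by (intro mult_left_mono suminf_le Idle Ids sg) auto
  also have "\<dots> = (C / (1 - q))\<^sup>2"
    using q by (simp add: suminf_mult summable_geometric suminf_geometric power2_eq_square)
  finally show "bergman_norm \<alpha> ?S \<le> C / (1 - q)"
    by (rule power2_le_imp_le) (use C0 q in auto)
qed

locale bergman =
  fixes \<alpha> :: real
  assumes \<alpha>: "\<alpha> > -1"
begin

abbreviation "H \<equiv> bergman_space \<alpha>"
abbreviation "N \<equiv> bergman_norm \<alpha>"
abbreviation "bounded_op \<equiv> bounded_operator_on H N"
abbreviation "invertible_op \<equiv> invertible_operator_on H N"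

lemma bounded_opD:
  assumes "bounded_op T"
  shows "\<And>f. f \<in> H \<Longrightarrow> T f \<in> H"
    and "\<And>f g. f \<in> H \<Longrightarrow> g \<in> H \<Longrightarrow> T (\<lambda>z. f z + g z) = (\<lambda>z. T f z + T g z)"
    and "\<And>c f. f \<in> H \<Longrightarrow> T (\<lambda>z. c * f z) = (\<lambda>z. c * T f z)"
  using assms unfolding bounded_operator_on_def by blast+

lemma bounded_opI:
  assumes "\<And>f. f \<in> H \<Longrightarrow> T f \<in> H"
    and "\<And>f g. f \<in> H \<Longrightarrow> g \<in> H \<Longrightarrow> T (\<lambda>z. f z + g z) = (\<lambda>z. T f z + T g z)"
    and "\<And>c f. f \<in> H \<Longrightarrow> T (\<lambda>z. c * f z) = (\<lambda>z. c * T f z)"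
    and "\<And>f. f \<in> H \<Longrightarrow> N (T f) \<le> K * N f"
  shows "bounded_op T"
  using assms unfolding bounded_operator_on_def by blast

lemma bounded_op_bound:
  assumes "bounded_op T"
  obtains K where "K > 0" "\<And>f. f \<in> H \<Longrightarrow> N (T f) \<le> K * N f"
proof -
  obtain K where K: "\<And>f. f \<in> H \<Longrightarrow> N (T f) \<le> K * N f"
    using assms unfolding bounded_operator_on_def by blast
  have "N (T f) \<le> (\<bar>K\<bar> + 1) * N f" if "f \<in> H" for f
    using K[OF that] mult_right_mono[of K "\<bar>K\<bar> + 1" "N f"] bergman_norm_nonneg[OF \<alpha>, of f] by linarith
  then show ?thesis using that[of "\<bar>K\<bar> + 1"] by simp
qed

lemma diff_in_space:
  assumes "f \<in> H" "g \<in> H" shows "(\<lambda>z. f z - c * g z) \<in> H"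
    and "N (\<lambda>z. f z - c * g z) \<le> 2 * (N f + cmod c * N g)"
proof -
  have e: "(\<lambda>z. f z - c * g z) = (\<lambda>z. f z + (- c) * g z)" by (simp add: fun_eq_iff)
  have s: "(\<lambda>z. (- c) * g z) \<in> H" "N (\<lambda>z. (- c) * g z) \<le> cmod c * N g"
    using bergman_space_scale[OF \<alpha> assms(2), of "-c"] by auto
  show "(\<lambda>z. f z - c * g z) \<in> H"
    unfolding e by (rule bergman_space_add(1)[OF \<alpha> assms(1) s(1)])
  show "N (\<lambda>z. f z - c * g z) \<le> 2 * (N f + cmod c * N g)"
    unfolding e by (rule order_trans[OF bergman_space_add(2)[OF \<alpha> assms(1) s(1)]]) (use s(2) in simp)
qed

lemma bounded_op_diff:
  assumes T: "bounded_op T" "f \<in> H" "g \<in> H"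
  shows "T (\<lambda>z. f z - c * g z) = (\<lambda>z. T f z - c * T g z)"
proof -
  have e: "(\<lambda>z. f z - c * g z) = (\<lambda>z. f z + (- c) * g z)" by (simp add: fun_eq_iff)
  have s: "(\<lambda>z. (- c) * g z) \<in> H" using bergman_space_scale[OF \<alpha> assms(3), of "-c"] by auto
  show ?thesis unfolding e bounded_opD(2)[OF T(1,2) s] bounded_opD(3)[OF T(1,3)] by simp
qed

lemma bounded_op_shift:
  assumes A: "bounded_op A" and B: "bounded_op B"
  shows "bounded_op (\<lambda>f z. A f z - c * B f z)"
proof -
  obtain K L where K: "\<And>f. f \<in> H \<Longrightarrow> N (A f) \<le> K * N f" and L: "\<And>f. f \<in> H \<Longrightarrow> N (B f) \<le> L * N f"
    using bounded_op_bound[OF A] bounded_op_bound[OF B] by metis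
  have le: "N (\<lambda>z. A f z - c * B f z) \<le> (2 * (K + cmod c * L)) * N f" if f: "f \<in> H" for f
  proof -
    have "N (\<lambda>z. A f z - c * B f z) \<le> 2 * (N (A f) + cmod c * N (B f))"
      using diff_in_space(2)[OF bounded_opD(1)[OF A f] bounded_opD(1)[OF B f]] .
    also have "\<dots> \<le> 2 * (K * N f + cmod c * (L * N f))"
      using K[OF f] L[OF f] by (intro mult_left_mono add_mono) auto
    finally show ?thesis by (simp add: algebra_simps)
  qed
  show ?thesis
    by (rule bounded_opI[OF _ _ _ le])
      (simp_all add: diff_in_space(1) bounded_opD[OF A] bounded_opD[OF B] algebra_simps fun_eq_iff)
qed

lemma bounded_op_id: "bounded_op (\<lambda>f z. f z)"
  unfolding bounded_operator_on_def by (auto intro!: exI[of _ 1])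

lemma bounded_op_scale:
  assumes A: "bounded_op A"
  shows "bounded_op (\<lambda>f z. c * A f z)"
proof -
  obtain K where K: "\<And>f. f \<in> H \<Longrightarrow> N (A f) \<le> K * N f"
    using bounded_op_bound[OF A] by metis
  have le: "N (\<lambda>z. c * A f z) \<le> (cmod c * K) * N f" if f: "f \<in> H" for f
    using bergman_space_scale(2)[OF \<alpha> bounded_opD(1)[OF A f], of c] mult_left_mono[OF K[OF f], of "cmod c"]
    by (simp add: mult.assoc)
  show ?thesis
    by (rule bounded_opI[OF _ _ _ le])
      (simp_all add: bergman_space_scale(1)[OF \<alpha>] bounded_opD[OF A] algebra_simps fun_eq_iff)
qed

lemma bounded_op_compose:
  assumes A: "bounded_op A" and B: "bounded_op B"
  shows "bounded_op (\<lambda>f. A (B f))"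
proof -
  obtain K L where K: "K > 0" "\<And>f. f \<in> H \<Longrightarrow> N (A f) \<le> K * N f" and L: "\<And>f. f \<in> H \<Longrightarrow> N (B f) \<le> L * N f"
    using bounded_op_bound[OF A] bounded_op_bound[OF B] by metis
  have "N (A (B f)) \<le> (K * L) * N f" if f: "f \<in> H" for f
    unfolding mult.assoc using K(1)
    by (intro order_trans[OF K(2)[OF bounded_opD(1)[OF B f]]] mult_left_mono L f) auto
  then show ?thesis
    by (intro bounded_opI) (simp_all add: bounded_opD[OF A] bounded_opD[OF B])
qed

lemma invertible_op_scale:
  assumes A: "invertible_op A" and c: "c \<noteq> 0"
  shows "invertible_op (\<lambda>f z. c * A f z)"
proof -
  obtain S where S: "bounded_op S" "\<And>f. f \<in> H \<Longrightarrow> S (A f) = f \<and> A (S f) = f" and A': "bounded_op A"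
    using A unfolding invertible_operator_on_def by blast
  have "(\<lambda>z. inverse c * S (\<lambda>z. c * A f z) z) = f" if "f \<in> H" for f
    using bounded_opD(3)[OF S(1) bounded_opD(1)[OF A' that]] S(2)[OF that] c by (simp add: fun_eq_iff)
  moreover have "(\<lambda>z. c * A (\<lambda>z. inverse c * S f z) z) = f" if "f \<in> H" for f
    using bounded_opD(3)[OF A' bounded_opD(1)[OF S(1) that]] S(2)[OF that] c by (simp add: fun_eq_iff mult.assoc[symmetric])
  ultimately show ?thesis
    unfolding invertible_operator_on_def
    using bounded_op_scale[OF A'] bounded_op_scale[OF S(1), of "inverse c"]
    by (intro conjI exI[of _ "\<lambda>f z. inverse c * S f z"]) auto
qed

lemma invertible_op_compose:
  assumes A: "invertible_op A" and B: "invertible_op B"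
  shows "invertible_op (\<lambda>f. A (B f))"
proof -
  obtain S where S: "bounded_op S" "\<And>f. f \<in> H \<Longrightarrow> S (A f) = f \<and> A (S f) = f" and A': "bounded_op A"
    using A unfolding invertible_operator_on_def by blast
  obtain R where R: "bounded_op R" "\<And>f. f \<in> H \<Longrightarrow> R (B f) = f \<and> B (R f) = f" and B': "bounded_op B"
    using B unfolding invertible_operator_on_def by blast
  show ?thesis
    unfolding invertible_operator_on_def
    using bounded_op_compose[OF A' B'] bounded_op_compose[OF R(1) S(1)] S R bounded_opD(1)[OF B'] bounded_opD(1)[OF S(1)]
    by (intro conjI exI[of _ "\<lambda>f. R (S f)"]) auto
qed

lemma invertible_op_cong:
  assumes A: "invertible_op A" and B: "bounded_op B" and eq: "\<And>f. f \<in> H \<Longrightarrow> B f = A f"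
  shows "invertible_op B"
proof -
  obtain S where S: "bounded_op S" "\<And>f. f \<in> H \<Longrightarrow> S (A f) = f \<and> A (S f) = f"
    using A unfolding invertible_operator_on_def by blast
  then show ?thesis
    unfolding invertible_operator_on_def using B eq bounded_opD(1)[OF S(1)] by (intro conjI exI[of _ S]) auto
qed

lemma bounded_op_vanishes:
  assumes D: "bounded_op D" and g: "\<And>n. g n \<in> H" and lim: "(\<lambda>n. N (g n)) \<longlonglongrightarrow> 0"
    and h: "\<And>n. h = D (g n)"
  shows "h = (\<lambda>_. 0)"
proof
  fix z
  obtain L where L: "L > 0" "\<And>f. f \<in> H \<Longrightarrow> N (D f) \<le> L * N f"
    using bounded_op_bound[OF D] by metis
  obtain K where K: "K > 0" "\<And>f z. f \<in> H \<Longrightarrow> z \<in> unit_disk \<Longrightarrow> eval_weight \<alpha> z * cmod (f z) \<le> K * N f"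
    using point_evaluation_bounded[OF \<alpha>] by blast
  have hH: "h \<in> H" using h[of 0] bounded_opD(1)[OF D g] by simp
  show "h z = 0"
  proof (cases "z \<in> unit_disk")
    case True
    have "eval_weight \<alpha> z * cmod (h z) \<le> K * (L * N (g n))" for n
    proof -
      have "eval_weight \<alpha> z * cmod (h z) \<le> K * N h" by (rule K(2)[OF hH True])
      also have "\<dots> \<le> K * (L * N (g n))"
        using h[of n] L(2)[OF g, of n] K(1) by (intro mult_left_mono) auto
      finally show ?thesis .
    qed
    moreover have "(\<lambda>n. K * (L * N (g n))) \<longlonglongrightarrow> K * (L * 0)" by (intro tendsto_intros lim)
    ultimately have "eval_weight \<alpha> z * cmod (h z) \<le> K * (L * 0)" by (intro LIMSEQ_le_const) auto
    then show ?thesis using eval_weight_pos[OF True, of \<alpha>] by (simp add: mult_le_0_iff)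
  next
    case False
    then show ?thesis by (rule bergman_spaceD(2)[OF hH])
  qed
qed

text \<open>The Neumann series. That \<open>R\<close> commutes with its sum \<open>S\<close> follows because the commutator takes the
  same value at \<open>f\<close> and at every iterate of \<open>f\<close>, and these iterates tend to zero.\<close>

lemma neumann_invertible:
  assumes R: "bounded_op R" and q: "0 < q" "q < 1"
    and le: "\<And>n f. f \<in> H \<Longrightarrow> N ((R ^^ n) f) \<le> C * q ^ n * N f"
  shows "invertible_op (\<lambda>f z. f z - R f z)"
proof -
  define S where "S = (\<lambda>f z. \<Sum>n. (R ^^ n) f z)"
  have RH: "(R ^^ n) f \<in> H" if "f \<in> H" for f n
    using that by (induction n) (auto intro: bounded_opD(1)[OF R])
  have Radd: "(R ^^ n) (\<lambda>z. f z + g z) = (\<lambda>z. (R ^^ n) f z + (R ^^ n) g z)" if "f \<in> H" "g \<in> H" for f g n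
    by (induction n) (simp_all add: bounded_opD(2)[OF R RH[OF that(1)] RH[OF that(2)]])
  have Rscale: "(R ^^ n) (\<lambda>z. c * f z) = (\<lambda>z. c * (R ^^ n) f z)" if "f \<in> H" for c f n
    by (induction n) (simp_all add: bounded_opD(3)[OF R RH[OF that]])
  note series = bergman_geometric_series[OF \<alpha> RH q]
  have le': "N ((R ^^ n) f) \<le> (C * N f) * q ^ n" if "f \<in> H" for n f
    using le[OF that, of n] by (simp add: mult_ac)
  have summ: "summable (\<lambda>n. (R ^^ n) f z)" if "f \<in> H" for f z
    by (rule series(1)[OF that le'[OF that]])
  have SH: "S f \<in> H" if "f \<in> H" for f
    unfolding S_def by (rule series(2)[OF that le'[OF that]])
  have SN: "N (S f) \<le> C / (1 - q) * N f" if "f \<in> H" for f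
    using series(3)[OF that le'[OF that]] unfolding S_def by simp
  have S: "bounded_op S"
    unfolding bounded_operator_on_def
  proof (intro conjI ballI allI exI[of _ "C / (1 - q)"])
    show "S (\<lambda>z. f z + g z) = (\<lambda>z. S f z + S g z)" if "f \<in> H" "g \<in> H" for f g
      unfolding S_def Radd[OF that] by (rule ext) (rule suminf_add[symmetric, OF summ summ, OF that])
    show "S (\<lambda>z. c * f z) = (\<lambda>z. c * S f z)" if "f \<in> H" for c f
      unfolding S_def Rscale[OF that] by (rule ext) (rule suminf_mult[OF summ, OF that])
  qed (use SH SN in auto)
  have head: "S f = (\<lambda>z. f z + S (R f) z)" if "f \<in> H" for f
  proof
    fix z
    have "(\<Sum>n. (R ^^ Suc n) f z) = (\<Sum>n. (R ^^ n) f z) - (R ^^ 0) f z"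
      by (rule suminf_split_head[OF summ[OF that]])
    moreover have "(R ^^ Suc n) f = (R ^^ n) (R f)" for n by (simp add: funpow_swap1)
    ultimately show "S f z = f z + S (R f) z" by (simp add: S_def)
  qed
  have comm: "R (S f) = S (R f)" if f: "f \<in> H" for f
  proof -
    define D where "D = (\<lambda>f z. R (S f) z - 1 * S (R f) z)"
    have step: "D f = D (R f)" if f: "f \<in> H" for f
    proof -
      note RfH = bounded_opD(1)[OF R f]
      have "R (S f) = (\<lambda>z. R f z + R (S (R f)) z)"
        using bounded_opD(2)[OF R f SH[OF RfH]] unfolding head[OF f, symmetric] .
      then have a: "R (S f) z = R f z + R (S (R f)) z" for z by (rule fun_cong)
      have b: "S (R f) z = R f z + S (R (R f)) z" for z by (rule fun_cong[OF head[OF RfH]])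
      show ?thesis unfolding D_def by (rule ext) (subst a, subst b, simp)
    qed
    have steps: "D f = D ((R ^^ n) f)" for n
      by (induction n) (use step[OF RH[OF f]] in simp_all)
    have D: "bounded_op D"
      unfolding D_def by (rule bounded_op_shift[OF bounded_op_compose[OF R S] bounded_op_compose[OF S R]])
    have bd: "N ((R ^^ n) f) \<le> C * q ^ n * N f" for n by (rule le[OF f])
    have "(\<lambda>n. C * q ^ n * N f) \<longlonglongrightarrow> C * 0 * N f"
      using q by (intro tendsto_intros LIMSEQ_realpow_zero) auto
    then have lim0: "(\<lambda>n. C * q ^ n * N f) \<longlonglongrightarrow> 0" by simp
    have lim: "(\<lambda>n. N ((R ^^ n) f)) \<longlonglongrightarrow> 0"
      by (rule tendsto_sandwich[OF _ _ tendsto_const lim0])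
        (use bd bergman_norm_nonneg[OF \<alpha>] in auto)
    have Df: "D f = (\<lambda>_. 0)"
    proof (rule bounded_op_vanishes[OF D, where g = "\<lambda>n. (R ^^ n) f"])
      show "(R ^^ n) f \<in> H" for n by (rule RH[OF f])
      show "D f = D ((R ^^ n) f)" for n by (rule steps)
    qed (rule lim)
    show ?thesis
    proof
      fix z
      have "R (S f) z - 1 * S (R f) z = D f z" by (simp only: D_def)
      then show "R (S f) z = S (R f) z" by (simp only: Df mult_1 right_minus_eq)
    qed
  qed
  have B: "bounded_op (\<lambda>f z. f z - R f z)"
    using bounded_op_shift[OF bounded_op_id R, of 1] by simp
  have 1: "S (\<lambda>z. f z - R f z) = f" if "f \<in> H" for f
    using bounded_op_diff[OF S that bounded_opD(1)[OF R that], of 1] head[OF that] by simp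
  have 2: "(\<lambda>z. S f z - R (S f) z) = f" if "f \<in> H" for f
    using comm[OF that] head[OF that] by simp
  show ?thesis
    unfolding invertible_operator_on_def using B S 1 2 by (intro conjI exI[of _ S]) auto
qed

lemma outside_spectral_radius_invertible:
  assumes T: "bounded_op T" and q: "0 < q" "q < cmod \<mu>"
    and le: "\<And>n f. f \<in> H \<Longrightarrow> N ((T ^^ n) f) \<le> C * q ^ n * N f"
  shows "invertible_op (\<lambda>f z. T f z - \<mu> * f z)"
proof -
  have \<mu>: "\<mu> \<noteq> 0" using q by auto
  let ?R = "\<lambda>f z. inverse \<mu> * T f z"
  have TH: "(T ^^ n) f \<in> H" if "f \<in> H" for f n
    using that by (induction n) (auto intro: bounded_opD(1)[OF T])
  have pow: "(?R ^^ n) f = (\<lambda>z. inverse \<mu> ^ n * (T ^^ n) f z)" if "f \<in> H" for f n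
  proof (induction n)
    case (Suc n)
    then show ?case by (simp add: bounded_opD(3)[OF T TH[OF that]] mult.assoc)
  qed simp
  have "N ((?R ^^ n) f) \<le> C * (q / cmod \<mu>) ^ n * N f" if "f \<in> H" for f n
  proof -
    have "N ((?R ^^ n) f) \<le> cmod (inverse \<mu> ^ n) * N ((T ^^ n) f)"
      unfolding pow[OF that] by (rule bergman_space_scale(2)[OF \<alpha> TH[OF that]])
    also have "\<dots> \<le> cmod (inverse \<mu> ^ n) * (C * q ^ n * N f)"
      by (intro mult_left_mono le that) auto
    also have "\<dots> = C * (q / cmod \<mu>) ^ n * N f"
      by (simp only: norm_power norm_inverse divide_inverse power_mult_distrib mult_ac)
    finally show ?thesis .
  qed
  then have "invertible_op (\<lambda>f z. f z - ?R f z)"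
    using q \<mu> by (intro neumann_invertible[where q = "q / cmod \<mu>" and C = C] bounded_op_scale T) auto
  from invertible_op_scale[OF this, of "- \<mu>"] have inv: "invertible_op (\<lambda>f z. - \<mu> * (f z - ?R f z))"
    using \<mu> by simp
  show ?thesis
  proof (rule invertible_op_cong[OF inv])
    show "bounded_op (\<lambda>f z. T f z - \<mu> * f z)"
      by (intro bounded_op_shift T bounded_op_id)
    show "(\<lambda>z. T f z - \<mu> * f z) = (\<lambda>z. - \<mu> * (f z - ?R f z))" for f
      using \<mu> by (simp add: fun_eq_iff algebra_simps)
  qed
qed

text \<open>The resolvent set is open, by the factorisation
  \<open>T - \<mu>' = (T - \<mu>) (I - (\<mu>' - \<mu>) S)\<close> with \<open>S\<close> the inverse of \<open>T - \<mu>\<close>.\<close>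

lemma resolvent_open:
  assumes T: "bounded_op T" and inv: "invertible_op (\<lambda>f z. T f z - \<mu> * f z)"
  obtains r where "r > 0" "\<And>\<mu>'. cmod (\<mu>' - \<mu>) < r \<Longrightarrow> invertible_op (\<lambda>f z. T f z - \<mu>' * f z)"
proof -
  define A where "A = (\<lambda>f z. T f z - \<mu> * f z)"
  have invA: "invertible_op A" using inv by (simp add: A_def)
  obtain S where T': "bounded_op A" and S: "bounded_op S" "\<And>f. f \<in> H \<Longrightarrow> S (A f) = f" "\<And>f. f \<in> H \<Longrightarrow> A (S f) = f"
    using invA unfolding invertible_operator_on_def by metis
  obtain K where K: "K > 0" "\<And>f. f \<in> H \<Longrightarrow> N (S f) \<le> K * N f"
    using bounded_op_bound[OF S(1)] by metis
  have "invertible_op (\<lambda>f z. T f z - \<mu>' * f z)" if \<mu>': "cmod (\<mu>' - \<mu>) < 1 / (2 * K)" for \<mu>'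
  proof -
    let ?R = "\<lambda>f z. (\<mu>' - \<mu>) * S f z"
    have R: "bounded_op ?R" by (intro bounded_op_scale S)
    have le: "N (?R f) \<le> 1/2 * N f" if f: "f \<in> H" for f
    proof -
      have "N (?R f) \<le> cmod (\<mu>' - \<mu>) * N (S f)"
        by (rule bergman_space_scale(2)[OF \<alpha> bounded_opD(1)[OF S(1) f]])
      also have "\<dots> \<le> 1 / (2 * K) * (K * N f)"
        using \<mu>' K bergman_norm_nonneg[OF \<alpha>] f by (intro mult_mono) auto
      finally show ?thesis using K(1) by simp
    qed
    have RH: "(?R ^^ n) f \<in> H" if "f \<in> H" for f n
      using that by (induction n) (auto intro: bounded_opD(1)[OF R])
    have "N ((?R ^^ n) f) \<le> 1 * (1/2) ^ n * N f" if f: "f \<in> H" for f n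
    proof (induction n)
      case (Suc n)
      have "N ((?R ^^ Suc n) f) \<le> 1/2 * N ((?R ^^ n) f)" using le[OF RH[OF f, of n]] by simp
      also have "\<dots> \<le> 1/2 * (1 * (1/2) ^ n * N f)" by (rule mult_left_mono[OF Suc]) simp
      finally show ?case by simp
    qed simp
    then have "invertible_op (\<lambda>f z. f z - ?R f z)"
      by (intro neumann_invertible[OF R, where q = "1/2" and C = 1]) auto
    from invertible_op_compose[OF invA this]
    have inv': "invertible_op (\<lambda>f. A (\<lambda>z. f z - ?R f z))" .
    show ?thesis
    proof (rule invertible_op_cong[OF inv'])
      show "bounded_op (\<lambda>f z. T f z - \<mu>' * f z)"
        by (intro bounded_op_shift T bounded_op_id)
      fix f assume f: "f \<in> H"
      have "A (\<lambda>z. f z - ?R f z) = (\<lambda>z. A f z - (\<mu>' - \<mu>) * A (S f) z)"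
        by (rule bounded_op_diff[OF T' f bounded_opD(1)[OF S(1) f]])
      then show "(\<lambda>z. T f z - \<mu>' * f z) = A (\<lambda>z. f z - ?R f z)"
        using S(3)[OF f] by (simp add: A_def fun_eq_iff algebra_simps)
    qed
  qed
  then show ?thesis using that[of "1 / (2 * K)"] K(1) by simp
qed

end

section \<open>Orbits in the half-plane\<close>

lemma sums_norm_le_geometric:
  fixes a :: "nat \<Rightarrow> complex"
  assumes a: "a sums S" and q: "0 \<le> q" "q < 1" and le: "\<And>n. cmod (a n) \<le> c * q ^ n"
  shows "cmod S \<le> c / (1 - q)"
proof -
  have sm: "summable (\<lambda>n. c * q ^ n)" using q by (intro summable_mult summable_geometric) simp
  have "cmod (suminf a) \<le> (\<Sum>n. c * q ^ n)" by (rule norm_suminf_le[OF le sm])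
  also have "\<dots> = c / (1 - q)" using q by (simp add: suminf_mult summable_geometric suminf_geometric)
  finally show ?thesis using a by (simp add: sums_iff)
qed

lemma prod_le_few_exceptions:
  fixes t :: "nat \<Rightarrow> real"
  assumes t: "\<And>j. 0 \<le> t j" "\<And>j. t j \<le> M" and q: "0 < q"
    and E: "finite E" "card E \<le> k" and small: "\<And>j. j \<notin> E \<Longrightarrow> t j \<le> q"
  shows "(\<Prod>j<n. t j) \<le> (max 1 (M / q)) ^ k * q ^ n"
proof -
  let ?d = "max 1 (M / q)"
  have "(\<Prod>j<n. t j) \<le> (\<Prod>j<n. q * (if j \<in> E then ?d else 1))"
  proof (rule prod_mono)
    fix j
    have "M \<le> q * ?d" using q by (simp add: max_def field_simps)
    then show "0 \<le> t j \<and> t j \<le> q * (if j \<in> E then ?d else 1)"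
      using t[of j] small[of j] by auto
  qed
  also have "\<dots> = q ^ n * ?d ^ card ({..<n} \<inter> E)"
    by (simp add: prod.distrib prod.If_cases)
  also have "?d ^ card ({..<n} \<inter> E) \<le> ?d ^ k"
    using E card_mono[OF E(1), of "{..<n} \<inter> E"] by (intro power_increasing) auto
  finally show ?thesis using q by (simp add: mult.commute)
qed

text \<open>In \<open>k\<close> steps the progression shrinks by at least the ratio of the ends of the window. So the times
  that it spends there lie in an interval of length \<open>k\<close>, wherever it starts.\<close>

lemma geometric_window:
  fixes s R x :: real
  assumes s: "0 < s" "s < 1" and R: "0 < R" and k: "s ^ k \<le> 1 / R\<^sup>2" and x: "0 < x"
  shows "finite {j::nat. 1 / R < x * s ^ j \<and> x * s ^ j < R}"
    and "card {j::nat. 1 / R < x * s ^ j \<and> x * s ^ j < R} \<le> k"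
proof -
  let ?P = "\<lambda>j::nat. 1 / R < x * s ^ j \<and> x * s ^ j < R"
  have kR: "s ^ k * R \<le> 1 / R" using mult_right_mono[OF k, of R] R by (simp add: power2_eq_square)
  have far: False if i: "?P i" and j: "?P j" and ij: "i + k \<le> j" for i j
  proof -
    have "s ^ j \<le> s ^ i * s ^ k" using power_decreasing[OF ij, of s] s by (simp add: power_add)
    then have "x * s ^ j \<le> (x * s ^ i) * s ^ k" using x by (simp add: mult.assoc)
    also have "\<dots> \<le> R * s ^ k" using i s by (intro mult_right_mono) auto
    also have "\<dots> \<le> 1 / R" using kR by (simp add: mult.commute)
    finally show False using j by simp
  qed
  have "\<exists>j0. {j. ?P j} \<subseteq> {j0..<j0 + k}"
  proof (cases "\<exists>j. ?P j")
    case True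
    define j0 where "j0 = (LEAST j. ?P j)"
    have j0: "?P j0" unfolding j0_def using True by (rule LeastI_ex)
    have "{j. ?P j} \<subseteq> {j0..<j0 + k}"
    proof
      fix j assume "j \<in> {j. ?P j}"
      then have j: "?P j" by (rule CollectD)
      have "j0 \<le> j" unfolding j0_def using j by (rule Least_le)
      moreover have "j < j0 + k" by (rule ccontr) (use far[OF j0 j] in linarith)
      ultimately show "j \<in> {j0..<j0 + k}" by simp
    qed
    then show ?thesis ..
  qed auto
  then obtain j0 where sub: "{j. ?P j} \<subseteq> {j0..<j0 + k}" by blast
  show "finite {j. ?P j}" "card {j. ?P j} \<le> k"
    using finite_subset[OF sub] card_mono[OF _ sub] by auto
qed

text \<open>Products along an orbit: outside a window for the modulus of the half-plane coordinate each factor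
  is at most \<open>q\<close>, and the boundedly many factors inside contribute at most a constant.\<close>

lemma geometric_window_products:
  fixes s R M q :: real
  assumes s: "0 < s" "s < 1" and R: "0 < R" and q: "0 < q"
  obtains C where "C > 0"
    "\<And>x t n. \<lbrakk>0 < x; \<And>j::nat. 0 \<le> t j \<and> t j \<le> M; \<And>j. x / s ^ j \<ge> R \<or> x / s ^ j \<le> 1 / R \<Longrightarrow> t j \<le> q\<rbrakk>
       \<Longrightarrow> (\<Prod>j<n. t j) \<le> C * q ^ n"
    "\<And>x t n. \<lbrakk>0 < x; \<And>j::nat. 0 \<le> t j \<and> t j \<le> M; \<And>j. x * s ^ j \<ge> R \<or> x * s ^ j \<le> 1 / R \<Longrightarrow> t j \<le> q\<rbrakk>
       \<Longrightarrow> (\<Prod>j<n. t j) \<le> C * q ^ n"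
proof -
  obtain k where "s ^ k < 1 / R\<^sup>2" using real_arch_pow_inv[of "1 / R\<^sup>2" s] s R by auto
  then have k: "s ^ k \<le> 1 / R\<^sup>2" by simp
  let ?C = "(max 1 (M / q)) ^ k"
  have 2: "(\<Prod>j<n. t j) \<le> ?C * q ^ n"
    if x: "0 < x" and t: "\<And>j::nat. 0 \<le> t j \<and> t j \<le> M" and le: "\<And>j. x * s ^ j \<ge> R \<or> x * s ^ j \<le> 1 / R \<Longrightarrow> t j \<le> q" for x t n
    by (rule prod_le_few_exceptions[OF _ _ q geometric_window[OF s R k x]]) (use t le in \<open>auto simp: not_less\<close>)
  \<comment> \<open>The window is invariant under inversion, which exchanges growth and decay.\<close>
  have 1: "(\<Prod>j<n. t j) \<le> ?C * q ^ n"
    if x: "0 < x" and t: "\<And>j::nat. 0 \<le> t j \<and> t j \<le> M" and le: "\<And>j. x / s ^ j \<ge> R \<or> x / s ^ j \<le> 1 / R \<Longrightarrow> t j \<le> q" for x t n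
  proof (rule 2[of "1 / x"])
    fix j
    have p: "s ^ j > 0" using s by simp
    assume "1 / x * s ^ j \<ge> R \<or> 1 / x * s ^ j \<le> 1 / R"
    then have "x / s ^ j \<ge> R \<or> x / s ^ j \<le> 1 / R" using x p R by (auto simp: field_simps)
    then show "t j \<le> q" by (rule le)
  qed (use x t in auto)
  show ?thesis by (rule that[of ?C, OF _ 1 2]) auto
qed

text \<open>The function \<open>w\<close> carries the disk to the right half-plane and \<open>\<phi>\<close> to the dilation by \<open>1 / s\<close>, so
  that the attracting fixed point is at infinity and the repelling one at the origin.\<close>

locale hyperbolic_dynamics = bergman +
  fixes \<phi> w :: "complex \<Rightarrow> complex" and s :: real
  assumes \<phi>: "disk_bijection \<phi>"
    and w_holomorphic: "w holomorphic_on unit_disk"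
    and w_Re: "\<And>z. z \<in> unit_disk \<Longrightarrow> Re (w z) > 0"
    and s: "0 < s" "s < 1"
    and w_\<phi>: "\<And>z. z \<in> unit_disk \<Longrightarrow> w (\<phi> z) = w z / of_real s"
    and w_onto: "\<And>r. r > 0 \<Longrightarrow> \<exists>z\<in>unit_disk. w z = of_real r"
begin

abbreviation weight :: "complex \<Rightarrow> real" where "weight \<equiv> eval_weight \<alpha>"

definition \<phi>inv :: "complex \<Rightarrow> complex" where "\<phi>inv = inv_into unit_disk \<phi>"

lemma \<phi>_in: "z \<in> unit_disk \<Longrightarrow> \<phi> z \<in> unit_disk"
  using disk_bijectionD(4)[OF \<phi>] .

lemma \<phi>_\<phi>inv: "z \<in> unit_disk \<Longrightarrow> \<phi> (\<phi>inv z) = z"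
  unfolding \<phi>inv_def using disk_bijectionD(3)[OF \<phi>] by (intro f_inv_into_f) simp

lemma \<phi>inv_in: "z \<in> unit_disk \<Longrightarrow> \<phi>inv z \<in> unit_disk"
  unfolding \<phi>inv_def using disk_bijectionD(3)[OF \<phi>] by (intro inv_into_into) simp

lemma \<phi>inv_\<phi>: "z \<in> unit_disk \<Longrightarrow> \<phi>inv (\<phi> z) = z"
  unfolding \<phi>inv_def using disk_bijectionD(2)[OF \<phi>] by (intro inv_into_f_f)

lemma disk_bijection_\<phi>inv: "disk_bijection \<phi>inv"
proof -
  obtain \<sigma> where \<sigma>: "disk_bijection \<sigma>" "\<And>z. z \<in> unit_disk \<Longrightarrow> \<sigma> (\<phi> z) = z" "\<And>z. z \<in> unit_disk \<Longrightarrow> \<phi> (\<sigma> z) = z"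
    using disk_bijection_inverse[OF \<phi>] by metis
  have eq: "\<sigma> z = \<phi>inv z" if "z \<in> unit_disk" for z
    using \<phi>inv_\<phi>[OF disk_bijectionD(4)[OF \<sigma>(1) that]] \<sigma>(3)[OF that] by simp
  show ?thesis
    using \<sigma>(1) eq unfolding disk_bijection_def
    by (metis (no_types, lifting) bij_betw_cong holomorphic_transform)
qed

lemma w_\<phi>inv: "z \<in> unit_disk \<Longrightarrow> w (\<phi>inv z) = of_real s * w z"
  using w_\<phi>[OF \<phi>inv_in, of z] \<phi>_\<phi>inv[of z] s by simp

lemma iterate_in: "z \<in> unit_disk \<Longrightarrow> (\<phi> ^^ n) z \<in> unit_disk"
  by (induction n) (auto intro: \<phi>_in[unfolded mem_ball_0])

lemma iterate_inv_in: "z \<in> unit_disk \<Longrightarrow> (\<phi>inv ^^ n) z \<in> unit_disk"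
  by (induction n) (auto intro: \<phi>inv_in[unfolded mem_ball_0])

lemma w_iterate: "z \<in> unit_disk \<Longrightarrow> w ((\<phi> ^^ n) z) = w z / of_real (s ^ n)"
  by (induction n) (simp_all add: w_\<phi>[OF iterate_in] mult.commute)

lemma w_iterate_inv: "z \<in> unit_disk \<Longrightarrow> w ((\<phi>inv ^^ n) z) = of_real (s ^ n) * w z"
  by (induction n) (simp_all add: w_\<phi>inv[OF iterate_inv_in] mult.assoc)

lemma norm_w_pos: "z \<in> unit_disk \<Longrightarrow> cmod (w z) > 0"
  using w_Re by force

text \<open>The modulus of the symbol, corrected so that composition with \<open>\<phi>\<close> becomes isometric: powers of
  the operator are governed by products of this quantity along orbits.\<close>

definition gain :: "(complex \<Rightarrow> complex) \<Rightarrow> complex \<Rightarrow> real" where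
  "gain \<psi> z = cmod (\<psi> z) * weight z / weight (\<phi> z)"

lemma gain_nonneg: "z \<in> unit_disk \<Longrightarrow> gain \<psi> z \<ge> 0"
  unfolding gain_def using eval_weight_pos[of z \<alpha>] eval_weight_pos[OF \<phi>_in, of z \<alpha>] by simp

lemma weight_ratio:
  assumes "disk_bijection \<tau>"
  obtains m where "m > 0" "\<And>z. z \<in> unit_disk \<Longrightarrow> weight z \<le> m * weight (\<tau> z)"
proof -
  obtain m where m: "m > 0" "\<And>z. z \<in> unit_disk \<Longrightarrow> 1 - (cmod z)\<^sup>2 \<le> m * (1 - (cmod (\<tau> z))\<^sup>2)"
    using disk_bijection_ratio_bounds[OF assms] by blast
  have "weight z \<le> (m powr ((\<alpha> + 2) / 2)) * weight (\<tau> z)" if "z \<in> unit_disk" for z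
  proof -
    have "weight z \<le> (m * (1 - (cmod (\<tau> z))\<^sup>2)) powr ((\<alpha> + 2) / 2)"
      unfolding eval_weight_def using m(2)[OF that] one_minus_norm_pos[OF that] \<alpha>
      by (intro powr_mono2) auto
    also have "\<dots> = (m powr ((\<alpha> + 2) / 2)) * weight (\<tau> z)"
      using m(1) one_minus_norm_pos[OF disk_bijectionD(4)[OF assms that]]
      by (simp add: eval_weight_def powr_mult)
    finally show ?thesis .
  qed
  then show ?thesis using that[of "m powr ((\<alpha> + 2) / 2)"] m(1) by simp
qed

lemma H_infinityE:
  assumes "\<psi> \<in> H_infinity"
  obtains M where "M > 0" "\<And>z. z \<in> unit_disk \<Longrightarrow> cmod (\<psi> z) \<le> M" "\<psi> holomorphic_on unit_disk"
  using assms unfolding H_infinity_def bounded_pos by auto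

lemma gain_bounded:
  assumes "\<psi> \<in> H_infinity"
  obtains M where "M > 0" "\<And>z. z \<in> unit_disk \<Longrightarrow> gain \<psi> z \<le> M"
proof -
  obtain M where M: "M > 0" "\<And>z. z \<in> unit_disk \<Longrightarrow> cmod (\<psi> z) \<le> M"
    using H_infinityE[OF assms] by metis
  obtain m where m: "m > 0" "\<And>z. z \<in> unit_disk \<Longrightarrow> weight z \<le> m * weight (\<phi> z)" using weight_ratio[OF \<phi>] by blast
  have "gain \<psi> z \<le> M * m" if z: "z \<in> unit_disk" for z
  proof -
    have "cmod (\<psi> z) * weight z \<le> M * (m * weight (\<phi> z))"
      using M m z eval_weight_pos[OF z, of \<alpha>] by (intro mult_mono) auto
    then show ?thesis using eval_weight_pos[OF \<phi>_in[OF z], of \<alpha>]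
      by (simp add: gain_def pos_divide_le_eq mult.assoc)
  qed
  then show ?thesis using that[of "M * m"] M m by simp
qed

lemma gain_product_forward:
  assumes "z \<in> unit_disk"
  shows "cmod (\<Prod>j<n. \<psi> ((\<phi> ^^ j) z)) * weight z = (\<Prod>j<n. gain \<psi> ((\<phi> ^^ j) z)) * weight ((\<phi> ^^ n) z)"
proof (induction n)
  case (Suc n)
  have p: "weight ((\<phi> ^^ n) z) > 0" "weight (\<phi> ((\<phi> ^^ n) z)) > 0"
    using eval_weight_pos iterate_in[OF assms] \<phi>_in by blast+
  have "cmod (\<Prod>j<Suc n. \<psi> ((\<phi> ^^ j) z)) * weight z
      = (\<Prod>j<n. gain \<psi> ((\<phi> ^^ j) z)) * weight ((\<phi> ^^ n) z) * cmod (\<psi> ((\<phi> ^^ n) z))"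
    using Suc by (simp add: norm_mult mult_ac)
  also have "\<dots> = (\<Prod>j<Suc n. gain \<psi> ((\<phi> ^^ j) z)) * weight ((\<phi> ^^ Suc n) z)"
    using p by (simp add: gain_def)
  finally show ?case .
qed simp

lemma gain_product_backward:
  assumes "z \<in> unit_disk"
  shows "cmod (\<Prod>j<n. \<psi> ((\<phi>inv ^^ Suc j) z)) * weight ((\<phi>inv ^^ n) z) = (\<Prod>j<n. gain \<psi> ((\<phi>inv ^^ Suc j) z)) * weight z"
proof (induction n)
  case (Suc n)
  let ?y = "(\<phi>inv ^^ Suc n) z"
  have y: "\<phi> ?y = (\<phi>inv ^^ n) z" using \<phi>_\<phi>inv[OF iterate_inv_in[OF assms]] by simp
  have p: "weight ?y > 0" "weight ((\<phi>inv ^^ n) z) > 0"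
    using eval_weight_pos iterate_inv_in[OF assms] by blast+
  have g: "gain \<psi> ?y = cmod (\<psi> ?y) * weight ?y / weight ((\<phi>inv ^^ n) z)" unfolding gain_def y ..
  have "(\<Prod>j<Suc n. gain \<psi> ((\<phi>inv ^^ Suc j) z)) * weight z
    = (cmod (\<Prod>j<n. \<psi> ((\<phi>inv ^^ Suc j) z)) * weight ((\<phi>inv ^^ n) z)) * gain \<psi> ?y"
    unfolding prod.lessThan_Suc Suc by (simp only: mult_ac)
  also have "\<dots> = cmod (\<Prod>j<n. \<psi> ((\<phi>inv ^^ Suc j) z)) * (cmod (\<psi> ?y) * weight ?y)"
    unfolding g using p by (simp del: funpow.simps)
  also have "\<dots> = cmod (\<Prod>j<Suc n. \<psi> ((\<phi>inv ^^ Suc j) z)) * weight ?y"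
    unfolding prod.lessThan_Suc norm_mult by (simp only: mult_ac)
  finally show ?case by simp
qed simp

abbreviation wcomp :: "(complex \<Rightarrow> complex) \<Rightarrow> (complex \<Rightarrow> complex) \<Rightarrow> complex \<Rightarrow> complex" where
  "wcomp \<psi> \<equiv> weighted_composition \<psi> \<phi>"

lemma weighted_composition_bounded:
  assumes \<psi>: "\<psi> holomorphic_on unit_disk" and \<tau>: "disk_bijection \<tau>" and M: "M \<ge> 0"
    and le: "\<And>z. z \<in> unit_disk \<Longrightarrow> cmod (\<psi> z) * weight z \<le> M * weight (\<tau> z)"
  shows "bounded_op (weighted_composition \<psi> \<tau>)"
proof (rule bounded_opI)
  fix f assume f: "f \<in> H"
  show "weighted_composition \<psi> \<tau> f \<in> H" "N (weighted_composition \<psi> \<tau> f) \<le> M * N f"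
    using weighted_composition_bound[OF \<alpha> \<tau> f \<psi> M le] by auto
qed (auto simp: weighted_composition_def algebra_simps fun_eq_iff)

lemma wcomp_bounded:
  assumes "\<psi> \<in> H_infinity" shows "bounded_op (wcomp \<psi>)"
proof -
  obtain M where M: "M > 0" "\<And>z. z \<in> unit_disk \<Longrightarrow> gain \<psi> z \<le> M" using gain_bounded[OF assms] by blast
  show ?thesis
  proof (rule weighted_composition_bounded[OF _ \<phi>, where M = M])
    show "\<psi> holomorphic_on unit_disk" using assms by (simp add: H_infinity_def)
    fix z assume z: "z \<in> unit_disk"
    show "cmod (\<psi> z) * weight z \<le> M * weight (\<phi> z)"
      using M(2)[OF z] eval_weight_pos[OF \<phi>_in[OF z], of \<alpha>] by (simp add: gain_def pos_divide_le_eq)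
  qed (use M in simp)
qed

lemma wcomp_iterate:
  assumes f: "f \<in> H"
  shows "(wcomp \<psi> ^^ n) f = weighted_composition (\<lambda>z. \<Prod>j<n. \<psi> ((\<phi> ^^ j) z)) (\<phi> ^^ n) f"
proof (induction n)
  case 0
  then show ?case using bergman_spaceD(2)[OF f] by (auto simp: weighted_composition_def fun_eq_iff)
next
  case (Suc n)
  show ?case
  proof
    fix z
    show "(wcomp \<psi> ^^ Suc n) f z = weighted_composition (\<lambda>z. \<Prod>j<Suc n. \<psi> ((\<phi> ^^ j) z)) (\<phi> ^^ Suc n) f z"
    proof (cases "z \<in> unit_disk")
      case True
      have "(wcomp \<psi> ^^ Suc n) f z = \<psi> z * (wcomp \<psi> ^^ n) f (\<phi> z)"
        using True unfolding funpow.simps o_apply weighted_composition_def by simp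
      also have "\<dots> = \<psi> z * ((\<Prod>j<n. \<psi> ((\<phi> ^^ j) (\<phi> z))) * f ((\<phi> ^^ n) (\<phi> z)))"
        unfolding Suc using \<phi>_in[OF True] by (simp add: weighted_composition_def)
      also have "\<dots> = (\<Prod>j<Suc n. \<psi> ((\<phi> ^^ j) z)) * f ((\<phi> ^^ Suc n) z)"
        unfolding prod.lessThan_Suc_shift by (simp add: funpow_swap1)
      finally show ?thesis using True by (simp add: weighted_composition_def)
    qed (simp add: weighted_composition_def)
  qed
qed

text \<open>An orbit leaves the neighbourhoods of the fixed points only for a bounded number of steps, so
  the bound for the gain there decides the growth of the powers.\<close>

lemma wcomp_resolvent:
  assumes \<psi>: "\<psi> \<in> H_infinity" and q: "0 < q" "q < cmod \<mu>" and R: "R > 0"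
    and near: "\<And>z. z \<in> unit_disk \<Longrightarrow> cmod (w z) \<ge> R \<or> cmod (w z) \<le> 1 / R \<Longrightarrow> gain \<psi> z \<le> q"
  shows "invertible_op (\<lambda>f z. wcomp \<psi> f z - \<mu> * f z)"
proof -
  obtain M where M: "M > 0" "\<And>z. z \<in> unit_disk \<Longrightarrow> gain \<psi> z \<le> M" using gain_bounded[OF \<psi>] by blast
  obtain C where C: "C > 0"
    "\<And>x t n. \<lbrakk>0 < x; \<And>j::nat. 0 \<le> t j \<and> t j \<le> M; \<And>j. x / s ^ j \<ge> R \<or> x / s ^ j \<le> 1 / R \<Longrightarrow> t j \<le> q\<rbrakk>
       \<Longrightarrow> (\<Prod>j<n. t j) \<le> C * q ^ n"
    using geometric_window_products[OF s R q(1), of M] by metis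
  have \<psi>h: "\<psi> holomorphic_on unit_disk" using \<psi> by (simp add: H_infinity_def)
  show ?thesis
  proof (rule outside_spectral_radius_invertible[OF wcomp_bounded[OF \<psi>] q])
    fix n f assume f: "f \<in> H"
    have hol: "(\<lambda>z. \<Prod>j<n. \<psi> ((\<phi> ^^ j) z)) holomorphic_on unit_disk"
    proof (intro holomorphic_intros)
      fix j
      have "(\<psi> \<circ> (\<phi> ^^ j)) holomorphic_on unit_disk"
        using disk_bijectionD[OF disk_bijection_funpow[OF \<phi>, of j]]
        by (intro holomorphic_on_compose_gen[OF _ \<psi>h]) auto
      then show "(\<lambda>z. \<psi> ((\<phi> ^^ j) z)) holomorphic_on unit_disk" by (simp add: o_def)
    qed
    have "cmod (\<Prod>j<n. \<psi> ((\<phi> ^^ j) z)) * weight z \<le> C * q ^ n * weight ((\<phi> ^^ n) z)" if z: "z \<in> unit_disk" for z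
    proof -
      have "(\<Prod>j<n. gain \<psi> ((\<phi> ^^ j) z)) \<le> C * q ^ n"
      proof (rule C(2)[OF norm_w_pos[OF z]])
        fix j
        show "0 \<le> gain \<psi> ((\<phi> ^^ j) z) \<and> gain \<psi> ((\<phi> ^^ j) z) \<le> M"
          using gain_nonneg M iterate_in[OF z] by blast
        have "cmod (w ((\<phi> ^^ j) z)) = cmod (w z) / s ^ j"
          using w_iterate[OF z, of j] s by (simp add: norm_divide norm_power)
        then show "R \<le> cmod (w z) / s ^ j \<or> cmod (w z) / s ^ j \<le> 1 / R \<Longrightarrow> gain \<psi> ((\<phi> ^^ j) z) \<le> q"
          using near[OF iterate_in[OF z, of j]] by simp
      qed
      then show ?thesis
        unfolding gain_product_forward[OF z] using eval_weight_pos[OF iterate_in[OF z], of \<alpha> n]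
        by (intro mult_right_mono) auto
    qed
    then show "N ((wcomp \<psi> ^^ n) f) \<le> C * q ^ n * N f"
      unfolding wcomp_iterate[OF f]
      using C(1) q(1) by (intro weighted_composition_bound(2)[OF \<alpha> disk_bijection_funpow[OF \<phi>] f hol]) auto
  qed
qed

section \<open>Solving the resolvent equation along an orbit\<close>

lemma forward_coefficient_norm:
  assumes z: "z \<in> unit_disk"
  shows "weight z * cmod ((\<Prod>j<n. \<psi> ((\<phi> ^^ j) z) / \<mu>) * x)
     = (\<Prod>j<n. gain \<psi> ((\<phi> ^^ j) z) / cmod \<mu>) * (weight ((\<phi> ^^ n) z) * cmod x)"
proof -
  have "weight z * cmod ((\<Prod>j<n. \<psi> ((\<phi> ^^ j) z) / \<mu>) * x)
      = (cmod (\<Prod>j<n. \<psi> ((\<phi> ^^ j) z)) * weight z) / cmod \<mu> ^ n * cmod x"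
    by (simp add: prod_dividef norm_divide norm_power norm_mult)
  then show ?thesis unfolding gain_product_forward[OF z] by (simp add: prod_dividef)
qed

lemma backward_coefficient_norm:
  assumes z: "z \<in> unit_disk" and nz: "\<And>n. \<psi> ((\<phi>inv ^^ Suc n) z) \<noteq> 0"
  shows "weight z * cmod ((\<Prod>j<n. \<mu> / \<psi> ((\<phi>inv ^^ Suc j) z)) * x)
     = (\<Prod>j<n. cmod \<mu> / gain \<psi> ((\<phi>inv ^^ Suc j) z)) * (weight ((\<phi>inv ^^ n) z) * cmod x)"
proof -
  let ?P = "cmod (\<Prod>j<n. \<psi> ((\<phi>inv ^^ Suc j) z))" and ?G = "\<Prod>j<n. gain \<psi> ((\<phi>inv ^^ Suc j) z)"
  let ?y = "(\<phi>inv ^^ n) z"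
  have P: "?P > 0" using nz by (simp add: prod_zero_iff del: funpow.simps)
  have dz: "weight z > 0" "weight ?y > 0" using eval_weight_pos z iterate_inv_in by blast+
  have e: "?P * weight ?y = ?G * weight z" by (rule gain_product_backward[OF z])
  have G: "?G > 0"
  proof -
    have "0 < ?P * weight ?y" using P dz(2) by (rule mult_pos_pos)
    then show ?thesis unfolding e using dz(1) zero_less_mult_pos2 by blast
  qed
  have "weight z / ?P = weight ?y / ?G"
  proof -
    have "a / p = b / g" if "p > 0" "g > 0" "p * b = g * a" for a b p g :: real
      using that by (simp add: frac_eq_eq mult.commute)
    from this[OF P G e] show ?thesis .
  qed
  moreover have "weight z * cmod ((\<Prod>j<n. \<mu> / \<psi> ((\<phi>inv ^^ Suc j) z)) * x) = cmod \<mu> ^ n * cmod x * (weight z / ?P)"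
    by (simp add: prod_dividef norm_divide norm_power norm_mult)
  moreover have "(\<Prod>j<n. cmod \<mu> / gain \<psi> ((\<phi>inv ^^ Suc j) z)) * (weight ?y * cmod x) = cmod \<mu> ^ n * cmod x * (weight ?y / ?G)"
    by (simp add: prod_dividef)
  ultimately show ?thesis by metis
qed

text \<open>The equation \<open>\<psi> \<cdot> f \<circ> \<phi> - \<mu> f = g\<close> solved along a forward orbit. The remainder tends to zero
  when the products of the gain grow more slowly than the powers of \<open>\<mu>\<close>.\<close>

lemma forward_sums:
  assumes z: "z \<in> unit_disk" and \<mu>: "\<mu> \<noteq> 0"
    and eq: "\<And>z. z \<in> unit_disk \<Longrightarrow> \<psi> z * f (\<phi> z) - \<mu> * f z = g z"
    and L: "\<And>z. z \<in> unit_disk \<Longrightarrow> weight z * cmod (f z) \<le> L"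
    and q: "0 \<le> q" "q < 1" and C: "\<And>n. (\<Prod>j<n. gain \<psi> ((\<phi> ^^ j) z) / cmod \<mu>) \<le> C * q ^ n"
  shows "(\<lambda>n. (\<Prod>j<n. \<psi> ((\<phi> ^^ j) z) / \<mu>) * g ((\<phi> ^^ n) z)) sums (- \<mu> * f z)"
proof -
  define p where "p n = (\<Prod>j<n. \<psi> ((\<phi> ^^ j) z) / \<mu>)" for n
  define y where "y n = (\<phi> ^^ n) z" for n
  have y: "y n \<in> unit_disk" for n unfolding y_def by (rule iterate_in[OF z])
  have id: "(\<Sum>i<n. p i * g (y i)) = \<mu> * p n * f (y n) - \<mu> * f z" for n
  proof (induction n)
    case (Suc n)
    have g: "g (y n) = \<psi> (y n) * f (y (Suc n)) - \<mu> * f (y n)" using eq[OF y[of n]] by (simp add: y_def)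
    have p: "\<mu> * p (Suc n) = p n * \<psi> (y n)" using \<mu> by (simp add: p_def y_def)
    show ?case unfolding sum.lessThan_Suc Suc g p by (simp add: algebra_simps)
  qed (simp add: p_def y_def)
  have L0: "L \<ge> 0"
    using L[OF z] eval_weight_pos[OF z, of \<alpha>] by (meson mult_nonneg_nonneg norm_ge_zero order_trans less_imp_le)
  have bound: "cmod (\<mu> * p n * f (y n)) \<le> cmod \<mu> * C * L / weight z * q ^ n" for n
  proof -
    have P0: "(\<Prod>j<n. gain \<psi> ((\<phi> ^^ j) z) / cmod \<mu>) \<ge> 0"
      using gain_nonneg iterate_in[OF z] by (intro prod_nonneg) auto
    have "cmod (\<mu> * p n * f (y n)) * weight z = cmod \<mu> * (weight z * cmod (p n * f (y n)))"
      by (simp add: norm_mult)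
    also have "\<dots> = cmod \<mu> * ((\<Prod>j<n. gain \<psi> ((\<phi> ^^ j) z) / cmod \<mu>) * (weight (y n) * cmod (f (y n))))"
      unfolding p_def y_def forward_coefficient_norm[OF z] ..
    also have "\<dots> \<le> cmod \<mu> * ((C * q ^ n) * L)"
      using C[of n] L[OF y] P0 L0 eval_weight_pos[OF y, of \<alpha> n]
      by (intro mult_left_mono mult_mono) auto
    finally show ?thesis using eval_weight_pos[OF z, of \<alpha>] by (simp add: field_simps)
  qed
  have "(\<lambda>n. cmod \<mu> * C * L / weight z * q ^ n) \<longlonglongrightarrow> cmod \<mu> * C * L / weight z * 0"
    using q by (intro tendsto_intros LIMSEQ_realpow_zero)
  then have "(\<lambda>n. cmod \<mu> * C * L / weight z * q ^ n) \<longlonglongrightarrow> 0" by simp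
  then have "(\<lambda>n. \<mu> * p n * f (y n)) \<longlonglongrightarrow> 0"
    by (rule Lim_null_comparison[rotated]) (use bound in simp)
  then have "(\<lambda>n. \<mu> * p n * f (y n) - \<mu> * f z) \<longlonglongrightarrow> 0 - \<mu> * f z" by (intro tendsto_intros)
  then have "(\<lambda>n. \<Sum>i<n. p i * g (y i)) \<longlonglongrightarrow> - \<mu> * f z" unfolding id by simp
  then show ?thesis by (simp add: sums_def p_def y_def)
qed

text \<open>Along a backward orbit the same equation is solved in the other direction. Here the remainder
  tends to zero when the products of the gain grow faster than the powers of \<open>\<mu>\<close>.\<close>

lemma backward_sums:
  assumes z: "z \<in> unit_disk"
    and eq: "\<And>z. z \<in> unit_disk \<Longrightarrow> \<psi> z * f (\<phi> z) - \<mu> * f z = g z"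
    and nz: "\<And>n. \<psi> ((\<phi>inv ^^ Suc n) z) \<noteq> 0"
    and L: "\<And>z. z \<in> unit_disk \<Longrightarrow> weight z * cmod (f z) \<le> L"
    and q: "0 \<le> q" "q < 1" and C: "\<And>n. (\<Prod>j<n. cmod \<mu> / gain \<psi> ((\<phi>inv ^^ Suc j) z)) \<le> C * q ^ n"
  shows "(\<lambda>n. (\<Prod>j<Suc n. \<mu> / \<psi> ((\<phi>inv ^^ Suc j) z)) * g ((\<phi>inv ^^ Suc n) z)) sums (\<mu> * f z)"
proof -
  define p where "p n = (\<Prod>j<n. \<mu> / \<psi> ((\<phi>inv ^^ Suc j) z))" for n
  define y where "y n = (\<phi>inv ^^ n) z" for n
  have y: "y n \<in> unit_disk" for n unfolding y_def by (rule iterate_inv_in[OF z])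
  have id: "(\<Sum>i<n. p (Suc i) * g (y (Suc i))) = \<mu> * f z - \<mu> * p n * f (y n)" for n
  proof (induction n)
    case (Suc n)
    have "\<phi> (y (Suc n)) = y n" unfolding y_def using \<phi>_\<phi>inv[OF iterate_inv_in[OF z]] by simp
    then have g: "g (y (Suc n)) = \<psi> (y (Suc n)) * f (y n) - \<mu> * f (y (Suc n))"
      using eq[OF y[of "Suc n"]] by simp
    have "\<psi> (y (Suc n)) \<noteq> 0" using nz unfolding y_def .
    then have p: "p (Suc n) * \<psi> (y (Suc n)) = p n * \<mu>"
      unfolding p_def y_def prod.lessThan_Suc by simp
    have "p (Suc n) * g (y (Suc n)) = p n * \<mu> * f (y n) - \<mu> * p (Suc n) * f (y (Suc n))"
      unfolding g p[symmetric] by (simp add: algebra_simps)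
    then show ?case unfolding sum.lessThan_Suc Suc by (simp add: algebra_simps)
  qed (simp add: p_def y_def)
  have L0: "L \<ge> 0"
    using L[OF z] eval_weight_pos[OF z, of \<alpha>] by (meson mult_nonneg_nonneg norm_ge_zero order_trans less_imp_le)
  have bound: "cmod (\<mu> * p n * f (y n)) \<le> cmod \<mu> * C * L / weight z * q ^ n" for n
  proof -
    let ?E = "\<Prod>j<n. cmod \<mu> / gain \<psi> ((\<phi>inv ^^ Suc j) z)"
    have P0: "?E \<ge> 0"
      using gain_nonneg iterate_inv_in[OF z] by (intro prod_nonneg) (metis divide_nonneg_nonneg norm_ge_zero)
    have "cmod (\<mu> * p n * f (y n)) * weight z = cmod \<mu> * (weight z * cmod (p n * f (y n)))"
      by (simp add: norm_mult)
    also have "\<dots> = cmod \<mu> * (?E * (weight (y n) * cmod (f (y n))))"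
      unfolding p_def y_def backward_coefficient_norm[where \<psi> = \<psi>, OF z nz] ..
    also have "\<dots> \<le> cmod \<mu> * ((C * q ^ n) * L)"
      using C[of n] L[OF y] P0 L0 eval_weight_pos[OF y, of \<alpha> n]
      by (intro mult_left_mono mult_mono) auto
    finally show ?thesis using eval_weight_pos[OF z, of \<alpha>] by (simp add: field_simps)
  qed
  have "(\<lambda>n. cmod \<mu> * C * L / weight z * q ^ n) \<longlonglongrightarrow> cmod \<mu> * C * L / weight z * 0"
    using q by (intro tendsto_intros LIMSEQ_realpow_zero)
  then have "(\<lambda>n. cmod \<mu> * C * L / weight z * q ^ n) \<longlonglongrightarrow> 0" by simp
  then have "(\<lambda>n. \<mu> * p n * f (y n)) \<longlonglongrightarrow> 0"
    by (rule Lim_null_comparison[rotated]) (use bound in simp)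
  then have "(\<lambda>n. \<mu> * f z - \<mu> * p n * f (y n)) \<longlonglongrightarrow> \<mu> * f z - 0" by (intro tendsto_intros)
  then have "(\<lambda>n. \<Sum>i<n. p (Suc i) * g (y (Suc i))) \<longlonglongrightarrow> \<mu> * f z" unfolding id by simp
  then show ?thesis by (simp only: sums_def p_def y_def)
qed

text \<open>In the forward sum the term of \<open>g z\<close> is moved to the other side, so that both bounds use \<open>g\<close> only at
  the other points of the orbit, where a function concentrated at \<open>z\<close> is small.\<close>

lemma forward_solution_bound:
  assumes z: "z \<in> unit_disk" and \<mu>: "\<mu> \<noteq> 0"
    and eq: "\<And>z. z \<in> unit_disk \<Longrightarrow> \<psi> z * f (\<phi> z) - \<mu> * f z = g z"
    and L: "\<And>z. z \<in> unit_disk \<Longrightarrow> weight z * cmod (f z) \<le> L"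
    and q: "0 \<le> q" "q < 1" and C: "\<And>n. (\<Prod>j<n. gain \<psi> ((\<phi> ^^ j) z) / cmod \<mu>) \<le> C * q ^ n"
    and \<eta>: "\<And>n. weight ((\<phi> ^^ Suc n) z) * cmod (g ((\<phi> ^^ Suc n) z)) \<le> \<eta>"
  shows "weight z * cmod (\<mu> * f z + g z) \<le> C * \<eta> / (1 - q)"
proof -
  let ?a = "\<lambda>n. (\<Prod>j<n. \<psi> ((\<phi> ^^ j) z) / \<mu>) * g ((\<phi> ^^ n) z)"
  have dz: "weight z > 0" by (rule eval_weight_pos[OF z])
  have "(\<lambda>n. ?a (Suc n)) sums (- \<mu> * f z - g z)"
    using forward_sums[OF z \<mu> eq L q C] by (subst sums_Suc_iff) simp
  then have "(\<lambda>n. of_real (weight z) * ?a (Suc n)) sums (of_real (weight z) * (- \<mu> * f z - g z))"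
    by (rule sums_mult)
  then have "cmod (of_real (weight z) * (- \<mu> * f z - g z)) \<le> C * \<eta> / (1 - q)"
  proof (rule sums_norm_le_geometric[OF _ q])
    fix n
    have C0: "C \<ge> 0" using C[of 0] by simp
    have \<eta>0: "\<eta> \<ge> 0"
      using \<eta>[of n] eval_weight_pos[OF iterate_in[OF z], of \<alpha> "Suc n"]
      by (meson less_imp_le mult_nonneg_nonneg norm_ge_zero order_trans)
    have "cmod (of_real (weight z) * ?a (Suc n)) = weight z * cmod (?a (Suc n))"
      using dz by (simp only: norm_mult norm_of_real abs_of_pos)
    also have "\<dots> = (\<Prod>j<Suc n. gain \<psi> ((\<phi> ^^ j) z) / cmod \<mu>) * (weight ((\<phi> ^^ Suc n) z) * cmod (g ((\<phi> ^^ Suc n) z)))"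
      by (rule forward_coefficient_norm[OF z])
    also have "\<dots> \<le> (C * q ^ Suc n) * \<eta>"
      using C0 q eval_weight_pos[OF iterate_in[OF z], of \<alpha> "Suc n"] by (intro mult_mono[OF C \<eta>]) auto
    also have "\<dots> \<le> (C * q ^ n) * \<eta>"
      using C0 q \<eta>0 by (intro mult_right_mono mult_left_mono power_decreasing) auto
    finally show "cmod (of_real (weight z) * ?a (Suc n)) \<le> C * \<eta> * q ^ n" by (simp only: mult_ac)
  qed
  moreover have "- \<mu> * f z - g z = - (\<mu> * f z + g z)" by simp
  ultimately show ?thesis using dz by (simp only: norm_mult norm_minus_cancel norm_of_real abs_of_pos)
qed

lemma backward_solution_bound:
  assumes z: "z \<in> unit_disk"
    and eq: "\<And>z. z \<in> unit_disk \<Longrightarrow> \<psi> z * f (\<phi> z) - \<mu> * f z = g z"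
    and nz: "\<And>n. \<psi> ((\<phi>inv ^^ Suc n) z) \<noteq> 0"
    and L: "\<And>z. z \<in> unit_disk \<Longrightarrow> weight z * cmod (f z) \<le> L"
    and q: "0 \<le> q" "q < 1" and C: "\<And>n. (\<Prod>j<n. cmod \<mu> / gain \<psi> ((\<phi>inv ^^ Suc j) z)) \<le> C * q ^ n"
    and \<eta>: "\<And>n. weight ((\<phi>inv ^^ Suc n) z) * cmod (g ((\<phi>inv ^^ Suc n) z)) \<le> \<eta>"
  shows "weight z * cmod (\<mu> * f z) \<le> C * \<eta> / (1 - q)"
proof -
  let ?a = "\<lambda>n. (\<Prod>j<n. \<mu> / \<psi> ((\<phi>inv ^^ Suc j) z)) * g ((\<phi>inv ^^ n) z)"
  have dz: "weight z > 0" by (rule eval_weight_pos[OF z])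
  have "(\<lambda>n. of_real (weight z) * ?a (Suc n)) sums (of_real (weight z) * (\<mu> * f z))"
    by (rule sums_mult[OF backward_sums[where \<psi> = \<psi>, OF z eq nz L q C]])
  then have "cmod (of_real (weight z) * (\<mu> * f z)) \<le> C * \<eta> / (1 - q)"
  proof (rule sums_norm_le_geometric[OF _ q])
    fix n
    have C0: "C \<ge> 0" using C[of 0] by simp
    have \<eta>0: "\<eta> \<ge> 0"
      using \<eta>[of n] eval_weight_pos[OF iterate_inv_in[OF z], of \<alpha> "Suc n"]
      by (meson less_imp_le mult_nonneg_nonneg norm_ge_zero order_trans)
    have "cmod (of_real (weight z) * ?a (Suc n)) = weight z * cmod (?a (Suc n))"
      using dz by (simp only: norm_mult norm_of_real abs_of_pos)
    also have "\<dots> = (\<Prod>j<Suc n. cmod \<mu> / gain \<psi> ((\<phi>inv ^^ Suc j) z)) * (weight ((\<phi>inv ^^ Suc n) z) * cmod (g ((\<phi>inv ^^ Suc n) z)))"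
      by (rule backward_coefficient_norm[where \<psi> = \<psi>, OF z nz])
    also have "\<dots> \<le> (C * q ^ Suc n) * \<eta>"
      using C0 q eval_weight_pos[OF iterate_inv_in[OF z], of \<alpha> "Suc n"] by (intro mult_mono[OF C \<eta>]) auto
    also have "\<dots> \<le> (C * q ^ n) * \<eta>"
      using C0 q \<eta>0 by (intro mult_right_mono mult_left_mono power_decreasing) auto
    finally show "cmod (of_real (weight z) * ?a (Suc n)) \<le> C * \<eta> * q ^ n" by (simp only: mult_ac)
  qed
  then show ?thesis using dz by (simp only: norm_mult norm_of_real abs_of_pos)
qed

end

section \<open>Test functions\<close>

lemma half_plane_peak_le:
  assumes "r > 0" "Re v > 0"
  shows "cmod (4 * of_real r * v / (of_real r + v)\<^sup>2) \<le> 2"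
proof -
  have "(cmod (of_real r + v))\<^sup>2 = r\<^sup>2 + (cmod v)\<^sup>2 + 2 * r * Re v"
    unfolding cmod_power2 by (simp add: power2_eq_square algebra_simps)
  moreover have "2 * r * cmod v \<le> r\<^sup>2 + (cmod v)\<^sup>2" by (rule sum_squares_bound)
  moreover have "2 * r * Re v > 0" using assms by simp
  ultimately have le: "2 * r * cmod v \<le> (cmod (of_real r + v))\<^sup>2" by linarith
  have "of_real r + v \<noteq> 0" using assms by (auto simp: complex_eq_iff)
  then have "(cmod (of_real r + v))\<^sup>2 > 0" by simp
  then show ?thesis using le assms
    by (simp add: norm_divide norm_mult norm_power pos_divide_le_eq)
qed

lemma dilation_peak:
  fixes t r :: real
  assumes "r > 0" "t > 0"
  shows "cmod (4 * of_real r * of_real (r * t) / (of_real r + of_real (r * t))\<^sup>2) = 4 * t / (1 + t)\<^sup>2"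
proof -
  have "4 * r * (r * t) / (r + r * t)\<^sup>2 = 4 * t / (1 + t)\<^sup>2"
  proof -
    have "(r + r * t)\<^sup>2 = r\<^sup>2 * (1 + t)\<^sup>2" by (simp add: power2_eq_square algebra_simps)
    then show ?thesis using assms by (simp add: power2_eq_square)
  qed
  moreover have "4 * of_real r * of_real (r * t) / (of_real r + of_real (r * t))\<^sup>2
      = (of_real (4 * r * (r * t) / (r + r * t)\<^sup>2) :: complex)" by simp
  ultimately show ?thesis using assms by (simp only: norm_of_real) simp
qed

text \<open>For \<open>t = exp u\<close> the quotient \<open>4 * t / (1 + t)\<^sup>2\<close> is the square of the reciprocal of \<open>cosh (u / 2)\<close>, and
  \<open>cosh (x + y) \<ge> cosh x * cosh y\<close> when \<open>x\<close> and \<open>y\<close> have the same sign.\<close>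

lemma peak_power_decay:
  fixes s :: real
  assumes s: "0 < s" "s < 1"
  shows "4 * s ^ k / (1 + s ^ k)\<^sup>2 \<le> (4 * s / (1 + s)\<^sup>2) ^ k"
proof (induction k)
  case (Suc k)
  let ?x = "s ^ k"
  have x: "0 < ?x" "?x \<le> 1" using s by (auto simp: power_le_one)
  have "(1 + ?x) * (1 + s) \<le> 2 * (1 + s * ?x)"
    using mult_nonneg_nonneg[of "1 - s" "1 - ?x"] s x by (simp add: algebra_simps)
  then have "((1 + ?x) * (1 + s))\<^sup>2 \<le> (2 * (1 + s * ?x))\<^sup>2"
    using s x by (intro power_mono) auto
  then have le: "(1 + ?x)\<^sup>2 * (1 + s)\<^sup>2 \<le> 4 * (1 + s * ?x)\<^sup>2" by (simp only: power_mult_distrib) simp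
  have "4 * (s * ?x) / (1 + s * ?x)\<^sup>2 = 16 * (s * ?x) / (4 * (1 + s * ?x)\<^sup>2)" by simp
  also have "\<dots> \<le> 16 * (s * ?x) / ((1 + ?x)\<^sup>2 * (1 + s)\<^sup>2)"
  proof -
    have "1 + ?x > 0" "1 + s > 0" using s x by (simp_all add: add_pos_pos)
    then have "(1 + ?x)\<^sup>2 * (1 + s)\<^sup>2 > 0" by (intro mult_pos_pos zero_less_power)
    moreover have "16 * (s * ?x) \<ge> 0" using s x by simp
    ultimately show ?thesis using le by (intro frac_le) auto
  qed
  also have "\<dots> = (4 * ?x / (1 + ?x)\<^sup>2) * (4 * s / (1 + s)\<^sup>2)" by simp
  also have "\<dots> \<le> (4 * s / (1 + s)\<^sup>2) ^ k * (4 * s / (1 + s)\<^sup>2)"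
    using s by (intro mult_right_mono Suc) auto
  finally show ?case by (simp add: mult.commute)
qed simp

lemma peak_base_less_one:
  fixes s :: real
  assumes s: "0 < s" "s < 1"
  shows "0 < 4 * s / (1 + s)\<^sup>2" "4 * s / (1 + s)\<^sup>2 < 1"
proof -
  have "(1 - s)\<^sup>2 > 0" using s by simp
  then have "4 * s < (1 + s)\<^sup>2" by (simp add: power2_eq_square algebra_simps)
  then show "0 < 4 * s / (1 + s)\<^sup>2" "4 * s / (1 + s)\<^sup>2 < 1" using s by auto
qed

text \<open>The modulus of \<open>v / (1 + v)\<close> is the inverse of that of \<open>1 + 1 / v\<close>, which increases by a definite factor when
  \<open>v\<close> is scaled down within a bounded part of the right half-plane.\<close>

lemma edge_contraction:
  fixes s R :: real
  assumes s: "0 < s" "s < 1" and R: "R > 0"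
  obtains \<theta> where "0 \<le> \<theta>" "\<theta> < 1"
    "\<And>v n. Re v > 0 \<Longrightarrow> cmod v \<le> R \<Longrightarrow>
      cmod (of_real (s ^ Suc n) * v / (1 + of_real (s ^ Suc n) * v)) \<le> \<theta> * cmod (v / (1 + v))"
proof -
  define \<kappa> where "\<kappa> = 1 / s\<^sup>2 - 1"
  have \<kappa>: "\<kappa> > 0" using s by (simp add: \<kappa>_def field_simps power_less_one_iff abs_square_less_1)
  define \<theta> where "\<theta> = sqrt ((1 + R)\<^sup>2 / ((1 + R)\<^sup>2 + \<kappa>))"
  have D: "(1 + R)\<^sup>2 > 0" using R by simp
  have "(1 + R)\<^sup>2 / ((1 + R)\<^sup>2 + \<kappa>) < 1"
    by (subst divide_less_eq_1_pos) (use D \<kappa> in linarith)+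
  then have th: "\<theta> < 1" by (simp add: \<theta>_def)
  have main: "cmod (of_real (s ^ Suc n) * v / (1 + of_real (s ^ Suc n) * v)) \<le> \<theta> * cmod (v / (1 + v))"
    if v: "Re v > 0" "cmod v \<le> R" for v n
  proof -
    define x where "x = s ^ Suc n"
    have x: "0 < x" "x \<le> s"
      using s power_decreasing[of 1 "Suc n" s] by (auto simp: x_def simp del: power_Suc)
    have ix: "1 / s \<le> 1 / x" using x s by (simp add: frac_le)
    have ge: "(cmod (1 / of_real x + v))\<^sup>2 \<ge> (cmod (1 + v))\<^sup>2 + \<kappa>"
    proof -
      have "(1 / s)\<^sup>2 \<le> (1 / x)\<^sup>2" using ix s by (intro power_mono) auto
      moreover have "Re v \<le> Re v / x"
        using x s v by (simp add: pos_le_divide_eq mult_le_cancel_left2)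
      moreover have "(cmod (1 / of_real x + v))\<^sup>2 = (1 / x)\<^sup>2 + 2 * (Re v / x) + (cmod v)\<^sup>2"
        unfolding cmod_power2 by (simp add: power2_eq_square algebra_simps)
      moreover have "(cmod (1 + v))\<^sup>2 = 1 + 2 * Re v + (cmod v)\<^sup>2"
        unfolding cmod_power2 by (simp add: power2_eq_square algebra_simps)
      ultimately show ?thesis by (simp add: \<kappa>_def power_divide)
    qed
    have nz: "1 + v \<noteq> 0" "1 / of_real x + v \<noteq> 0" "1 + of_real x * v \<noteq> 0"
    proof -
      have "1 / x + Re v > 0" "1 + x * Re v > 0" using v x by (simp_all add: add_pos_pos)
      then show "1 + v \<noteq> 0" "1 / of_real x + v \<noteq> 0" "1 + of_real x * v \<noteq> 0"
        using v by (auto simp: complex_eq_iff)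
    qed
    have le: "(cmod (1 + v))\<^sup>2 \<le> (1 + R)\<^sup>2"
      using norm_triangle_ineq[of 1 v] v by (intro power_mono) auto
    have "(cmod (1 + v))\<^sup>2 / (cmod (1 / of_real x + v))\<^sup>2 \<le> (cmod (1 + v))\<^sup>2 / ((cmod (1 + v))\<^sup>2 + \<kappa>)"
      using ge \<kappa> nz by (intro divide_left_mono mult_pos_pos add_nonneg_pos) auto
    also have "\<dots> \<le> (1 + R)\<^sup>2 / ((1 + R)\<^sup>2 + \<kappa>)"
    proof -
      have "a / (a + \<kappa>) \<le> b / (b + \<kappa>)" if "0 < a" "a \<le> b" for a b
        using that \<kappa> by (simp add: frac_le_eq divide_le_0_iff algebra_simps add_pos_pos)
      then show ?thesis using le nz by simp
    qed
    also have "\<dots> = \<theta>\<^sup>2" using D \<kappa> by (simp add: \<theta>_def)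
    finally have "(cmod (1 + v) / cmod (1 / of_real x + v))\<^sup>2 \<le> \<theta>\<^sup>2" by (simp add: power_divide)
    then have q: "cmod (1 + v) / cmod (1 / of_real x + v) \<le> \<theta>"
      by (rule power2_le_imp_le) (use D \<kappa> in \<open>simp add: \<theta>_def\<close>)
    have "of_real x * v / (1 + of_real x * v) = v / (1 / of_real x + v)"
      using x nz by (simp add: field_simps)
    then have "cmod (of_real x * v / (1 + of_real x * v)) = cmod (1 + v) / cmod (1 / of_real x + v) * cmod (v / (1 + v))"
      using nz by (simp add: norm_divide)
    also have "\<dots> \<le> \<theta> * cmod (v / (1 + v))" using q by (intro mult_right_mono) auto
    finally show ?thesis by (simp only: x_def)
  qed
  show ?thesis by (rule that[OF _ th main]) (use D \<kappa> in \<open>auto simp: \<theta>_def\<close>)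
qed

context hyperbolic_dynamics
begin

text \<open>Test functions whose norms are bounded uniformly in \<open>c\<close>. If \<open>w c\<close> is real, their values, multiplied by
  the evaluation weight, decay geometrically along the orbit of \<open>c\<close> in both directions, at a rate that improves with
  \<open>m\<close>.\<close>

definition peak :: "complex \<Rightarrow> nat \<Rightarrow> complex \<Rightarrow> complex" where
  "peak c m z = (4 * of_real (cmod (w c)) * w z / (of_real (cmod (w c)) + w z)\<^sup>2) ^ m * unit_kernel \<alpha> c z"

lemma w_plus_nonzero: "z \<in> unit_disk \<Longrightarrow> r \<ge> 0 \<Longrightarrow> of_real r + w z \<noteq> 0"
  using w_Re[of z] by (auto simp: complex_eq_iff)

lemma peak_in_space:
  assumes c: "c \<in> unit_disk"
  shows "peak c m \<in> H" "N (peak c m) \<le> 2 ^ m * N disk_one"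
proof -
  let ?Q = "\<lambda>z. (4 * of_real (cmod (w c)) * w z / (of_real (cmod (w c)) + w z)\<^sup>2) ^ m"
  have hol: "?Q holomorphic_on unit_disk"
    using w_plus_nonzero by (intro holomorphic_intros w_holomorphic) auto
  have le: "cmod (?Q z) \<le> 2 ^ m" if "z \<in> unit_disk" for z
    unfolding norm_power using half_plane_peak_le[OF norm_w_pos[OF c] w_Re[OF that]]
    by (intro power_mono) auto
  note k = unit_kernel_bergman[OF \<alpha> c]
  show "peak c m \<in> H"
    using bounded_multiple_bound(1)[OF \<alpha> k(1) hol le] by (simp add: peak_def[abs_def])
  have "N (peak c m) \<le> 2 ^ m * N (unit_kernel \<alpha> c)"
    using bounded_multiple_bound(2)[OF \<alpha> k(1) hol le] by (simp add: peak_def[abs_def])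
  also have "\<dots> \<le> 2 ^ m * N disk_one" using k(2) by simp
  finally show "N (peak c m) \<le> 2 ^ m * N disk_one" .
qed

definition decay :: real where "decay = 4 * s / (1 + s)\<^sup>2"

lemma decay: "0 < decay" "decay < 1"
  using peak_base_less_one[OF s] by (simp_all add: decay_def)

lemma peak_at_center:
  assumes c: "c \<in> unit_disk" and r: "w c = of_real r" "r > 0"
  shows "weight c * cmod (peak c m c) = 1"
proof -
  have "4 * of_real r * of_real r / (of_real r + of_real r)\<^sup>2 = (1::complex)"
    using r by (simp add: power2_eq_square field_simps)
  then show ?thesis
    using unit_kernel_bounds(2)[OF \<alpha> c] r by (simp add: peak_def mult.commute)
qed

lemma peak_on_orbit:
  assumes c: "c \<in> unit_disk" and r: "w c = of_real r" "r > 0" and z: "z \<in> unit_disk"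
    and wz: "w z = of_real (r * s ^ k) \<or> w z = of_real (r / s ^ k)"
  shows "weight z * cmod (peak c m z) \<le> (decay ^ m) ^ k"
proof -
  obtain t where t: "w z = of_real (r * t)" "t = s ^ k \<or> t = 1 / s ^ k"
    using wz by (metis mult.right_neutral times_divide_eq_right)
  have sk: "s ^ k > 0" using s by simp
  then have t0: "t > 0" using t(2) by auto
  have "4 * t / (1 + t)\<^sup>2 = 4 * s ^ k / (1 + s ^ k)\<^sup>2"
    using t(2)
  proof
    assume t1: "t = 1 / s ^ k"
    have "4 * (1 / x) / (1 + 1 / x)\<^sup>2 = 4 * x / (1 + x)\<^sup>2" if "x > 0" for x :: real
      using that by (simp add: power2_eq_square field_simps add_pos_pos)
    from this[OF sk] show ?thesis by (simp only: t1)
  qed simp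
  then have "cmod (4 * of_real r * w z / (of_real r + w z)\<^sup>2) \<le> decay ^ k"
    unfolding t(1) dilation_peak[OF r(2) t0] decay_def using peak_power_decay[OF s, of k] by simp
  then have "cmod ((4 * of_real r * w z / (of_real r + w z)\<^sup>2) ^ m) \<le> (decay ^ k) ^ m"
    unfolding norm_power by (intro power_mono) auto
  also have "(decay ^ k) ^ m = (decay ^ m) ^ k" by (simp add: power_mult[symmetric] mult.commute)
  finally have le: "cmod ((4 * of_real r * w z / (of_real r + w z)\<^sup>2) ^ m) \<le> (decay ^ m) ^ k" .
  have "weight z * cmod (peak c m z)
      = cmod ((4 * of_real r * w z / (of_real r + w z)\<^sup>2) ^ m) * (cmod (unit_kernel \<alpha> c z) * weight z)"
    using r by (simp add: peak_def norm_mult)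
  also have "\<dots> \<le> (decay ^ m) ^ k * 1"
    using le unit_kernel_bounds(1)[OF \<alpha> c z] eval_weight_pos[OF z, of \<alpha>] decay
    by (intro mult_mono) auto
  finally show ?thesis by simp
qed

text \<open>A test function concentrated at \<open>c\<close> that favours \<open>c\<close> over every point of its backward orbit.\<close>

definition edge :: "complex \<Rightarrow> nat \<Rightarrow> complex \<Rightarrow> complex" where
  "edge c m z = (w z / (1 + w z)) ^ m * unit_kernel \<alpha> c z"

lemma one_plus_w_nonzero: "z \<in> unit_disk \<Longrightarrow> 1 + w z \<noteq> 0"
  using w_plus_nonzero[of z 1] by simp

lemma norm_one_plus_w: "z \<in> unit_disk \<Longrightarrow> cmod (w z) \<le> cmod (1 + w z)" "z \<in> unit_disk \<Longrightarrow> 1 \<le> cmod (1 + w z)"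
proof -
  assume z: "z \<in> unit_disk"
  have "(cmod (1 + w z))\<^sup>2 = 1 + 2 * Re (w z) + (cmod (w z))\<^sup>2"
    unfolding cmod_power2 by (simp add: power2_eq_square algebra_simps)
  then have "(cmod (w z))\<^sup>2 \<le> (cmod (1 + w z))\<^sup>2" "1\<^sup>2 \<le> (cmod (1 + w z))\<^sup>2"
    using w_Re[OF z] by auto
  then show "cmod (w z) \<le> cmod (1 + w z)" "1 \<le> cmod (1 + w z)"
    by (auto intro: power2_le_imp_le)
qed

lemma edge_in_space:
  assumes c: "c \<in> unit_disk"
  shows "edge c m \<in> H" "N (edge c m) \<le> N disk_one"
proof -
  have hol: "(\<lambda>z. (w z / (1 + w z)) ^ m) holomorphic_on unit_disk"
    using one_plus_w_nonzero by (intro holomorphic_intros w_holomorphic) auto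
  have le: "cmod ((w z / (1 + w z)) ^ m) \<le> 1" if z: "z \<in> unit_disk" for z
  proof -
    have "cmod (1 + w z) > 0" using one_plus_w_nonzero[OF z] by simp
    then have "cmod (w z / (1 + w z)) \<le> 1" using norm_one_plus_w(1)[OF z] by (simp add: norm_divide)
    then show ?thesis by (simp add: norm_power power_le_one)
  qed
  note k = unit_kernel_bergman[OF \<alpha> c]
  show "edge c m \<in> H"
    using bounded_multiple_bound(1)[OF \<alpha> k(1) hol le] by (simp add: edge_def[abs_def])
  show "N (edge c m) \<le> N disk_one"
    using bounded_multiple_bound(2)[OF \<alpha> k(1) hol le] k(2) by (simp add: edge_def[abs_def])
qed

lemma edge_values:
  assumes c: "c \<in> unit_disk"
  shows "weight c * cmod (edge c m c) = cmod (w c / (1 + w c)) ^ m"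
    and "z \<in> unit_disk \<Longrightarrow> weight z * cmod (edge c m z) \<le> cmod (w z / (1 + w z)) ^ m"
proof -
  show "weight c * cmod (edge c m c) = cmod (w c / (1 + w c)) ^ m"
    using unit_kernel_bounds(2)[OF \<alpha> c] by (simp add: edge_def norm_mult norm_power mult_ac)
  assume z: "z \<in> unit_disk"
  have "cmod (w z / (1 + w z)) ^ m * (cmod (unit_kernel \<alpha> c z) * weight z) \<le> cmod (w z / (1 + w z)) ^ m * 1"
    using unit_kernel_bounds(1)[OF \<alpha> c z] by (intro mult_left_mono) auto
  then show "weight z * cmod (edge c m z) \<le> cmod (w z / (1 + w z)) ^ m"
    by (simp add: edge_def norm_mult norm_power mult_ac)
qed

lemma invertible_solve:
  assumes inv: "invertible_op (\<lambda>f z. wcomp \<psi> f z - \<mu> * f z)"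
  obtains K where "K > 0"
    "\<And>g. g \<in> H \<Longrightarrow> \<exists>f\<in>H. N f \<le> K * N g \<and> (\<forall>z\<in>unit_disk. \<psi> z * f (\<phi> z) - \<mu> * f z = g z)"
    "\<And>f g. f \<in> H \<Longrightarrow> g \<in> H \<Longrightarrow> \<forall>z\<in>unit_disk. \<psi> z * f (\<phi> z) - \<mu> * f z = g z \<Longrightarrow> N f \<le> K * N g"
proof -
  define A where "A = (\<lambda>f z. wcomp \<psi> f z - \<mu> * f z)"
  have invA: "invertible_op A" using inv by (simp add: A_def)
  obtain S where A: "bounded_op A" and S: "bounded_op S" "\<And>f. f \<in> H \<Longrightarrow> S (A f) = f" "\<And>f. f \<in> H \<Longrightarrow> A (S f) = f"
    using invA unfolding invertible_operator_on_def by metis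
  obtain K where K: "K > 0" "\<And>f. f \<in> H \<Longrightarrow> N (S f) \<le> K * N f" using bounded_op_bound[OF S(1)] by metis
  have Az: "A f z = \<psi> z * f (\<phi> z) - \<mu> * f z" if "z \<in> unit_disk" for f z
    using that by (simp add: A_def weighted_composition_def)
  show ?thesis
  proof (rule that[OF K(1)])
    fix g assume g: "g \<in> H"
    have "\<psi> z * S g (\<phi> z) - \<mu> * S g z = g z" if "z \<in> unit_disk" for z
      unfolding Az[OF that, symmetric] S(3)[OF g] ..
    then show "\<exists>f\<in>H. N f \<le> K * N g \<and> (\<forall>z\<in>unit_disk. \<psi> z * f (\<phi> z) - \<mu> * f z = g z)"
      using K(2)[OF g] bounded_opD(1)[OF S(1) g] by blast
  next
    fix f g assume f: "f \<in> H" and g: "g \<in> H" and eq: "\<forall>z\<in>unit_disk. \<psi> z * f (\<phi> z) - \<mu> * f z = g z"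
    have "A f z = g z" for z
    proof (cases "z \<in> unit_disk")
      case True
      then show ?thesis using Az eq by simp
    next
      case False
      then show ?thesis using bergman_spaceD(2)[OF bounded_opD(1)[OF A f]] bergman_spaceD(2)[OF g] by simp
    qed
    then have "A f = g" by (rule ext)
    then have "S g = f" using S(2)[OF f] by simp
    then show "N f \<le> K * N g" using K(2)[OF g] by simp
  qed
qed

section \<open>Points of the spectrum\<close>

lemma norm_w_iterate: "z \<in> unit_disk \<Longrightarrow> cmod (w ((\<phi> ^^ n) z)) = cmod (w z) / s ^ n"
  using w_iterate[of z n] s by (simp add: norm_divide norm_power)

lemma norm_w_iterate_inv: "z \<in> unit_disk \<Longrightarrow> cmod (w ((\<phi>inv ^^ n) z)) = cmod (w z) * s ^ n"
  using w_iterate_inv[of z n] s by (simp add: norm_mult norm_power mult.commute)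

lemma solution_bounded:
  assumes "f \<in> H"
  obtains L where "\<And>z. z \<in> unit_disk \<Longrightarrow> weight z * cmod (f z) \<le> L"
  using point_evaluation_bounded[OF \<alpha>] assms by metis

text \<open>The gain exceeds \<open>\<bar>\<mu>\<bar>\<close> near the repelling point and stays below it near the attracting one. Solving along
  both halves of an orbit gives two expressions for \<open>\<mu> f\<close> at its middle point, hence a linear relation between the
  values on the orbit of every function in the range of \<open>T - \<mu>\<close>; a peak function violates it.\<close>

lemma not_invertible_repelling_annulus:
  assumes \<psi>: "\<psi> \<in> H_infinity" and R: "R > 0" and ab: "0 < a" "a < cmod \<mu>" "cmod \<mu> < b"
    and near_a: "\<And>z. z \<in> unit_disk \<Longrightarrow> cmod (w z) \<ge> R \<Longrightarrow> gain \<psi> z \<le> a"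
    and near_b: "\<And>z. z \<in> unit_disk \<Longrightarrow> cmod (w z) \<le> 1 / R \<Longrightarrow> gain \<psi> z \<ge> b"
  shows "\<not> invertible_op (\<lambda>f z. wcomp \<psi> f z - \<mu> * f z)"
proof
  assume inv: "invertible_op (\<lambda>f z. wcomp \<psi> f z - \<mu> * f z)"
  have \<mu>: "\<mu> \<noteq> 0" "cmod \<mu> > 0" using ab by auto
  obtain M where M: "M > 0" "\<And>z. z \<in> unit_disk \<Longrightarrow> gain \<psi> z \<le> M" using gain_bounded[OF \<psi>] by blast
  obtain z where z: "z \<in> unit_disk" "w z = of_real (1 / R)" using w_onto[of "1 / R"] R by auto
  have nz: "cmod (w z) = 1 / R" using z(2) R by (simp add: norm_divide)
  define p where "p = a / cmod \<mu>"
  define q where "q = cmod \<mu> / b"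
  have p: "0 < p" "p < 1" and q: "0 < q" "q < 1" using ab \<mu> by (auto simp: p_def q_def)
  obtain C where C: "C > 0"
    "\<And>x t n. \<lbrakk>0 < x; \<And>j::nat. 0 \<le> t j \<and> t j \<le> M / cmod \<mu>; \<And>j. x / s ^ j \<ge> R + 1 \<or> x / s ^ j \<le> 1 / (R + 1) \<Longrightarrow> t j \<le> p\<rbrakk>
       \<Longrightarrow> (\<Prod>j<n. t j) \<le> C * p ^ n"
    using geometric_window_products[OF s _ p(1), of "R + 1" "M / cmod \<mu>"] R by (metis add_pos_pos zero_less_one)
  have fwd: "(\<Prod>j<n. gain \<psi> ((\<phi> ^^ j) z) / cmod \<mu>) \<le> C * p ^ n" for n
  proof (rule C(2)[of "1 / R"])
    show "0 < 1 / R" using R by simp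
    fix j
    show "0 \<le> gain \<psi> ((\<phi> ^^ j) z) / cmod \<mu> \<and> gain \<psi> ((\<phi> ^^ j) z) / cmod \<mu> \<le> M / cmod \<mu>"
      using gain_nonneg M iterate_in[OF z(1)] by (auto intro: divide_right_mono)
    assume or: "1 / R / s ^ j \<ge> R + 1 \<or> 1 / R / s ^ j \<le> 1 / (R + 1)"
    have "s ^ j \<le> 1" using s by (simp add: power_le_one)
    then have "1 / R \<le> 1 / R / s ^ j" using R s by (simp add: field_simps)
    moreover have "1 / (R + 1) < 1 / R" using R by (simp add: field_simps)
    ultimately have "1 / R / s ^ j \<ge> R + 1" using or by linarith
    then have "cmod (w ((\<phi> ^^ j) z)) \<ge> R" using norm_w_iterate[OF z(1), of j] nz by simp
    then show "gain \<psi> ((\<phi> ^^ j) z) / cmod \<mu> \<le> p"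
      unfolding p_def using near_a iterate_in[OF z(1)] by (intro divide_right_mono) auto
  qed
  have back_gain: "gain \<psi> ((\<phi>inv ^^ Suc n) z) \<ge> b" for n
  proof (rule near_b[OF iterate_inv_in[OF z(1)]])
    have "s ^ Suc n \<le> 1" using s by (intro power_le_one) auto
    then have "1 / R * s ^ Suc n \<le> 1 / R * 1" using R by (intro mult_left_mono) auto
    then show "cmod (w ((\<phi>inv ^^ Suc n) z)) \<le> 1 / R"
      unfolding norm_w_iterate_inv[OF z(1)] nz by simp
  qed
  have nzp: "\<psi> ((\<phi>inv ^^ Suc n) z) \<noteq> 0" for n
  proof
    assume "\<psi> ((\<phi>inv ^^ Suc n) z) = 0"
    then have "gain \<psi> ((\<phi>inv ^^ Suc n) z) = 0" unfolding gain_def by simp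
    then show False using back_gain[of n] ab \<mu> by linarith
  qed
  have bwd: "(\<Prod>j<n. cmod \<mu> / gain \<psi> ((\<phi>inv ^^ Suc j) z)) \<le> 1 * q ^ n" for n
  proof -
    have "(\<Prod>j<n. cmod \<mu> / gain \<psi> ((\<phi>inv ^^ Suc j) z)) \<le> (\<Prod>j<n. q)"
    proof (rule prod_mono)
      fix j
      have g: "gain \<psi> ((\<phi>inv ^^ Suc j) z) \<ge> b" "b > 0" using back_gain ab \<mu> by auto
      then have "cmod \<mu> / gain \<psi> ((\<phi>inv ^^ Suc j) z) \<le> cmod \<mu> / b"
        by (intro divide_left_mono mult_pos_pos) auto
      then show "0 \<le> cmod \<mu> / gain \<psi> ((\<phi>inv ^^ Suc j) z) \<and> cmod \<mu> / gain \<psi> ((\<phi>inv ^^ Suc j) z) \<le> q"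
        using g unfolding q_def by (auto simp del: funpow.simps)
    qed
    then show ?thesis by simp
  qed
  define c where "c = C / (1 - p) + 1 / (1 - q)"
  have c: "c > 0" using C(1) p q by (simp add: c_def add_pos_pos)
  obtain m where m: "decay ^ m < 1 / c"
    using real_arch_pow_inv[of "1 / c" decay] c decay by auto
  let ?g = "peak z m"
  obtain f where f: "f \<in> H" "\<And>z. z \<in> unit_disk \<Longrightarrow> \<psi> z * f (\<phi> z) - \<mu> * f z = ?g z"
    using invertible_solve[OF inv] peak_in_space(1)[OF z(1), of m] by metis
  obtain L where L: "\<And>z. z \<in> unit_disk \<Longrightarrow> weight z * cmod (f z) \<le> L" using solution_bounded[OF f(1)] by blast
  have R1: "1 / R > 0" using R by simp
  have dm: "0 \<le> decay ^ m" "decay ^ m \<le> 1" using decay by (auto simp: power_le_one)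
  have d1: "(decay ^ m) ^ Suc n \<le> decay ^ m" for n
    using dm power_le_one[OF dm, of n] mult_left_mono[of "(decay ^ m) ^ n" 1 "decay ^ m"] by simp
  have dz: "weight z > 0" by (rule eval_weight_pos[OF z(1)])
  have F: "weight z * cmod (\<mu> * f z + ?g z) \<le> C * decay ^ m / (1 - p)"
  proof (rule forward_solution_bound[OF z(1) \<mu>(1) f(2) L _ _ fwd])
    fix n
    have "w ((\<phi> ^^ Suc n) z) = of_real (1 / R / s ^ Suc n)" using w_iterate[OF z(1), of "Suc n"] z(2) by simp
    then have "weight ((\<phi> ^^ Suc n) z) * cmod (?g ((\<phi> ^^ Suc n) z)) \<le> (decay ^ m) ^ Suc n"
      by (intro peak_on_orbit[OF z R1 iterate_in[OF z(1)]]) blast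
    then show "weight ((\<phi> ^^ Suc n) z) * cmod (?g ((\<phi> ^^ Suc n) z)) \<le> decay ^ m" using d1 by (rule order_trans)
  qed (use p in auto)
  have B: "weight z * cmod (\<mu> * f z) \<le> 1 * decay ^ m / (1 - q)"
  proof (rule backward_solution_bound[where \<psi> = \<psi>, OF z(1) f(2) nzp L _ _ bwd])
    fix n
    have "w ((\<phi>inv ^^ Suc n) z) = of_real (1 / R * s ^ Suc n)"
      unfolding w_iterate_inv[OF z(1)] z(2) by (simp only: of_real_mult[symmetric] mult.commute)
    then have "weight ((\<phi>inv ^^ Suc n) z) * cmod (?g ((\<phi>inv ^^ Suc n) z)) \<le> (decay ^ m) ^ Suc n"
      by (intro peak_on_orbit[OF z R1 iterate_inv_in[OF z(1)]]) blast
    then show "weight ((\<phi>inv ^^ Suc n) z) * cmod (?g ((\<phi>inv ^^ Suc n) z)) \<le> decay ^ m" using d1 by (rule order_trans)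
  qed (use q in auto)
  have "1 = weight z * cmod ((\<mu> * f z + ?g z) - \<mu> * f z)" using peak_at_center[OF z R1, of m] by simp
  also have "\<dots> \<le> weight z * (cmod (\<mu> * f z + ?g z) + cmod (\<mu> * f z))"
    using dz by (intro mult_left_mono norm_triangle_ineq4) simp
  also have "\<dots> \<le> C * decay ^ m / (1 - p) + 1 * decay ^ m / (1 - q)"
    unfolding distrib_left by (rule add_mono[OF F B])
  also have "\<dots> = decay ^ m * c" by (simp add: c_def algebra_simps)
  also have "\<dots> < 1" using m c by (simp add: field_simps)
  finally show False by simp
qed

text \<open>The symbol takes arbitrarily small values at points \<open>z\<close> in a compact range of \<open>w\<close>, but not on the
  backward orbits of these points, and the gain exceeds \<open>\<bar>\<mu>\<bar>\<close> near the repelling fixed point. If \<open>f\<close> is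
  the solution for an edge function at \<open>z\<close>, then \<open>\<psi> z * f (\<phi> z)\<close> is small because \<open>\<psi> z\<close> is, and \<open>\<mu> * f z\<close> is
  small because it depends only on the values of the edge function on the backward orbit; but their difference is the value of
  the edge function at \<open>z\<close>.\<close>

lemma not_invertible_small_values:
  assumes \<psi>: "\<psi> \<in> H_infinity" and R: "R > 0" and \<delta>: "\<delta> > 0" and b: "cmod \<mu> < b"
    and near_b: "\<And>z. z \<in> unit_disk \<Longrightarrow> cmod (w z) \<le> 1 / R \<Longrightarrow> gain \<psi> z \<ge> b"
    and small: "\<And>\<epsilon>. \<epsilon> > 0 \<Longrightarrow> \<exists>z\<in>unit_disk. cmod (\<psi> z) < \<epsilon> \<and> 1 / R \<le> cmod (w z) \<and> cmod (w z) \<le> R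
        \<and> (\<forall>n. cmod (\<psi> ((\<phi>inv ^^ Suc n) z)) \<ge> \<delta>)"
  shows "\<not> invertible_op (\<lambda>f z. wcomp \<psi> f z - \<mu> * f z)"
proof
  assume inv: "invertible_op (\<lambda>f z. wcomp \<psi> f z - \<mu> * f z)"
  have b0: "b > 0" using b by (meson norm_ge_zero order.strict_trans1)
  obtain K where K: "K > 0"
    "\<And>g. g \<in> H \<Longrightarrow> \<exists>f\<in>H. N f \<le> K * N g \<and> (\<forall>z\<in>unit_disk. \<psi> z * f (\<phi> z) - \<mu> * f z = g z)"
    using invertible_solve[OF inv] by metis
  obtain E where E: "E > 0" "\<And>f z. f \<in> H \<Longrightarrow> z \<in> unit_disk \<Longrightarrow> weight z * cmod (f z) \<le> E * N f"
    using point_evaluation_bounded[OF \<alpha>] by blast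
  obtain m1 where m1: "m1 > 0" "\<And>z. z \<in> unit_disk \<Longrightarrow> weight z \<le> m1 * weight (\<phi> z)" using weight_ratio[OF \<phi>] by blast
  obtain m2 where m2: "m2 > 0" "\<And>z. z \<in> unit_disk \<Longrightarrow> weight z \<le> m2 * weight (\<phi>inv z)"
    using weight_ratio[OF disk_bijection_\<phi>inv] by blast
  obtain \<theta> where \<theta>: "0 \<le> \<theta>" "\<theta> < 1"
    "\<And>v n. Re v > 0 \<Longrightarrow> cmod v \<le> R \<Longrightarrow>
      cmod (of_real (s ^ Suc n) * v / (1 + of_real (s ^ Suc n) * v)) \<le> \<theta> * cmod (v / (1 + v))"
    using edge_contraction[OF s R] by blast
  define q where "q = max (1/2) (cmod \<mu> / b)"
  have q: "0 < q" "q < 1" using b b0 by (auto simp: q_def)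
  define M where "M = cmod \<mu> * m2 / \<delta>"
  obtain C where C: "C > 0"
    "\<And>x t n. \<lbrakk>0 < x; \<And>j::nat. 0 \<le> t j \<and> t j \<le> M; \<And>j. x * s ^ j \<ge> R + 1 \<or> x * s ^ j \<le> 1 / (R + 1) \<Longrightarrow> t j \<le> q\<rbrakk>
       \<Longrightarrow> (\<Prod>j<n. t j) \<le> C * q ^ n"
    using geometric_window_products[OF s _ q(1), of "R + 1" M] R by (metis add_pos_pos zero_less_one)
  define c where "c = C / (1 - q)"
  have c: "c > 0" using C(1) q by (simp add: c_def)
  have "\<exists>n. \<theta> ^ n < 1 / (2 * c)" using real_arch_pow_inv[of "1 / (2 * c)" \<theta>] c \<theta> by auto
  then obtain m where m: "\<theta> ^ m < 1 / (2 * c)" by blast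
  define p0 where "p0 = 1 / (R * (1 + R))"
  have p0: "p0 > 0" using R by (simp add: p0_def)
  define X where "X = m1 * (E * (K * N disk_one))"
  have X: "X \<ge> 0" using m1 E K bergman_norm_nonneg[OF \<alpha>] by (simp add: X_def)
  define \<epsilon> where "\<epsilon> = p0 ^ m / 4 / (X + 1)"
  have \<epsilon>: "\<epsilon> > 0" using p0 X by (simp add: \<epsilon>_def)
  obtain z where z: "z \<in> unit_disk" "cmod (\<psi> z) < \<epsilon>" "1 / R \<le> cmod (w z)" "cmod (w z) \<le> R"
    and orb: "\<And>n. cmod (\<psi> ((\<phi>inv ^^ Suc n) z)) \<ge> \<delta>"
    using small[OF \<epsilon>] by blast
  let ?y = "\<lambda>n. (\<phi>inv ^^ n) z"
  have y: "?y n \<in> unit_disk" for n by (rule iterate_inv_in[OF z(1)])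
  have nzp: "\<psi> (?y (Suc n)) \<noteq> 0" for n using orb[of n] \<delta> by (metis norm_zero not_le)
  have gain_low: "gain \<psi> (?y (Suc n)) \<ge> \<delta> / m2" for n
  proof -
    have e: "\<phi> (?y (Suc n)) = ?y n" using \<phi>_\<phi>inv[OF y] by simp
    have "weight (?y n) \<le> m2 * weight (?y (Suc n))" using m2(2)[OF y[of n]] by simp
    then have "1 / m2 \<le> weight (?y (Suc n)) / weight (?y n)"
      using m2(1) eval_weight_pos[OF y[of n], of \<alpha>] by (simp add: field_simps del: funpow.simps)
    then have "\<delta> * (1 / m2) \<le> cmod (\<psi> (?y (Suc n))) * (weight (?y (Suc n)) / weight (?y n))"
      using orb[of n] \<delta> m2(1) by (intro mult_mono) auto
    then show ?thesis unfolding gain_def e by (simp del: funpow.simps)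
  qed
  have bwd: "(\<Prod>j<n. cmod \<mu> / gain \<psi> (?y (Suc j))) \<le> C * q ^ n" for n
  proof (rule C(2)[of "cmod (w z) * s"])
    show "0 < cmod (w z) * s" using norm_w_pos[OF z(1)] s by simp
    fix j
    have g: "gain \<psi> (?y (Suc j)) \<ge> \<delta> / m2" "\<delta> / m2 > 0" using gain_low \<delta> m2 by auto
    have "cmod \<mu> / gain \<psi> (?y (Suc j)) \<le> cmod \<mu> / (\<delta> / m2)"
      using g by (intro divide_left_mono mult_pos_pos) auto
    then show "0 \<le> cmod \<mu> / gain \<psi> (?y (Suc j)) \<and> cmod \<mu> / gain \<psi> (?y (Suc j)) \<le> M"
      unfolding M_def using g by (intro conjI divide_nonneg_pos) (auto simp del: funpow.simps)
    assume or: "cmod (w z) * s * s ^ j \<ge> R + 1 \<or> cmod (w z) * s * s ^ j \<le> 1 / (R + 1)"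
    have e: "cmod (w z) * s * s ^ j = cmod (w (?y (Suc j)))"
      unfolding norm_w_iterate_inv[OF z(1)] by simp
    have "s ^ Suc j \<le> 1" using s by (intro power_le_one) auto
    then have "cmod (w z) * s ^ Suc j \<le> R * 1" using z(4) s R by (intro mult_mono) auto
    then have "cmod (w (?y (Suc j))) \<le> R" unfolding norm_w_iterate_inv[OF z(1)] by simp
    moreover have "1 / (R + 1) \<le> 1 / R" using R by (simp add: field_simps)
    ultimately have "cmod (w (?y (Suc j))) \<le> 1 / R" using or unfolding e by linarith
    then have gb: "gain \<psi> (?y (Suc j)) \<ge> b" by (rule near_b[OF y])
    then have "cmod \<mu> / gain \<psi> (?y (Suc j)) \<le> cmod \<mu> / b"
      using b0 by (intro divide_left_mono mult_pos_pos) auto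
    then show "cmod \<mu> / gain \<psi> (?y (Suc j)) \<le> q" unfolding q_def by linarith
  qed
  let ?g = "edge z m"
  note g = edge_in_space[OF z(1), of m]
  obtain f where f: "f \<in> H" "N f \<le> K * N ?g" "\<And>z. z \<in> unit_disk \<Longrightarrow> \<psi> z * f (\<phi> z) - \<mu> * f z = ?g z"
    using K(2)[OF g(1)] by blast
  have L: "\<And>z. z \<in> unit_disk \<Longrightarrow> weight z * cmod (f z) \<le> E * N f" by (rule E(2)[OF f(1)])
  have fN: "E * N f \<le> E * (K * N disk_one)"
    using f(2) g(2) K(1) E(1) by (intro mult_left_mono) (auto intro: order_trans[OF f(2)])
  define P where "P = cmod (w z / (1 + w z)) ^ m"
  have dz: "weight z > 0" by (rule eval_weight_pos[OF z(1)])
  have P0: "P \<ge> 0" by (simp add: P_def)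
  have Ble: "weight z * cmod (\<mu> * f z) \<le> C * (\<theta> ^ m * P) / (1 - q)"
  proof (rule backward_solution_bound[where \<psi> = \<psi>, OF z(1) f(3) nzp L _ _ bwd])
    fix n
    have "weight (?y (Suc n)) * cmod (?g (?y (Suc n))) \<le> cmod (w (?y (Suc n)) / (1 + w (?y (Suc n)))) ^ m"
      by (rule edge_values(2)[OF z(1) y])
    also have "\<dots> \<le> (\<theta> * cmod (w z / (1 + w z))) ^ m"
      unfolding w_iterate_inv[OF z(1)] by (intro power_mono \<theta>(3) w_Re z) auto
    also have "\<dots> = \<theta> ^ m * P" by (simp only: P_def power_mult_distrib)
    finally show "weight (?y (Suc n)) * cmod (?g (?y (Suc n))) \<le> \<theta> ^ m * P" .
  qed (use q in auto)
  have "C * (\<theta> ^ m * P) / (1 - q) = (\<theta> ^ m * c) * P" by (simp add: c_def)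
  also have "\<dots> \<le> (1/2) * P" using m c P0 by (intro mult_right_mono) (auto simp: field_simps)
  finally have half: "weight z * cmod (\<mu> * f z) \<le> P / 2" using Ble by linarith
  have front: "weight z * cmod (\<psi> z * f (\<phi> z)) \<le> \<epsilon> * X"
  proof -
    have fz: "\<phi> z \<in> unit_disk" by (rule \<phi>_in[OF z(1)])
    have "weight z * cmod (f (\<phi> z)) \<le> m1 * weight (\<phi> z) * cmod (f (\<phi> z))"
      using m1(2)[OF z(1)] by (intro mult_right_mono) auto
    also have "\<dots> \<le> m1 * (E * N f)" using L[OF fz] m1(1) by (simp add: mult.assoc)
    also have "\<dots> \<le> X" unfolding X_def using m1(1) by (intro mult_left_mono[OF fN]) auto
    finally have "weight z * cmod (f (\<phi> z)) \<le> X" .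
    then have "cmod (\<psi> z) * (weight z * cmod (f (\<phi> z))) \<le> \<epsilon> * X"
      using z(2) \<epsilon> dz by (intro mult_mono) auto
    then show ?thesis by (simp add: norm_mult mult_ac)
  qed
  have "P = weight z * cmod (\<psi> z * f (\<phi> z) - \<mu> * f z)"
    using edge_values(1)[OF z(1), of m] by (simp only: P_def f(3)[OF z(1)])
  also have "\<dots> \<le> weight z * (cmod (\<psi> z * f (\<phi> z)) + cmod (\<mu> * f z))"
    using dz by (intro mult_left_mono norm_triangle_ineq4) simp
  also have "\<dots> \<le> \<epsilon> * X + P / 2"
    unfolding distrib_left by (rule add_mono[OF front half])
  finally have "P \<le> 2 * (\<epsilon> * X)" by simp
  also have "\<dots> < p0 ^ m"
  proof -
    have "\<epsilon> * X \<le> \<epsilon> * (X + 1)" using \<epsilon> by simp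
    also have "\<dots> = p0 ^ m / 4"
    proof -
      have "X + 1 \<noteq> 0" using X by linarith
      then show ?thesis unfolding \<epsilon>_def by (rule nonzero_eq_divide_eq[THEN iffD1, OF _ refl])
    qed
    finally have "2 * (\<epsilon> * X) \<le> p0 ^ m / 2" by simp
    then show ?thesis using zero_less_power[OF p0, of m] by linarith
  qed
  also have "\<dots> \<le> P"
  proof -
    have "cmod (1 + w z) \<le> 1 + R" using norm_triangle_ineq[of 1 "w z"] z(4) by simp
    moreover have "cmod (1 + w z) > 0" using one_plus_w_nonzero[OF z(1)] by simp
    ultimately have "(1 / R) / (1 + R) \<le> cmod (w z) / cmod (1 + w z)"
      using z(3) R by (intro frac_le) auto
    then have "p0 \<le> cmod (w z / (1 + w z))" by (simp add: p0_def norm_divide)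
    then show ?thesis unfolding P_def using p0 by (intro power_mono) auto
  qed
  finally show False by simp
qed

text \<open>The gain exceeds \<open>\<bar>\<mu>\<bar>\<close> near the attracting fixed point and stays below it near the repelling one. On functions
  that vanish to high order at the attracting point, that is on multiples of \<open>v = (1 + w) ^ (- m)\<close>, the operator is
  similar to the one with symbol \<open>\<psi> \<cdot> (v \<circ> \<phi>) / v\<close>, for which the gain is less than \<open>\<bar>\<mu>\<bar>\<close>
  near both fixed points; so \<open>T - \<mu>\<close> can be solved there, and an inverse of \<open>T - \<mu>\<close> has to agree with this solution.
  Applied to a peak function far out on a forward orbit, the solution is exponentially large at the starting point.\<close>

lemma not_invertible_attracting_annulus:
  assumes \<psi>: "\<psi> \<in> H_infinity" and R: "R > 0" and ab: "0 < b" "b < cmod \<mu>" "cmod \<mu> < a"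
    and near_a: "\<And>z. z \<in> unit_disk \<Longrightarrow> cmod (w z) \<ge> R \<Longrightarrow> gain \<psi> z \<ge> a"
    and near_b: "\<And>z. z \<in> unit_disk \<Longrightarrow> cmod (w z) \<le> 1 / R \<Longrightarrow> gain \<psi> z \<le> b"
  shows "\<not> invertible_op (\<lambda>f z. wcomp \<psi> f z - \<mu> * f z)"
proof
  assume inv: "invertible_op (\<lambda>f z. wcomp \<psi> f z - \<mu> * f z)"
  have \<mu>: "\<mu> \<noteq> 0" "cmod \<mu> > 0" using ab by auto
  obtain K where K: "K > 0"
    "\<And>f g. f \<in> H \<Longrightarrow> g \<in> H \<Longrightarrow> \<forall>z\<in>unit_disk. \<psi> z * f (\<phi> z) - \<mu> * f z = g z \<Longrightarrow> N f \<le> K * N g"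
    using invertible_solve[OF inv] by metis
  obtain E where E: "E > 0" "\<And>f z. f \<in> H \<Longrightarrow> z \<in> unit_disk \<Longrightarrow> weight z * cmod (f z) \<le> E * N f"
    using point_evaluation_bounded[OF \<alpha>] by blast
  obtain M where M: "M > 0" "\<And>z. z \<in> unit_disk \<Longrightarrow> gain \<psi> z \<le> M" using gain_bounded[OF \<psi>] by blast
  define \<kappa> where "\<kappa> = max 1 (M / cmod \<mu>)"
  have \<kappa>: "\<kappa> \<ge> 1" "M / cmod \<mu> \<le> \<kappa>" by (auto simp: \<kappa>_def)
  define s' where "s' = (1 + s) / 2"
  have s': "s < s'" "0 < s'" "s' < 1" using s by (auto simp: s'_def)
  \<comment> \<open>The order of vanishing has to make the gain of the conjugated symbol less than \<open>b\<close> and the decay of the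
    peak functions faster than the possible growth of the products of the gain.\<close>
  obtain m1 where m1: "s' ^ m1 < b / M" using real_arch_pow_inv[of "b / M" s'] s' ab M(1) by auto
  obtain m2 where m2: "decay ^ m2 < 1 / (8 * \<kappa>)" using real_arch_pow_inv[of "1 / (8 * \<kappa>)" decay] decay \<kappa> by auto
  define m where "m = max m1 m2"
  have "s' ^ m \<le> s' ^ m1" "decay ^ m \<le> decay ^ m2"
    unfolding m_def using s' decay by (intro power_decreasing; simp)+
  then have m: "M * s' ^ m \<le> b" "decay ^ m * \<kappa> \<le> 1 / 8"
  proof -
    have "M * s' ^ m \<le> M * s' ^ m1" using M(1) \<open>s' ^ m \<le> s' ^ m1\<close> by simp
    also have "\<dots> \<le> b" using m1 M(1) by (simp add: pos_less_divide_eq mult.commute)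
    finally show "M * s' ^ m \<le> b" .
    have "decay ^ m * \<kappa> \<le> decay ^ m2 * \<kappa>" using \<kappa>(1) \<open>decay ^ m \<le> decay ^ m2\<close> by simp
    also have "\<dots> \<le> 1 / 8" using m2 \<kappa>(1) by (simp add: pos_less_divide_eq)
    finally show "decay ^ m * \<kappa> \<le> 1 / 8" .
  qed
  let ?u = "\<lambda>z. (1 + w z) / (1 + w z / of_real s)"
  have nz2: "1 + w z / of_real s \<noteq> 0" if "z \<in> unit_disk" for z
    using one_plus_w_nonzero[OF \<phi>_in[OF that]] w_\<phi>[OF that] by simp
  have u_eq: "?u z = (1 + w z) / (1 + w (\<phi> z))" if "z \<in> unit_disk" for z using w_\<phi>[OF that] by simp
  have u_le1: "cmod (?u z) \<le> 1" if z: "z \<in> unit_disk" for z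
  proof -
    have s1: "1 \<le> 1 / s" and s2: "1 \<le> 1 / s\<^sup>2" using s by (auto simp: power_le_one)
    have "Re (w z) * 1 \<le> Re (w z) * (1 / s)"
      using w_Re[OF z] by (intro mult_left_mono[OF s1]) simp
    moreover have "(cmod (w z))\<^sup>2 * 1 \<le> (cmod (w z))\<^sup>2 * (1 / s\<^sup>2)"
      by (rule mult_left_mono[OF s2]) simp
    moreover have "(cmod (1 + w z))\<^sup>2 = 1 + 2 * Re (w z) + (cmod (w z))\<^sup>2"
      unfolding cmod_power2 by (simp add: power2_eq_square algebra_simps)
    moreover have "(cmod (1 + w z / of_real s))\<^sup>2 = 1 + 2 * (Re (w z) * (1 / s)) + (cmod (w z))\<^sup>2 * (1 / s\<^sup>2)"
      unfolding cmod_power2 using s by (simp add: power2_eq_square field_simps)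
    ultimately have "(cmod (1 + w z))\<^sup>2 \<le> (cmod (1 + w z / of_real s))\<^sup>2" by linarith
    then have "cmod (1 + w z) \<le> cmod (1 + w z / of_real s)" by (rule power2_le_imp_le) simp
    then show ?thesis using nz2[OF z] by (simp add: norm_divide)
  qed
  have u_small: "cmod (?u z) \<le> s'" if z: "z \<in> unit_disk" and wz: "cmod (w z) \<ge> 2 * s / (1 - s)" for z
  proof -
    have t: "cmod (w z) > 0" by (rule norm_w_pos[OF z])
    have "cmod (w z) / s = cmod (w z / of_real s)" using s by (simp add: norm_divide)
    also have "\<dots> = cmod (w (\<phi> z))" using w_\<phi>[OF z] by simp
    also have "\<dots> \<le> cmod (1 + w (\<phi> z))" by (rule norm_one_plus_w(1)[OF \<phi>_in[OF z]])
    finally have "cmod (w z) / s \<le> cmod (1 + w z / of_real s)" using w_\<phi>[OF z] by simp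
    then have "cmod (?u z) \<le> (1 + cmod (w z)) / (cmod (w z) / s)"
      using norm_triangle_ineq[of 1 "w z"] t s unfolding norm_divide by (intro frac_le) auto
    also have "\<dots> = s / cmod (w z) + s" using t s by (simp add: field_simps)
    also have "s / cmod (w z) \<le> (1 - s) / 2" using wz t s by (simp add: field_simps)
    finally show ?thesis by (simp add: s'_def field_simps)
  qed
  define \<psi>' where "\<psi>' z = \<psi> z * ?u z ^ m" for z
  have \<psi>': "\<psi>' \<in> H_infinity"
  proof -
    obtain B where B: "B > 0" "\<And>z. z \<in> unit_disk \<Longrightarrow> cmod (\<psi> z) \<le> B" "\<psi> holomorphic_on unit_disk"
      using H_infinityE[OF \<psi>] by metis
    have "\<psi>' holomorphic_on unit_disk"
      unfolding \<psi>'_def using nz2 s by (intro holomorphic_intros B w_holomorphic) auto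
    moreover have "cmod (\<psi>' z) \<le> B" if z: "z \<in> unit_disk" for z
    proof -
      have "cmod (\<psi> z) * cmod (?u z) ^ m \<le> B * 1"
        using B z u_le1[OF z] by (intro mult_mono power_le_one) auto
      then show ?thesis by (simp add: \<psi>'_def norm_mult norm_power)
    qed
    ultimately show ?thesis unfolding H_infinity_def bounded_iff by (auto intro!: exI[of _ B])
  qed
  have gain': "gain \<psi>' z = gain \<psi> z * cmod (?u z) ^ m" for z
    by (simp add: gain_def \<psi>'_def norm_mult norm_power)
  define R' where "R' = max R (2 * s / (1 - s))"
  have R': "R' > 0" "R \<le> R'" "2 * s / (1 - s) \<le> R'" using R by (auto simp: R'_def)
  have near': "gain \<psi>' z \<le> b" if z: "z \<in> unit_disk" and or: "cmod (w z) \<ge> R' \<or> cmod (w z) \<le> 1 / R'" for z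
    using or
  proof
    assume "cmod (w z) \<ge> R'"
    then have "cmod (?u z) \<le> s'" using u_small[OF z] R' by linarith
    then have "gain \<psi>' z \<le> M * s' ^ m"
      unfolding gain' using M z gain_nonneg[OF z] by (intro mult_mono power_mono) auto
    then show ?thesis using m(1) by linarith
  next
    assume "cmod (w z) \<le> 1 / R'"
    also have "\<dots> \<le> 1 / R" using R R' by (simp add: frac_le)
    finally have "gain \<psi> z * cmod (?u z) ^ m \<le> b * 1"
      using near_b[OF z] u_le1[OF z] gain_nonneg[OF z] ab by (intro mult_mono power_le_one) auto
    then show ?thesis unfolding gain' by simp
  qed
  have inv': "invertible_op (\<lambda>f z. wcomp \<psi>' f z - \<mu> * f z)"
    by (rule wcomp_resolvent[OF \<psi>' ab(1,2) R'(1) near'])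
  define q where "q = b / cmod \<mu>"
  have q: "0 < q" "q < 1" using ab \<mu> by (auto simp: q_def)
  obtain M' where M': "M' > 0" "\<And>z. z \<in> unit_disk \<Longrightarrow> gain \<psi>' z \<le> M'" using gain_bounded[OF \<psi>'] by blast
  obtain C where C: "C > 0"
    "\<And>x t n. \<lbrakk>0 < x; \<And>j::nat. 0 \<le> t j \<and> t j \<le> M' / cmod \<mu>; \<And>j. x / s ^ j \<ge> R' \<or> x / s ^ j \<le> 1 / R' \<Longrightarrow> t j \<le> q\<rbrakk>
       \<Longrightarrow> (\<Prod>j<n. t j) \<le> C * q ^ n"
    using geometric_window_products[OF s R'(1) q(1), of "M' / cmod \<mu>"] by metis
  define r where "r = R"
  have r: "r > 0" using R by (simp add: r_def)
  obtain z where z: "z \<in> unit_disk" "w z = of_real r" using w_onto[OF r] by auto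
  let ?y = "\<lambda>n. (\<phi> ^^ n) z"
  have y: "?y n \<in> unit_disk" for n by (rule iterate_in[OF z(1)])
  have wy: "w (?y n) = of_real (r / s ^ n)" for n using w_iterate[OF z(1), of n] z(2) by simp
  have ny: "cmod (w (?y n)) = r / s ^ n" for n unfolding wy norm_of_real using r s by simp
  have fwd': "(\<Prod>j<n. gain \<psi>' (?y j) / cmod \<mu>) \<le> C * q ^ n" for n
  proof (rule C(2)[OF r])
    fix j
    show "0 \<le> gain \<psi>' (?y j) / cmod \<mu> \<and> gain \<psi>' (?y j) / cmod \<mu> \<le> M' / cmod \<mu>"
      using gain_nonneg M' y by (auto intro: divide_right_mono)
    assume "r / s ^ j \<ge> R' \<or> r / s ^ j \<le> 1 / R'"
    then show "gain \<psi>' (?y j) / cmod \<mu> \<le> q"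
      unfolding q_def using near'[OF y[of j]] ny[of j] by (intro divide_right_mono) auto
  qed
  define t where "t j = gain \<psi> (?y j) / cmod \<mu>" for j
  define D where "D n = (\<Prod>j<n. t j)" for n
  have t: "a / cmod \<mu> \<le> t j" "1 \<le> t j" "t j \<le> \<kappa>" for j
  proof -
    have "s ^ j \<le> 1" "s ^ j > 0" using s by (auto simp: power_le_one)
    then have "r \<le> r / s ^ j" using r by (simp add: field_simps)
    then have "gain \<psi> (?y j) \<ge> a" using ny[of j] by (intro near_a y) (simp add: r_def)
    then show ta: "a / cmod \<mu> \<le> t j" unfolding t_def by (intro divide_right_mono) auto
    have "1 \<le> a / cmod \<mu>" using ab \<mu> by simp
    then show "1 \<le> t j" using ta by linarith
    have "t j \<le> M / cmod \<mu>" unfolding t_def using M(2)[OF y] by (intro divide_right_mono) auto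
    then show "t j \<le> \<kappa>" using \<kappa> by linarith
  qed
  have Dpos: "D n \<ge> 1" for n unfolding D_def using t(2) by (intro prod_ge_1) auto
  have Dgrow: "(a / cmod \<mu>) ^ n \<le> D n" for n
  proof -
    have "(\<Prod>j<n. a / cmod \<mu>) \<le> D n" unfolding D_def using t(1) ab \<mu> by (intro prod_mono) auto
    then show ?thesis by simp
  qed
  have Dup: "D (i + k) \<le> D i * \<kappa> ^ k" for i k
  proof (induction k)
    case (Suc k)
    have "D (i + Suc k) = D (i + k) * t (i + k)" by (simp add: D_def)
    also have "\<dots> \<le> (D i * \<kappa> ^ k) * \<kappa>"
      using Suc t(2)[of "i + k"] t(3)[of "i + k"] Dpos[of i] \<kappa> by (intro mult_mono) auto
    finally show ?case by (simp add: mult_ac)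
  qed simp
  have Ddown: "D i \<le> D (i + k)" for i k
  proof (induction k)
    case (Suc k)
    have "D (i + k) * 1 \<le> D (i + k) * t (i + k)"
      using t(2)[of "i + k"] Dpos[of "i + k"] by (intro mult_left_mono) auto
    then show ?case using Suc by (simp add: D_def)
  qed simp
  define x where "x = decay ^ m * \<kappa>"
  have x: "0 \<le> x" "x \<le> 1 / 8" using m decay \<kappa> by (auto simp: x_def)
  have dx: "(decay ^ m) ^ k \<le> x ^ k" "(decay ^ m) ^ k * \<kappa> ^ k = x ^ k" for k
  proof -
    have "decay ^ m * 1 \<le> x" unfolding x_def using decay \<kappa> by (intro mult_left_mono) auto
    then show "(decay ^ m) ^ k \<le> x ^ k" using decay by (intro power_mono) auto
    show "(decay ^ m) ^ k * \<kappa> ^ k = x ^ k" unfolding x_def by (rule power_mult_distrib[symmetric])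
  qed
  define B where "B = cmod \<mu> * (E * (K * (2 ^ m * N disk_one)))"
  have "D n \<le> 2 * B" for n
  proof -
    let ?h = "peak (?y n) m"
    note h = peak_in_space[OF y, of n m]
    define \<rho> where "\<rho> = r / s ^ n"
    have \<rho>: "\<rho> > 0" using r s by (simp add: \<rho>_def)
    have wn: "w (?y n) = of_real \<rho>" "cmod (w (?y n)) = \<rho>" using wy[of n] ny[of n] by (simp_all only: \<rho>_def)
    let ?F = "\<lambda>z. (4 * of_real \<rho> * w z * (1 + w z) / (of_real \<rho> + w z)\<^sup>2) ^ m"
    define k where "k z = ?F z * unit_kernel \<alpha> (?y n) z" for z
    have k: "k \<in> H"
      unfolding k_def[abs_def]
    proof (rule bounded_multiple_bound(1)[OF \<alpha> unit_kernel_bergman(1)[OF \<alpha> y]])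
      show "?F holomorphic_on unit_disk"
        using w_plus_nonzero[OF _ less_imp_le[OF \<rho>]] by (intro holomorphic_intros w_holomorphic) auto
      fix z :: complex assume z: "z \<in> unit_disk"
      have sq: "(cmod (of_real \<rho> + w z))\<^sup>2 = \<rho>\<^sup>2 + 2 * (\<rho> * Re (w z)) + (cmod (w z))\<^sup>2"
        unfolding cmod_power2 by (simp add: power2_eq_square algebra_simps)
      have ge: "cmod (w z) \<le> cmod (of_real \<rho> + w z)" "\<rho> \<le> cmod (of_real \<rho> + w z)"
      proof -
        have "(cmod (w z))\<^sup>2 \<le> (cmod (of_real \<rho> + w z))\<^sup>2" "\<rho>\<^sup>2 \<le> (cmod (of_real \<rho> + w z))\<^sup>2"
          unfolding sq using \<rho> w_Re[OF z] mult_pos_pos[OF \<rho> w_Re[OF z]] zero_le_power2[of \<rho>] zero_le_power2[of "cmod (w z)"]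
          by linarith+
        then show "cmod (w z) \<le> cmod (of_real \<rho> + w z)" "\<rho> \<le> cmod (of_real \<rho> + w z)"
          by (auto intro: power2_le_imp_le)
      qed
      let ?d = "cmod (of_real \<rho> + w z)"
      have d: "?d > 0" using ge \<rho> by linarith
      have f1: "cmod (w z) / ?d \<le> 1" using ge d by simp
      have f2: "cmod (1 + w z) / ?d \<le> 1 / \<rho> + 1"
      proof -
        have "cmod (1 + w z) / ?d \<le> (1 + cmod (w z)) / ?d"
          using norm_triangle_ineq[of 1 "w z"] d by (intro divide_right_mono) auto
        also have "\<dots> = 1 / ?d + cmod (w z) / ?d" by (rule add_divide_distrib)
        also have "1 / ?d \<le> 1 / \<rho>" using ge \<rho> by (intro divide_left_mono mult_pos_pos d) auto
        finally show ?thesis using f1 by linarith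
      qed
      have "cmod (4 * of_real \<rho> * w z * (1 + w z) / (of_real \<rho> + w z)\<^sup>2)
          = 4 * \<rho> * ((cmod (w z) / ?d) * (cmod (1 + w z) / ?d))"
        using \<rho> unfolding norm_divide norm_mult norm_power by (simp add: power2_eq_square)
      also have "\<dots> \<le> 4 * \<rho> * (1 * (1 / \<rho> + 1))"
        using \<rho> d f1 f2 by (intro mult_left_mono mult_mono) auto
      finally show "cmod (?F z) \<le> (4 * \<rho> * (1 * (1 / \<rho> + 1))) ^ m"
        unfolding norm_power by (intro power_mono) auto
    qed
    have kh: "k z = (1 + w z) ^ m * ?h z" for z
      unfolding k_def peak_def wn(2) by (simp add: power_mult_distrib[symmetric] mult_ac)
    obtain e where e: "e \<in> H" "\<And>z. z \<in> unit_disk \<Longrightarrow> \<psi>' z * e (\<phi> z) - \<mu> * e z = k z"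
      using invertible_solve[OF inv'] k by metis
    let ?v = "\<lambda>z. 1 / (1 + w z) ^ m"
    define f where "f z = ?v z * e z" for z
    have f: "f \<in> H"
      unfolding f_def[abs_def]
    proof (rule bounded_multiple_bound(1)[OF \<alpha> e(1)])
      show "?v holomorphic_on unit_disk"
        using one_plus_w_nonzero by (intro holomorphic_intros w_holomorphic) auto
      show "cmod (?v z) \<le> 1" if z: "z \<in> unit_disk" for z
      proof -
        have "1 \<le> cmod (1 + w z) ^ m" by (rule one_le_power[OF norm_one_plus_w(2)[OF z]])
        then have "1 / cmod (1 + w z) ^ m \<le> 1" by (intro divide_le_eq_1[THEN iffD2]) linarith
        then show ?thesis by (simp only: norm_divide norm_power norm_one)
      qed
    qed
    have feq: "\<psi> z * f (\<phi> z) - \<mu> * f z = ?h z" if z: "z \<in> unit_disk" for z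
    proof -
      have n1: "1 + w z \<noteq> 0" "1 + w (\<phi> z) \<noteq> 0" using one_plus_w_nonzero z \<phi>_in by blast+
      have c1: "\<psi>' z * ?v z = \<psi> z * ?v (\<phi> z)"
        unfolding \<psi>'_def u_eq[OF z] using n1 by (simp add: power_divide)
      have "\<psi> z * f (\<phi> z) - \<mu> * f z = (\<psi> z * ?v (\<phi> z)) * e (\<phi> z) - \<mu> * (?v z * e z)"
        unfolding f_def by (simp only: mult_ac)
      also have "\<dots> = ?v z * (\<psi>' z * e (\<phi> z) - \<mu> * e z)"
        unfolding c1[symmetric] by (simp only: right_diff_distrib mult_ac)
      also have "\<dots> = ?v z * k z" by (simp only: e(2)[OF z])
      also have "\<dots> = ?h z" unfolding kh using n1 by simp
      finally show ?thesis .
    qed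
    have "N f \<le> K * N ?h" using K(2)[OF f h(1)] feq by blast
    also have "\<dots> \<le> K * (2 ^ m * N disk_one)" using h(2) K(1) by simp
    finally have fN: "E * N f \<le> E * (K * (2 ^ m * N disk_one))" using E(1) by simp
    have dz: "weight z > 0" by (rule eval_weight_pos[OF z(1)])
    obtain L where L: "\<And>z. z \<in> unit_disk \<Longrightarrow> weight z * cmod (e z) \<le> L" using solution_bounded[OF e(1)] by blast
    have S': "(\<lambda>i. (\<Prod>j<i. \<psi>' (?y j) / \<mu>) * k (?y i)) sums (- \<mu> * e z)"
      using q by (intro forward_sums[OF z(1) \<mu>(1) e(2) L _ _ fwd']) auto
    have conj: "?v z * ((\<Prod>j<i. \<psi>' (?y j) / \<mu>) * k (?y i)) = (\<Prod>j<i. \<psi> (?y j) / \<mu>) * ?h (?y i)" for i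
    proof -
      have "(\<Prod>j<i. \<psi>' (?y j) / \<mu>) * ?v z = (\<Prod>j<i. \<psi> (?y j) / \<mu>) * ?v (?y i)"
      proof (induction i)
        case (Suc i)
        have n1: "1 + w (?y i) \<noteq> 0" "1 + w (\<phi> (?y i)) \<noteq> 0" using one_plus_w_nonzero y \<phi>_in by blast+
        have c1: "\<psi>' (?y i) * ?v (?y i) = \<psi> (?y i) * ?v (\<phi> (?y i))"
          unfolding \<psi>'_def u_eq[OF y] using n1 by (simp add: power_divide)
        have "(\<Prod>j<Suc i. \<psi>' (?y j) / \<mu>) * ?v z = ((\<Prod>j<i. \<psi>' (?y j) / \<mu>) * ?v z) * \<psi>' (?y i) / \<mu>"
          by simp
        also have "\<dots> = (\<Prod>j<i. \<psi> (?y j) / \<mu>) * (\<psi>' (?y i) * ?v (?y i)) / \<mu>" unfolding Suc by simp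
        also have "\<dots> = (\<Prod>j<Suc i. \<psi> (?y j) / \<mu>) * ?v (?y (Suc i))" unfolding c1 by simp
        finally show ?case .
      qed simp
      then have "?v z * ((\<Prod>j<i. \<psi>' (?y j) / \<mu>) * k (?y i)) = (\<Prod>j<i. \<psi> (?y j) / \<mu>) * (?v (?y i) * k (?y i))"
        by (simp add: mult_ac)
      then show ?thesis unfolding kh using one_plus_w_nonzero[OF y] by simp
    qed
    define A where "A i = of_real (weight z) * ((\<Prod>j<i. \<psi> (?y j) / \<mu>) * ?h (?y i))" for i
    have "A sums (of_real (weight z) * (?v z * (- \<mu> * e z)))"
      unfolding A_def conj[symmetric] by (intro sums_mult S')
    then have S: "A sums (of_real (weight z) * (- \<mu> * f z))" by (simp add: f_def mult_ac)
    have normA: "cmod (A i) = D i * (weight (?y i) * cmod (?h (?y i)))" for i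
      unfolding A_def D_def t_def using forward_coefficient_norm[OF z(1), where n = i and \<psi> = \<psi> and \<mu> = \<mu>] dz
      by (simp only: norm_mult norm_of_real abs_of_pos)
    have An: "cmod (A n) = D n"
      unfolding normA peak_at_center[OF y wn(1) \<rho>] by simp
    have Alow: "cmod (A (n - Suc i)) \<le> D n * x ^ Suc i" if i: "i < n" for i
    proof -
      have wi: "w (?y (n - Suc i)) = of_real (\<rho> * s ^ Suc i)"
      proof -
        have "s ^ n = s ^ (n - Suc i) * s ^ Suc i" using i by (simp only: power_add[symmetric]) simp
        then show ?thesis unfolding wy \<rho>_def using s by (simp add: field_simps)
      qed
      have "weight (?y (n - Suc i)) * cmod (?h (?y (n - Suc i))) \<le> (decay ^ m) ^ Suc i"
        by (rule peak_on_orbit[OF y wn(1) \<rho> y]) (use wi in blast)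
      also have "\<dots> \<le> x ^ Suc i" by (rule dx)
      finally have "cmod (A (n - Suc i)) \<le> D (n - Suc i) * x ^ Suc i"
        unfolding normA using Dpos[of "n - Suc i"] by (intro mult_left_mono) auto
      also have "\<dots> \<le> D n * x ^ Suc i"
        using Ddown[of "n - Suc i" "Suc i"] i x by (intro mult_right_mono) auto
      finally show ?thesis .
    qed
    have Ahigh: "cmod (A (i + Suc n)) \<le> D n * x * x ^ i" for i
    proof -
      have wi: "w (?y (i + Suc n)) = of_real (\<rho> / s ^ Suc i)"
        unfolding wy \<rho>_def using s by (simp add: power_add field_simps)
      have pk: "weight (?y (i + Suc n)) * cmod (?h (?y (i + Suc n))) \<le> (decay ^ m) ^ Suc i"
        by (rule peak_on_orbit[OF y wn(1) \<rho> y]) (use wi in blast)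
      have "D (i + Suc n) \<le> D n * \<kappa> ^ Suc i" using Dup[of n "Suc i"] by (simp add: add.commute)
      then have "cmod (A (i + Suc n)) \<le> (D n * \<kappa> ^ Suc i) * (decay ^ m) ^ Suc i"
        unfolding normA using pk Dpos[of n] \<kappa> eval_weight_pos[OF y, of \<alpha> "i + Suc n"]
        by (intro mult_mono) auto
      also have "\<dots> = D n * ((decay ^ m) ^ Suc i * \<kappa> ^ Suc i)" by (simp only: mult_ac)
      also have "\<dots> = D n * x ^ Suc i" unfolding dx(2) ..
      finally show ?thesis by simp
    qed
    have low: "cmod (\<Sum>i<n. A i) \<le> D n * (x / (1 - x))"
    proof -
      have "(\<Sum>i<n. A i) = (\<Sum>i<n. A (n - Suc i))" by (rule sum.nat_diff_reindex[symmetric])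
      then have "cmod (\<Sum>i<n. A i) \<le> (\<Sum>i<n. cmod (A (n - Suc i)))" using norm_sum by metis
      also have "\<dots> \<le> (\<Sum>i<n. (D n * x) * x ^ i)" using Alow by (intro sum_mono) (auto simp: mult_ac)
      also have "\<dots> \<le> (\<Sum>i. (D n * x) * x ^ i)"
        using x Dpos[of n] by (intro sum_le_suminf summable_mult summable_geometric) auto
      also have "\<dots> = D n * (x / (1 - x))" using x by (simp add: suminf_mult summable_geometric suminf_geometric)
      finally show ?thesis .
    qed
    let ?S = "of_real (weight z) * (- \<mu> * f z)"
    have tail: "(\<lambda>i. A (i + Suc n)) sums (?S - (\<Sum>i<Suc n. A i))"
      using S by (subst sums_iff_shift) simp
    have high: "cmod (?S - (\<Sum>i<Suc n. A i)) \<le> D n * (x / (1 - x))"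
      unfolding times_divide_eq_right by (rule sums_norm_le_geometric[OF tail _ _ Ahigh]) (use x in auto)
    have small: "x / (1 - x) \<le> 1 / 7" using x by (simp add: field_simps)
    have "A n = ?S - (\<Sum>i<n. A i) - (?S - (\<Sum>i<Suc n. A i))" by simp
    then have "cmod (A n) \<le> cmod ?S + cmod (\<Sum>i<n. A i) + cmod (?S - (\<Sum>i<Suc n. A i))"
      by (smt (verit, best) norm_triangle_ineq4)
    also have "\<dots> \<le> cmod ?S + D n * (x / (1 - x)) + D n * (x / (1 - x))"
      by (intro add_mono order_refl low high)
    also have "\<dots> \<le> cmod ?S + D n * (1 / 7) + D n * (1 / 7)"
      using small Dpos[of n] by (intro add_mono mult_left_mono) auto
    finally have "D n \<le> 2 * cmod ?S" unfolding An using norm_ge_zero[of ?S] by linarith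
    also have "cmod ?S = cmod \<mu> * (weight z * cmod (f z))" using dz by (simp add: norm_mult)
    also have "\<dots> \<le> B"
      unfolding B_def using E(2)[OF f z(1)] fN by (intro mult_left_mono) auto
    finally show ?thesis by simp
  qed
  moreover obtain n where "2 * B < (a / cmod \<mu>) ^ n"
    using real_arch_pow[of "a / cmod \<mu>" "2 * B"] ab \<mu> by auto
  ultimately show False using Dgrow[of n] by (meson not_le order.trans)
qed

text \<open>The inverse is again a weighted composition operator, composing with the inverse of \<open>\<phi>\<close>.\<close>

lemma bounded_below_invertible:
  assumes \<psi>: "\<psi> \<in> H_infinity" and \<delta>: "\<delta> > 0" "\<And>z. z \<in> unit_disk \<Longrightarrow> cmod (\<psi> z) \<ge> \<delta>"
  shows "invertible_op (wcomp \<psi>)"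
proof -
  let ?S = "weighted_composition (\<lambda>z. 1 / \<psi> (\<phi>inv z)) \<phi>inv"
  have nz: "\<psi> z \<noteq> 0" if "z \<in> unit_disk" for z using \<delta>(2)[OF that] \<delta>(1) by auto
  obtain m where m: "m > 0" "\<And>z. z \<in> unit_disk \<Longrightarrow> weight z \<le> m * weight (\<phi>inv z)"
    using weight_ratio[OF disk_bijection_\<phi>inv] by blast
  have S: "bounded_op ?S"
  proof (rule weighted_composition_bounded[OF _ disk_bijection_\<phi>inv, where M = "1 / \<delta> * m"])
    have "(\<psi> \<circ> \<phi>inv) holomorphic_on unit_disk"
      using disk_bijectionD[OF disk_bijection_\<phi>inv] \<psi>
      by (intro holomorphic_on_compose_gen[where t = unit_disk]) (auto simp: H_infinity_def)
    then show "(\<lambda>z. 1 / \<psi> (\<phi>inv z)) holomorphic_on unit_disk"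
      using nz \<phi>inv_in by (intro holomorphic_intros) (auto simp: o_def)
    show "1 / \<delta> * m \<ge> 0" using \<delta> m by simp
    fix z assume z: "z \<in> unit_disk"
    have "cmod (1 / \<psi> (\<phi>inv z)) \<le> 1 / \<delta>"
      using \<delta>(2)[OF \<phi>inv_in[OF z]] \<delta>(1) by (simp add: norm_divide frac_le)
    then have "cmod (1 / \<psi> (\<phi>inv z)) * weight z \<le> 1 / \<delta> * (m * weight (\<phi>inv z))"
      using m(2)[OF z] \<delta>(1) eval_weight_pos[OF z, of \<alpha>] by (intro mult_mono) auto
    then show "cmod (1 / \<psi> (\<phi>inv z)) * weight z \<le> 1 / \<delta> * m * weight (\<phi>inv z)" by (simp add: mult_ac)
  qed
  have "?S (wcomp \<psi> f) z = f z" if f: "f \<in> H" for f z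
    using nz[OF \<phi>inv_in, of z] \<phi>inv_in[of z] \<phi>_\<phi>inv[of z] bergman_spaceD(2)[OF f, of z]
    by (cases "z \<in> unit_disk") (simp_all add: weighted_composition_def)
  moreover have "wcomp \<psi> (?S f) z = f z" if f: "f \<in> H" for f z
    using nz[of z] \<phi>_in[of z] \<phi>inv_\<phi>[of z] bergman_spaceD(2)[OF f, of z]
    by (cases "z \<in> unit_disk") (simp_all add: weighted_composition_def)
  ultimately show ?thesis
    unfolding invertible_operator_on_def using S wcomp_bounded[OF \<psi>] by (intro conjI exI[of _ ?S]) (auto simp: fun_eq_iff)
qed

text \<open>Otherwise, small values of \<open>\<psi>\<close> occur at points whose backward orbits avoid small values: else small values could be traced back along
  an orbit as often as desired, whereas they occur only in a range of \<open>w\<close> that an orbit crosses in a bounded number of steps.\<close>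

lemma small_values_exist:
  assumes \<psi>: "\<psi> \<in> H_infinity" and ninv: "\<not> invertible_op (wcomp \<psi>)" and R: "R > 0" and c: "c > 0"
    and near: "\<And>z. z \<in> unit_disk \<Longrightarrow> cmod (w z) \<ge> R \<or> cmod (w z) \<le> 1 / R \<Longrightarrow> cmod (\<psi> z) \<ge> c"
  obtains \<delta> where "\<delta> > 0" "\<And>\<epsilon>. \<epsilon> > 0 \<Longrightarrow> \<exists>z\<in>unit_disk. cmod (\<psi> z) < \<epsilon> \<and> 1 / R \<le> cmod (w z) \<and> cmod (w z) \<le> R
        \<and> (\<forall>n. cmod (\<psi> ((\<phi>inv ^^ Suc n) z)) \<ge> \<delta>)"
proof (rule ccontr)
  assume "\<not> thesis"
  then have neg: "\<And>\<delta>. \<delta> > 0 \<Longrightarrow> \<exists>\<epsilon>>0. \<forall>z\<in>unit_disk. cmod (\<psi> z) < \<epsilon> \<longrightarrow> 1 / R \<le> cmod (w z) \<longrightarrow> cmod (w z) \<le> R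
        \<longrightarrow> (\<exists>n. cmod (\<psi> ((\<phi>inv ^^ Suc n) z)) < \<delta>)"
    using that by (metis not_le)
  have small: "1 / R \<le> cmod (w z)" "cmod (w z) < R" if "z \<in> unit_disk" "cmod (\<psi> z) < c" for z
    using near[OF that(1)] that(2) by force+
  have "\<exists>\<delta>>0. \<forall>z\<in>unit_disk. cmod (\<psi> z) < \<delta> \<longrightarrow> 1 / R / s ^ i \<le> cmod (w z)" for i
  proof (induction i)
    case 0
    then show ?case using small(1) c by auto
  next
    case (Suc i)
    then obtain \<delta> where \<delta>: "\<delta> > 0" "\<And>z. z \<in> unit_disk \<Longrightarrow> cmod (\<psi> z) < \<delta> \<Longrightarrow> 1 / R / s ^ i \<le> cmod (w z)"
      by blast
    obtain \<epsilon> where \<epsilon>: "\<epsilon> > 0" "\<And>z. z \<in> unit_disk \<Longrightarrow> cmod (\<psi> z) < \<epsilon> \<Longrightarrow> 1 / R \<le> cmod (w z) \<Longrightarrow> cmod (w z) \<le> R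
        \<Longrightarrow> \<exists>n. cmod (\<psi> ((\<phi>inv ^^ Suc n) z)) < \<delta>"
      using neg[OF \<delta>(1)] by blast
    have "1 / R / s ^ Suc i \<le> cmod (w z)" if z: "z \<in> unit_disk" "cmod (\<psi> z) < min \<epsilon> c" for z
    proof -
      have "1 / R \<le> cmod (w z)" "cmod (w z) \<le> R" using small[OF z(1)] z(2) by auto
      then obtain n where n: "cmod (\<psi> ((\<phi>inv ^^ Suc n) z)) < \<delta>" using \<epsilon>(2)[OF z(1)] z(2) by auto
      have "1 / R / s ^ i \<le> cmod (w z) * s ^ Suc n"
        using \<delta>(2)[OF iterate_inv_in[OF z(1)] n] unfolding norm_w_iterate_inv[OF z(1)] .
      also have "\<dots> \<le> cmod (w z) * s"
        using s power_decreasing[of 1 "Suc n" s] by (intro mult_left_mono) (auto simp del: power_Suc)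
      finally have "1 / R / s ^ i / s \<le> cmod (w z)" using s by (simp only: pos_divide_le_eq)
      then show ?thesis by (simp add: mult_ac)
    qed
    then show ?case using \<epsilon>(1) c by (intro exI[of _ "min \<epsilon> c"]) auto
  qed
  moreover obtain i where i: "s ^ i < 1 / (R * R)" using real_arch_pow_inv[of "1 / (R * R)" s] R s by auto
  ultimately obtain \<delta> where \<delta>: "\<delta> > 0" "\<And>z. z \<in> unit_disk \<Longrightarrow> cmod (\<psi> z) < \<delta> \<Longrightarrow> 1 / R / s ^ i \<le> cmod (w z)"
    by blast
  have "R \<le> 1 / R / s ^ i" using i R s by (simp add: field_simps)
  then have "cmod (\<psi> z) \<ge> min \<delta> c" if "z \<in> unit_disk" for z
    using \<delta>(2)[OF that] small(2)[OF that] by force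
  then have "invertible_op (wcomp \<psi>)"
    using \<delta>(1) c by (intro bounded_below_invertible[OF \<psi>, of "min \<delta> c"]) auto
  then show False using ninv by blast
qed

text \<open>The theorem in half-plane coordinates, with \<open>A\<close> and \<open>B\<close> the limits of the gain at the two fixed points.\<close>

theorem wcomp_spectrum:
  assumes \<psi>: "\<psi> \<in> H_infinity" and AB: "A \<ge> 0" "B \<ge> 0"
    and lim: "\<And>e. e > 0 \<Longrightarrow> \<exists>R>0. \<forall>z\<in>unit_disk. (cmod (w z) \<ge> R \<longrightarrow> \<bar>gain \<psi> z - A\<bar> < e)
        \<and> (cmod (w z) \<le> 1 / R \<longrightarrow> \<bar>gain \<psi> z - B\<bar> < e)"
    and ninv: "\<not> invertible_op (wcomp \<psi>)"
  shows "operator_spectrum H N (wcomp \<psi>) = {\<mu>. cmod \<mu> \<le> max A B}"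
proof -
  let ?inv = "\<lambda>\<mu>. invertible_op (\<lambda>f z. wcomp \<psi> f z - \<mu> * f z)"
  have outside: "?inv \<mu>" if \<mu>: "max A B < cmod \<mu>" for \<mu>
  proof -
    define q where "q = (max A B + cmod \<mu>) / 2"
    have q: "max A B < q" "q < cmod \<mu>" "0 < q" using \<mu> AB by (auto simp: q_def)
    then have "q - max A B > 0" by simp
    then obtain R where R: "R > 0" "\<forall>z\<in>unit_disk. (cmod (w z) \<ge> R \<longrightarrow> \<bar>gain \<psi> z - A\<bar> < q - max A B)
        \<and> (cmod (w z) \<le> 1 / R \<longrightarrow> \<bar>gain \<psi> z - B\<bar> < q - max A B)"
      using lim by blast
    have "gain \<psi> z \<le> q" if "z \<in> unit_disk" "cmod (w z) \<ge> R \<or> cmod (w z) \<le> 1 / R" for z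
      using R(2) that by fastforce
    then show ?thesis by (rule wcomp_resolvent[OF \<psi> q(3,2) R(1)])
  qed
  have inner: "\<not> ?inv \<mu>" if \<mu>: "cmod \<mu> < min A B" for \<mu>
  proof -
    define b where "b = (min A B + cmod \<mu>) / 2"
    have b: "cmod \<mu> < b" "b < min A B" using \<mu> by (auto simp: b_def)
    then have b0: "b > 0" using norm_ge_zero[of \<mu>] by linarith
    have "min A B - b > 0" using b by simp
    then obtain R where R: "R > 0" "\<forall>z\<in>unit_disk. (cmod (w z) \<ge> R \<longrightarrow> \<bar>gain \<psi> z - A\<bar> < min A B - b)
        \<and> (cmod (w z) \<le> 1 / R \<longrightarrow> \<bar>gain \<psi> z - B\<bar> < min A B - b)"
      using lim by blast
    have ge: "gain \<psi> z \<ge> b" if "z \<in> unit_disk" "cmod (w z) \<ge> R \<or> cmod (w z) \<le> 1 / R" for z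
      using R(2) that by fastforce
    obtain m where m: "m > 0" "\<And>z. z \<in> unit_disk \<Longrightarrow> weight z \<le> m * weight (\<phi> z)" using weight_ratio[OF \<phi>] by blast
    have "cmod (\<psi> z) \<ge> b / m" if z: "z \<in> unit_disk" "cmod (w z) \<ge> R \<or> cmod (w z) \<le> 1 / R" for z
    proof -
      have "weight z / weight (\<phi> z) \<le> m"
        using m(2)[OF z(1)] eval_weight_pos[OF \<phi>_in[OF z(1)], of \<alpha>] by (simp add: pos_divide_le_eq)
      then have "cmod (\<psi> z) * (weight z / weight (\<phi> z)) \<le> cmod (\<psi> z) * m" by (rule mult_left_mono) simp
      then have "b \<le> cmod (\<psi> z) * m" using ge[OF z] by (simp add: gain_def)
      then show ?thesis using m(1) by (simp add: pos_divide_le_eq)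
    qed
    from small_values_exist[OF \<psi> ninv R(1) _ this] obtain \<delta> where \<delta>: "\<delta> > 0"
      "\<And>\<epsilon>. \<epsilon> > 0 \<Longrightarrow> \<exists>z\<in>unit_disk. cmod (\<psi> z) < \<epsilon> \<and> 1 / R \<le> cmod (w z) \<and> cmod (w z) \<le> R
        \<and> (\<forall>n. cmod (\<psi> ((\<phi>inv ^^ Suc n) z)) \<ge> \<delta>)"
      using b0 m(1) by (metis divide_pos_pos)
    show ?thesis
      by (rule not_invertible_small_values[OF \<psi> R(1) \<delta>(1) b(1) _ \<delta>(2)]) (use ge in blast)+
  qed
  have between: "\<not> ?inv \<mu>" if \<mu>: "min A B < cmod \<mu>" "cmod \<mu> < max A B" for \<mu>
  proof -
    define l where "l = (min A B + cmod \<mu>) / 2"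
    define u where "u = (max A B + cmod \<mu>) / 2"
    have l: "0 < l" "min A B < l" "l < cmod \<mu>" and u: "cmod \<mu> < u" "u < max A B"
      using \<mu> AB by (auto simp: l_def u_def)
    have "min (l - min A B) (max A B - u) > 0" using l u by simp
    then obtain R where R: "R > 0" "\<forall>z\<in>unit_disk. (cmod (w z) \<ge> R \<longrightarrow> \<bar>gain \<psi> z - A\<bar> < min (l - min A B) (max A B - u))
        \<and> (cmod (w z) \<le> 1 / R \<longrightarrow> \<bar>gain \<psi> z - B\<bar> < min (l - min A B) (max A B - u))"
      using lim by blast
    have near: "z \<in> unit_disk \<Longrightarrow> cmod (w z) \<ge> R \<Longrightarrow> \<bar>gain \<psi> z - A\<bar> < min (l - min A B) (max A B - u)"
      "z \<in> unit_disk \<Longrightarrow> cmod (w z) \<le> 1 / R \<Longrightarrow> \<bar>gain \<psi> z - B\<bar> < min (l - min A B) (max A B - u)" for z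
      using R(2) by blast+
    show ?thesis
    proof (cases "A < B")
      case True
      show ?thesis
      proof (rule not_invertible_repelling_annulus[OF \<psi> R(1) l(1,3) u(1)])
        show "gain \<psi> z \<le> l" if "z \<in> unit_disk" "cmod (w z) \<ge> R" for z using near(1)[OF that] True by auto
        show "gain \<psi> z \<ge> u" if "z \<in> unit_disk" "cmod (w z) \<le> 1 / R" for z using near(2)[OF that] True by auto
      qed
    next
      case False
      show ?thesis
      proof (rule not_invertible_attracting_annulus[OF \<psi> R(1) l(1,3) u(1)])
        show "gain \<psi> z \<ge> u" if "z \<in> unit_disk" "cmod (w z) \<ge> R" for z using near(1)[OF that] False by auto
        show "gain \<psi> z \<le> l" if "z \<in> unit_disk" "cmod (w z) \<le> 1 / R" for z using near(2)[OF that] False by auto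
      qed
    qed
  qed
  \<comment> \<open>The circles of radius \<open>A\<close> and \<open>B\<close> are reached because the spectrum is closed.\<close>
  have closed: "\<not> ?inv \<mu>" if \<mu>: "cmod \<mu> \<le> max A B" for \<mu>
  proof
    assume inv: "?inv \<mu>"
    then have "\<mu> \<noteq> 0" using ninv by auto
    then have x: "cmod \<mu> > 0" by simp
    obtain r where r: "r > 0" "\<And>\<mu>'. cmod (\<mu>' - \<mu>) < r \<Longrightarrow> ?inv \<mu>'"
      using resolvent_open[OF wcomp_bounded[OF \<psi>] inv] by metis
    obtain y where y: "0 < y" "y < cmod \<mu>" "cmod \<mu> - y < r" "y < min A B \<or> min A B < y"
    proof -
      define l where "l = (if min A B < cmod \<mu> then min A B else 0)"
      have l: "0 \<le> l" "l < cmod \<mu>" "cmod \<mu> \<le> min A B \<or> l = min A B" using x AB by (auto simp: l_def)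
      obtain y where "max l (cmod \<mu> - r) < y" "y < cmod \<mu>"
        using dense[of "max l (cmod \<mu> - r)" "cmod \<mu>"] l r(1) by auto
      then show thesis using l by (intro that[of y]) linarith+
    qed
    let ?\<mu> = "of_real (y / cmod \<mu>) * \<mu>"
    have n: "cmod ?\<mu> = y" using y x by (simp add: norm_mult norm_divide)
    have "?\<mu> - \<mu> = of_real (y / cmod \<mu> - 1) * \<mu>" by (simp add: algebra_simps)
    then have "cmod (?\<mu> - \<mu>) = \<bar>y / cmod \<mu> - 1\<bar> * cmod \<mu>" by (simp only: norm_mult norm_of_real)
    also have "\<dots> = \<bar>(y / cmod \<mu> - 1) * cmod \<mu>\<bar>" by (simp add: abs_mult)
    also have "(y / cmod \<mu> - 1) * cmod \<mu> = y - cmod \<mu>" using x by (simp add: left_diff_distrib)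
    finally have "cmod (?\<mu> - \<mu>) < r" using y by simp
    then have "?inv ?\<mu>" by (rule r(2))
    moreover have "\<not> ?inv ?\<mu>"
      using y(4)
    proof
      assume "y < min A B"
      then show ?thesis using n by (intro inner) simp
    next
      assume "min A B < y"
      then show ?thesis using n y(2) \<mu> by (intro between) simp_all
    qed
    ultimately show False by blast
  qed
  have "\<not> ?inv \<mu> \<longleftrightarrow> cmod \<mu> \<le> max A B" for \<mu>
    using outside closed not_le by blast
  then show ?thesis by (simp only: operator_spectrum_def)
qed

end

section \<open>Hyperbolic automorphisms\<close>

lemma Moebius_difference:
  assumes "1 - cnj c * z \<noteq> 0" "1 - cnj c * x \<noteq> 0"
  shows "e * ((z - c) / (1 - cnj c * z)) - e * ((x - c) / (1 - cnj c * x))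
     = e * (1 - (cmod c)\<^sup>2) * (z - x) / ((1 - cnj c * z) * (1 - cnj c * x))"
proof -
  have cc: "cnj c * c = of_real ((cmod c)\<^sup>2)" by (metis complex_norm_square mult.commute)
  have "(z - c) * (1 - cnj c * x) - (x - c) * (1 - cnj c * z) = (1 - cnj c * c) * (z - x)"
    by (simp add: algebra_simps)
  then have main: "(z - c) / (1 - cnj c * z) - (x - c) / (1 - cnj c * x)
      = (1 - cnj c * c) * (z - x) / ((1 - cnj c * z) * (1 - cnj c * x))"
    using assms by (simp add: diff_frac_eq)
  have "e * ((z - c) / (1 - cnj c * z)) - e * ((x - c) / (1 - cnj c * x))
      = e * ((z - c) / (1 - cnj c * z) - (x - c) / (1 - cnj c * x))"
    by (rule right_diff_distrib[symmetric])
  also have "\<dots> = e * (1 - (cmod c)\<^sup>2) * (z - x) / ((1 - cnj c * z) * (1 - cnj c * x))"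
    unfolding main cc by simp
  finally show ?thesis .
qed

text \<open>The derivatives at the two fixed points are positive and reciprocal to each other, and the cross ratio
  with respect to the fixed points linearises the automorphism.\<close>

lemma hyperbolic_automorphism_cross_ratio:
  assumes \<phi>: "disk_automorphism \<phi>"
    and a: "cmod a = 1" "\<phi> a = a" and b: "cmod b = 1" "\<phi> b = b" and ab: "a \<noteq> b"
  obtains s where "s > 0" "deriv \<phi> a = of_real s" "deriv \<phi> b = of_real (1 / s)"
    "\<And>z. z \<in> unit_disk \<Longrightarrow> (\<phi> z - b) / (\<phi> z - a) = (z - b) / (z - a) / of_real s"
    "(deriv \<phi> \<longlongrightarrow> deriv \<phi> a) (at a within unit_disk)"
    "(deriv \<phi> \<longlongrightarrow> deriv \<phi> b) (at b within unit_disk)"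
proof -
  have an: "\<phi> analytic_on cball 0 1" and bij: "bij_betw \<phi> unit_disk unit_disk"
    using \<phi> by (auto simp: disk_automorphism_def)
  have hol: "\<phi> holomorphic_on cball 0 1" by (rule analytic_imp_holomorphic[OF an])
  have hol': "\<phi> holomorphic_on unit_disk" by (rule holomorphic_on_subset[OF hol]) auto
  have dan: "deriv \<phi> analytic_on cball 0 1" by (rule analytic_deriv[OF an])
  have dcont: "continuous_on (cball 0 1) (deriv \<phi>)"
    by (rule holomorphic_on_imp_continuous_on[OF analytic_imp_holomorphic[OF dan]])
  have disk: "disk_bijection \<phi>" using hol' bij by (simp add: disk_bijection_def)
  obtain e c where ec: "cmod e = 1" "cmod c < 1"
    "\<And>z. z \<in> unit_disk \<Longrightarrow> \<phi> z = e * ((z - c) / (1 - cnj c * z))"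
    using disk_bijection_is_Moebius[OF disk] by blast
  have nz: "1 - cnj c * z \<noteq> 0" if "z \<in> cball 0 1" for z
    using one_minus_cnj_mult_nonzero[OF ec(2)] that by simp
  have extend: "f z = 0" if f: "continuous_on (cball 0 1) f" "\<And>z. z \<in> unit_disk \<Longrightarrow> f z = 0" "z \<in> cball 0 1"
    for f :: "complex \<Rightarrow> complex" and z
    using continuous_constant_on_closure[of unit_disk f 0 z] f by simp
  have eq: "\<phi> z = e * ((z - c) / (1 - cnj c * z))" if z: "z \<in> cball 0 1" for z
  proof -
    have "continuous_on (cball 0 1) (\<lambda>z. \<phi> z - e * ((z - c) / (1 - cnj c * z)))"
      using nz by (intro continuous_intros holomorphic_on_imp_continuous_on[OF hol]) auto
    from extend[OF this _ z] show ?thesis using ec(3) by simp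
  qed
  have deq: "deriv \<phi> z = e * (1 - (cmod c)\<^sup>2) / (1 - cnj c * z)\<^sup>2" if z: "z \<in> cball 0 1" for z
  proof -
    have "continuous_on (cball 0 1) (\<lambda>z. deriv \<phi> z - e * (1 - (cmod c)\<^sup>2) / (1 - cnj c * z)\<^sup>2)"
      using nz by (intro continuous_intros dcont) auto
    moreover have "deriv \<phi> z - e * (1 - (cmod c)\<^sup>2) / (1 - cnj c * z)\<^sup>2 = 0" if z: "z \<in> unit_disk" for z
    proof -
      have "(\<phi> has_field_derivative e * (1 - (cmod c)\<^sup>2) / (1 - cnj c * z)\<^sup>2) (at z)"
        by (rule has_field_derivative_transform_within_open[OF Moebius_derivative[of c z e] open_ball z])
          (use ec z in auto)
      then show ?thesis using DERIV_imp_deriv by simp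
    qed
    ultimately show ?thesis using extend[OF _ _ z] by fastforce
  qed
  define P where "P z = 1 - cnj c * z" for z
  define k where "k = 1 - (cmod c)\<^sup>2"
  have k: "k > 0" using ec(2) by (simp add: k_def abs_square_less_1)
  have kc: "complex_of_real k = 1 - (complex_of_real (cmod c))\<^sup>2" by (simp add: k_def)
  have ac: "a \<in> cball 0 1" and bc: "b \<in> cball 0 1" using a b by auto
  have nP: "P z \<noteq> 0" if "z \<in> cball 0 1" for z using nz[OF that] by (simp add: P_def)
  have diff: "\<phi> z - \<phi> x = e * of_real k * (z - x) / (P z * P x)" if "z \<in> cball 0 1" "x \<in> cball 0 1" for z x
    unfolding eq[OF that(1)] eq[OF that(2)] kc P_def
    using Moebius_difference[OF nz[OF that(1)] nz[OF that(2)], of e] by simp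
  have ek: "e * of_real k = P a * P b"
  proof -
    have d: "a - b = e * of_real k * (a - b) / (P a * P b)" using diff[OF ac bc] a b by simp
    have "P a * P b \<noteq> 0" using nP[OF ac] nP[OF bc] by simp
    then have "(a - b) * (P a * P b) = e * of_real k * (a - b)" using d by (metis nonzero_eq_divide_eq)
    then have "(a - b) * (P a * P b) = (a - b) * (e * of_real k)" by (simp only: mult_ac)
    then show ?thesis using ab by simp
  qed
  have conjP: "e * cnj (P x) = P x" if x: "cmod x = 1" "\<phi> x = x" for x
  proof -
    have xc: "x \<in> cball 0 1" using x by simp
    have "x * cnj x = 1" using x(1) by (simp add: complex_norm_square[symmetric])
    then have "x * cnj (P x) = x - c" by (simp add: P_def algebra_simps)
    moreover have "x * P x = e * (x - c)"
      using eq[OF xc] x(2) nP[OF xc] by (simp add: P_def field_simps)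
    ultimately have "x * (e * cnj (P x)) = x * P x" by (simp add: mult_ac)
    then show ?thesis using x(1) by auto
  qed
  have dk: "deriv \<phi> x = e * of_real k / (P x * P x)" if "x \<in> cball 0 1" for x
    using deq[OF that] by (simp add: kc P_def power2_eq_square)
  have pos: "deriv \<phi> x = of_real (k / (cmod (P x))\<^sup>2)" if x: "cmod x = 1" "\<phi> x = x" for x
  proof -
    have xc: "x \<in> cball 0 1" using x by simp
    have "deriv \<phi> x = e * of_real k / (P x * P x)" by (rule dk[OF xc])
    also have "\<dots> = e * of_real k / ((e * cnj (P x)) * P x)" using conjP[OF x] by simp
    also have "\<dots> = of_real k / (cnj (P x) * P x)" using ec(1) by auto
    also have "cnj (P x) * P x = of_real ((cmod (P x))\<^sup>2)" by (metis complex_norm_square mult.commute)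
    finally show ?thesis by simp
  qed
  define s where "s = k / (cmod (P a))\<^sup>2"
  have s0: "s > 0" using k nP[OF ac] by (simp add: s_def)
  have da: "deriv \<phi> a = of_real s" using pos[OF a] by (simp add: s_def)
  have da': "deriv \<phi> a = P b / P a"
    using dk[OF ac] nP[OF ac] unfolding ek by simp
  have db': "deriv \<phi> b = P a / P b"
    using dk[OF bc] nP[OF bc] unfolding ek by simp
  have Pb: "P b = of_real s * P a" using da da' nP[OF ac] by (simp add: field_simps)
  have db: "deriv \<phi> b = of_real (1 / s)" unfolding db' Pb using nP[OF ac] s0 by simp
  have cross: "(\<phi> z - b) / (\<phi> z - a) = (z - b) / (z - a) / of_real s" if z: "z \<in> unit_disk" for z
  proof -
    have zc: "z \<in> cball 0 1" using z by simp
    have za: "z - a \<noteq> 0" using z a by auto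
    have e0: "e * of_real k \<noteq> 0" using ec(1) k by auto
    have fb: "\<phi> z - b = P a * (z - b) / P z" and fa: "\<phi> z - a = P b * (z - a) / P z"
      using diff[OF zc bc] diff[OF zc ac] a b nP[OF ac] nP[OF bc] unfolding ek by simp_all
    show ?thesis unfolding fb fa Pb using nP[OF ac] nP[OF zc] by simp
  qed
  have lim: "(deriv \<phi> \<longlongrightarrow> deriv \<phi> x) (at x within unit_disk)" if "x \<in> cball 0 1" for x
    using dcont that continuous_on_subset unfolding continuous_on_def
    by (meson ball_subset_cball tendsto_within_subset)
  show ?thesis by (rule that[OF s0 da db cross lim[OF ac] lim[OF bc]])
qed

text \<open>The quotient \<open>(z - b) / (z - a)\<close> maps the disk to a half-plane bounded by a line through the origin; the
  factor \<open>cnj b * (a - b)\<close> rotates it to the right half-plane.\<close>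

lemma half_plane_coordinate:
  assumes a: "cmod a = 1" and b: "cmod b = 1" and ab: "a \<noteq> b" and za: "z \<noteq> a"
  shows "Re (cnj b * (a - b) * ((z - b) / (z - a))) = (1 - Re (cnj b * a)) * (1 - (cmod z)\<^sup>2) / (cmod (z - a))\<^sup>2"
    and "Re (cnj b * a) < 1"
proof -
  have a1: "(Re a)\<^sup>2 + (Im a)\<^sup>2 = 1" and b1: "(Re b)\<^sup>2 + (Im b)\<^sup>2 = 1"
    using a b by (simp_all add: cmod_power2[symmetric])
  have "(cmod (a - b))\<^sup>2 = 2 - 2 * Re (cnj b * a)"
    using a1 b1 unfolding cmod_power2 by (simp add: power2_eq_square algebra_simps)
  moreover have "(cmod (a - b))\<^sup>2 > 0" using ab by simp
  ultimately show "Re (cnj b * a) < 1" by linarith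
  have num: "Re (cnj b * (a - b) * ((z - b) * cnj (z - a))) = (1 - Re (cnj b * a)) * (1 - (cmod z)\<^sup>2)"
    unfolding cmod_power2 using a1 b1 by (simp add: power2_eq_square) algebra
  have "(z - b) / (z - a) = (z - b) * cnj (z - a) / of_real ((cmod (z - a))\<^sup>2)"
    by (rule complex_div_cnj[THEN trans]) simp
  then have "cnj b * (a - b) * ((z - b) / (z - a)) = cnj b * (a - b) * ((z - b) * cnj (z - a)) / of_real ((cmod (z - a))\<^sup>2)"
    by simp
  then have "Re (cnj b * (a - b) * ((z - b) / (z - a))) = Re (cnj b * (a - b) * ((z - b) * cnj (z - a))) / (cmod (z - a))\<^sup>2"
    by (simp only: Re_divide_of_real)
  then show "Re (cnj b * (a - b) * ((z - b) / (z - a))) = (1 - Re (cnj b * a)) * (1 - (cmod z)\<^sup>2) / (cmod (z - a))\<^sup>2"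
    unfolding num .
qed

lemma boundary_value_tendsto:
  assumes "continuous_at_boundary \<psi> c" "c \<in> sphere 0 1"
  shows "(\<psi> \<longlongrightarrow> boundary_value \<psi> c) (at c within unit_disk)"
proof -
  obtain l where l: "(\<psi> \<longlongrightarrow> l) (at c within unit_disk)"
    using assms(1) unfolding continuous_at_boundary_def by blast
  have "at c within unit_disk \<noteq> bot"
    using assms(2) by (simp add: trivial_limit_within islimpt_ball)
  then show ?thesis using l tendsto_Lim unfolding boundary_value_def by metis
qed

theorem theorem4p2p1:
  fixes \<alpha> :: real and \<phi> \<psi> :: "complex \<Rightarrow> complex" and a b :: complex
  assumes "\<alpha> > -1"
    and "hyperbolic_automorphism \<phi>"
    and "a \<in> sphere 0 1" and "denjoy_wolff_point \<phi> a"
    and "b \<in> sphere 0 1" and "\<phi> b = b" and "b \<noteq> a"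
    and "\<psi> \<in> H_infinity" and "\<exists>z\<in>unit_disk. \<psi> z \<noteq> 0"
    and "continuous_at_boundary \<psi> a" and "continuous_at_boundary \<psi> b"
    and "\<not> invertible_operator_on (bergman_space \<alpha>) (bergman_norm \<alpha>)
             (weighted_composition \<psi> \<phi>)"
  shows "operator_spectrum (bergman_space \<alpha>) (bergman_norm \<alpha>) (weighted_composition \<psi> \<phi>) =
    {\<mu>. cmod \<mu> \<le>
       max (cmod (boundary_value \<psi> a) / Re (deriv \<phi> a) powr ((\<alpha> + 2) / 2))
           (cmod (boundary_value \<psi> b) / Re (deriv \<phi> b) powr ((\<alpha> + 2) / 2))}"
proof -
  have aut: "disk_automorphism \<phi>" using assms(2) by (simp add: hyperbolic_automorphism_def)
  have a: "cmod a = 1" "\<phi> a = a" and b: "cmod b = 1" "\<phi> b = b" and ab: "a \<noteq> b"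
    using assms(3-7) by (auto simp: denjoy_wolff_point_def)
  obtain s where s0: "s > 0" and da: "deriv \<phi> a = of_real s" and db: "deriv \<phi> b = of_real (1 / s)"
    and cross: "\<And>z. z \<in> unit_disk \<Longrightarrow> (\<phi> z - b) / (\<phi> z - a) = (z - b) / (z - a) / of_real s"
    and lim_a: "(deriv \<phi> \<longlongrightarrow> deriv \<phi> a) (at a within unit_disk)"
    and lim_b: "(deriv \<phi> \<longlongrightarrow> deriv \<phi> b) (at b within unit_disk)"
    using hyperbolic_automorphism_cross_ratio[OF aut a b ab] by metis
  have disk: "disk_bijection \<phi>"
    using aut holomorphic_on_subset[OF analytic_imp_holomorphic, of \<phi> "cball 0 1" unit_disk]
    by (auto simp: disk_automorphism_def disk_bijection_def)
  define \<omega> where "\<omega> = cnj b * (a - b)"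
  have \<omega>: "\<omega> \<noteq> 0" using b ab by (auto simp: \<omega>_def)
  define w where "w z = \<omega> * ((z - b) / (z - a))" for z
  have za: "z \<noteq> a" "z \<noteq> b" if "z \<in> unit_disk" for z using that a b by auto
  note half = half_plane_coordinate[OF a(1) b(1) ab]
  have Re_w: "Re (w z) = (1 - Re (cnj b * a)) * (1 - (cmod z)\<^sup>2) / (cmod (z - a))\<^sup>2" if "z \<noteq> a" for z
    using half(1)[OF that] by (simp add: w_def \<omega>_def)
  have ReA: "Re (cnj b * a) < 1" using half(2)[of b] ab by simp
  have w_\<phi>: "w (\<phi> z) = w z / of_real s" if "z \<in> unit_disk" for z
    using cross[OF that] by (simp add: w_def)
  have norm_w: "cmod (w z) * cmod (z - a) = cmod \<omega> * cmod (z - b)" if "z \<in> unit_disk" for z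
    using za[OF that] by (simp add: w_def norm_mult norm_divide)
  \<comment> \<open>The orbit of the origin tends to \<open>a\<close>, where \<open>w\<close> is infinite; so \<open>\<phi>\<close> expands \<open>w\<close>.\<close>
  have s1: "s < 1"
  proof (rule ccontr)
    assume "\<not> s < 1"
    then have s1: "s \<ge> 1" by simp
    let ?y = "\<lambda>n. (\<phi> ^^ n) 0"
    have y: "?y n \<in> unit_disk" for n
      using disk_bijectionD(4)[OF disk_bijection_funpow[OF disk], of 0 n] by simp
    have "cmod (w (?y n)) \<le> cmod (w 0)" for n
    proof (induction n)
      case (Suc n)
      have "cmod (w (?y (Suc n))) = cmod (w (?y n)) / s" using w_\<phi>[OF y[of n]] s0 by (simp add: norm_divide)
      also have "\<dots> \<le> cmod (w (?y n))" using s1 by (simp add: divide_le_eq mult_le_cancel_left1)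
      finally show ?case using Suc by simp
    qed simp
    then have le: "cmod \<omega> * cmod (?y n - b) \<le> cmod (w 0) * cmod (?y n - a)" for n
      unfolding norm_w[OF y, symmetric] by (rule mult_right_mono) simp
    have "\<forall>K. compact K \<and> K \<subseteq> unit_disk \<longrightarrow> uniform_limit K (\<lambda>n. \<phi> ^^ n) (\<lambda>_. a) sequentially"
      using assms(4) unfolding denjoy_wolff_point_def by (elim conjE)
    from this[rule_format, of "{0}"] have lim: "?y \<longlonglongrightarrow> a" by simp
    have "(\<lambda>n. cmod \<omega> * cmod (?y n - b)) \<longlonglongrightarrow> cmod \<omega> * cmod (a - b)"
      "(\<lambda>n. cmod (w 0) * cmod (?y n - a)) \<longlonglongrightarrow> cmod (w 0) * cmod (a - a)"
      by (intro tendsto_intros lim)+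
    then have "cmod \<omega> * cmod (a - b) \<le> cmod (w 0) * cmod (a - a)"
      by (rule LIMSEQ_le) (use le in blast)
    then show False using \<omega> ab by (simp add: mult_le_0_iff)
  qed
  interpret hyperbolic_dynamics \<alpha> \<phi> w s
  proof
    show "\<alpha> > -1" "disk_bijection \<phi>" "0 < s" "s < 1" by fact+
    show "w holomorphic_on unit_disk"
      unfolding w_def using za by (intro holomorphic_intros) auto
    show "Re (w z) > 0" if z: "z \<in> unit_disk" for z
      unfolding Re_w[OF za(1)[OF z]] using ReA one_minus_norm_pos[OF z] za(1)[OF z]
      by (intro divide_pos_pos mult_pos_pos) auto
    show "w (\<phi> z) = w z / of_real s" if "z \<in> unit_disk" for z by (rule w_\<phi>[OF that])
    fix r :: real assume r: "r > 0"
    have bb: "cnj b * b = 1" using b(1) by (metis complex_norm_square mult.commute of_real_1 one_power2)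
    have "Re \<omega> < 0" using ReA bb by (simp add: \<omega>_def right_diff_distrib)
    then have d: "\<omega> - of_real r \<noteq> 0" using r by (auto simp: complex_eq_iff)
    define z where "z = (\<omega> * b - a * of_real r) / (\<omega> - of_real r)"
    have zb: "z - b = of_real r * (b - a) / (\<omega> - of_real r)" and zma: "z - a = \<omega> * (b - a) / (\<omega> - of_real r)"
      using d by (simp_all add: z_def field_simps)
    have zna: "z \<noteq> a" using zma \<omega> ab d by auto
    have wz: "w z = of_real r" unfolding w_def zb zma using \<omega> ab d by simp
    have "0 < (1 - Re (cnj b * a)) * (1 - (cmod z)\<^sup>2) / (cmod (z - a))\<^sup>2"
      using Re_w[OF zna] wz r by simp
    then have "1 - (cmod z)\<^sup>2 > 0" using ReA zna by (simp add: zero_less_divide_iff zero_less_mult_iff)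
    then have "z \<in> unit_disk" by (simp add: abs_square_less_1)
    then show "\<exists>z\<in>unit_disk. w z = of_real r" using wz by blast
  qed
  define A where "A = cmod (boundary_value \<psi> a) / Re (deriv \<phi> a) powr ((\<alpha> + 2) / 2)"
  define B where "B = cmod (boundary_value \<psi> b) / Re (deriv \<phi> b) powr ((\<alpha> + 2) / 2)"
  have gain_eq: "gain \<psi> z = cmod (\<psi> z) / cmod (deriv \<phi> z) powr ((\<alpha> + 2) / 2)" if z: "z \<in> unit_disk" for z
  proof -
    have x: "1 - (cmod z)\<^sup>2 > 0" using one_minus_norm_pos[OF z] .
    have "weight (\<phi> z) = cmod (deriv \<phi> z) powr ((\<alpha> + 2) / 2) * weight z"
      unfolding eval_weight_def disk_bijection_deriv_norm[OF disk z, symmetric] using x by (simp add: powr_mult)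
    then show ?thesis using eval_weight_pos[OF z, of \<alpha>] by (simp add: gain_def)
  qed
  have gain_lim: "(gain \<psi> \<longlongrightarrow> cmod (boundary_value \<psi> c) / Re (deriv \<phi> c) powr ((\<alpha> + 2) / 2)) (at c within unit_disk)"
    if c: "continuous_at_boundary \<psi> c" "c \<in> sphere 0 1" and t: "deriv \<phi> c = of_real t" "t > 0"
      and d: "(deriv \<phi> \<longlongrightarrow> deriv \<phi> c) (at c within unit_disk)" for c t
  proof -
    have "((\<lambda>z. cmod (\<psi> z) / cmod (deriv \<phi> z) powr ((\<alpha> + 2) / 2)) \<longlongrightarrow>
        cmod (boundary_value \<psi> c) / cmod (deriv \<phi> c) powr ((\<alpha> + 2) / 2)) (at c within unit_disk)"
      using t by (intro tendsto_intros boundary_value_tendsto[OF c] d) auto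
    moreover have "cmod (deriv \<phi> c) = Re (deriv \<phi> c)" using t by simp
    moreover have "\<forall>\<^sub>F z in at c within unit_disk. cmod (\<psi> z) / cmod (deriv \<phi> z) powr ((\<alpha> + 2) / 2) = gain \<psi> z"
      unfolding eventually_at_filter by (rule always_eventually) (use gain_eq in auto)
    ultimately show ?thesis using Lim_transform_eventually by fastforce
  qed
  have "operator_spectrum H N (wcomp \<psi>) = {\<mu>. cmod \<mu> \<le> max A B}"
  proof (rule wcomp_spectrum[OF assms(8)])
    show "A \<ge> 0" "B \<ge> 0" by (simp_all add: A_def B_def)
    show "\<not> invertible_op (wcomp \<psi>)" by fact
    fix e :: real assume e: "e > 0"
    have "(gain \<psi> \<longlongrightarrow> A) (at a within unit_disk)"
      unfolding A_def by (rule gain_lim[OF assms(10,3) da s0 lim_a])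
    then obtain d1 where d1: "d1 > 0" "\<And>z. z \<in> unit_disk \<Longrightarrow> z \<noteq> a \<Longrightarrow> dist z a < d1 \<Longrightarrow> dist (gain \<psi> z) A < e"
      using e unfolding tendsto_iff eventually_at by metis
    have "(gain \<psi> \<longlongrightarrow> B) (at b within unit_disk)"
      unfolding B_def by (rule gain_lim[OF assms(11,5) db _ lim_b]) (use s0 in simp)
    then obtain d2 where d2: "d2 > 0" "\<And>z. z \<in> unit_disk \<Longrightarrow> z \<noteq> b \<Longrightarrow> dist z b < d2 \<Longrightarrow> dist (gain \<psi> z) B < e"
      using e unfolding tendsto_iff eventually_at by metis
    define R where "R = 2 * cmod \<omega> / d1 + 2 / (cmod \<omega> * d2) + 1"
    have c\<omega>: "cmod \<omega> > 0" using \<omega> by simp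
    have R: "R > 2 * cmod \<omega> / d1" "R > 2 / (cmod \<omega> * d2)" "R > 0"
      using c\<omega> d1(1) d2(1) by (auto simp: R_def add_pos_nonneg add_nonneg_pos)
    have le2: "cmod (z - x) \<le> 2" if "z \<in> unit_disk" "cmod x = 1" for z x
      using norm_triangle_ineq4[of z x] that by simp
    show "\<exists>R>0. \<forall>z\<in>unit_disk. (cmod (w z) \<ge> R \<longrightarrow> \<bar>gain \<psi> z - A\<bar> < e) \<and> (cmod (w z) \<le> 1 / R \<longrightarrow> \<bar>gain \<psi> z - B\<bar> < e)"
    proof (intro exI[of _ R] conjI ballI impI R(3))
      fix z assume z: "z \<in> unit_disk" and wz: "cmod (w z) \<ge> R"
      have "R * cmod (z - a) \<le> cmod \<omega> * cmod (z - b)"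
        unfolding norm_w[OF z, symmetric] using wz by (rule mult_right_mono) simp
      also have "\<dots> \<le> cmod \<omega> * 2" using le2[OF z b(1)] by (intro mult_left_mono) auto
      also have "\<dots> < R * d1" using R(1) d1(1) by (simp add: pos_divide_less_eq mult.commute)
      finally have "cmod (z - a) < d1" using R(3) by simp
      then show "\<bar>gain \<psi> z - A\<bar> < e" using d1(2)[OF z za(1)[OF z]] by (simp add: dist_norm)
    next
      fix z assume z: "z \<in> unit_disk" and wz: "cmod (w z) \<le> 1 / R"
      have "cmod \<omega> * cmod (z - b) \<le> 1 / R * cmod (z - a)"
        unfolding norm_w[OF z, symmetric] using wz by (rule mult_right_mono) simp
      also have "\<dots> \<le> 1 / R * 2" using le2[OF z a(1)] R(3) by (intro mult_left_mono) auto
      also have "\<dots> < cmod \<omega> * d2"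
        using R(2,3) c\<omega> d2(1) by (simp add: field_simps)
      finally have "cmod (z - b) < d2" using c\<omega> by simp
      then show "\<bar>gain \<psi> z - B\<bar> < e" using d2(2)[OF z za(2)[OF z]] by (simp add: dist_norm)
    qed
  qed
  then show ?thesis by (simp only: A_def B_def)
qed

end
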